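(* Let $\alpha\in(0,1]$, $\tau>0$, and let $U$ be the random field on $\mathbb{S}^2$ defined in the context. Suppose that there is $\beta^*\in(0,1]$ such that $\mathcal C_0\le\widetilde D$, $\mathcal C_\ell\le\widetilde C\ell^{-\kappa_1}$ ($\ell\ge1$) and $\mathcal A_0\le\widetilde K$, $\mathcal A_\ell\le\widetilde A\ell^{-\kappa_2}$ ($\ell\ge1$), with constants $\widetilde D,\widetilde C,\widetilde K,\widetilde A>0$ and $\kappa_1,\kappa_2>2(1+\beta^* )$. Then for every $t>0$ there exists a constant $K_{\beta^*}>0$ such that for all $\boldsymbol x,\boldsymbol y\in\mathbb{S}^2$, $$\mathrm{Var}[U(\boldsymbol x,t)-U(\boldsymbol y,t)]\le K_{\beta^*}\,(\tilde d(\boldsymbol x,\boldsymbol y))^{2\beta^*},$$ where $\tilde d(\boldsymbol x,\boldsymbol y)=\arccos(\boldsymbol x\cdot\boldsymbol y)$ is the geodesic distance.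
   Context: $\mathbb{S}^2$ is the unit sphere in $\mathbb{R}^3$, $\mu$ the normalized surface measure, and $\{Y_{\ell,m}\}$ the standard orthonormal basis of complex spherical harmonics in $L_2(\mathbb{S}^2,\mu)$, with $-\Delta_{\mathbb{S}^2}Y_{\ell,m}=\lambda_\ell Y_{\ell,m}$, $\lambda_\ell=\ell(\ell+1)$. $E_\alpha(z)=\sum_{k\ge0}z^k/\Gamma(\alpha k+1)$. $\xi$ is a real-valued, centred, $2$-weakly isotropic Gaussian random field on $\mathbb{S}^2$ with Fourier coefficients $\widehat\xi_{\ell,m}=\int\xi\overline{Y_{\ell,m}}d\mu$, $\mathbb{E}[\widehat\xi_{\ell,m}\overline{\widehat\xi_{\ell',m'}}]=\mathcal C_\ell\delta_{\ell\ell'}\delta_{mm'}$. Independent of $\xi$, let $\beta^{(1)}_{\ell,m}$ ($\ell\ge0,0\le m\le\ell$), $\beta^{(2)}_{\ell,m}$ ($\ell\ge1,1\le m\le\ell$) be independent standard real Brownian motions and $\mathcal A_\ell\ge0$; set $\widehat W_{\ell,0,0}=\sqrt{\mathcal A_\ell}\beta^{(1)}_{\ell,0}$, $\widehat W_{\ell,m,0}=\sqrt{\mathcal A_\ell/2}(\beta^{(1)}_{\ell,m}-\mathrm{i}\beta^{(2)}_{\ell,m})$ for $m\ge1$, $\widehat W_{\ell,m,0}=(-1)^m\sqrt{\mathcal A_\ell/2}(\beta^{(1)}_{\ell,|m|}+\mathrm{i}\beta^{(2)}_{\ell,|m|})$ for $m\le-1$. $U(t)=U^H(t)+U^I(t)$,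 with $U^H(t)=\sum_{\ell,m}E_\alpha(-\lambda_\ell t^\alpha)\widehat\xi_{\ell,m}Y_{\ell,m}$, $U^I(t)=0$ for $t\le\tau$ and $U^I(t)=\sum_{\ell,m}\big(\int_0^{t-\tau}E_\alpha(-\lambda_\ell(t-\tau-s)^\alpha)d\widehat W_{\ell,m,0}(s)\big)Y_{\ell,m}$ for $t>\tau$ (Itô integrals); $U(\boldsymbol x,t)$ denotes the value of this series at $\boldsymbol x$. *)

theory Defs
  imports "HOL-Probability.Probability"
begin

definition mittag_leffler :: "real \<Rightarrow> real \<Rightarrow> real" where
  "mittag_leffler \<alpha> z = (\<Sum>k. z ^ k / Gamma (\<alpha> * real k + 1))"

abbreviation S2 :: "(real^3) set" where
  "S2 \<equiv> sphere 0 1"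

text \<open>Normalized surface measure on S2, realised as the cone measure:
  mu(A) = vol{x in unit ball, x/|x| in A} / vol(unit ball).\<close>
definition S2_measure :: "(real^3) measure" where
  "S2_measure = distr (uniform_measure lborel (ball 0 1)) (restrict_space borel S2) sgn"

definition geodesic_dist :: "real^3 \<Rightarrow> real^3 \<Rightarrow> real" where
  "geodesic_dist x y = arccos (x \<bullet> y)"

section \<open>Complex spherical harmonics (Condon-Shortley phase, normalized w.r.t. S2_measure)\<close>

definition legendreP :: "nat \<Rightarrow> real \<Rightarrow> real" where
  "legendreP l z = (1 / 2 ^ l) *
     (\<Sum>k\<le>l div 2. (-1) ^ k * real (l choose k) * real ((2*l - 2*k) choose l) * z ^ (l - 2*k))"

text \<open>For m \<ge> 0, with x = (sin th cos ph, sin th sin ph, cos th):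
  Y_{l,m}(x) = sqrt((2l+1)(l-m)!/(l+m)!) (-1)^m (1-z^2)^{m/2} P_l^{(m)}(z) e^{i m ph}, z = cos th,
  and (1-z^2)^{m/2} e^{i m ph} = (x1 + i x2)^m.  For m < 0: Y_{l,m} = (-1)^m conj Y_{l,-m}.\<close>
definition sph_harm_nonneg :: "nat \<Rightarrow> nat \<Rightarrow> real^3 \<Rightarrow> complex" where
  "sph_harm_nonneg l m x =
     complex_of_real (sqrt ((2 * real l + 1) * fact (l - m) / fact (l + m)) * (-1) ^ m
        * (deriv ^^ m) (legendreP l) (x$3))
     * (Complex (x$1) (x$2)) ^ m"

definition sph_harm :: "nat \<Rightarrow> int \<Rightarrow> real^3 \<Rightarrow> complex" where
  "sph_harm l m x =
     (if 0 \<le> m then sph_harm_nonneg l (nat m) x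
      else (-1) ^ nat (- m) * cnj (sph_harm_nonneg l (nat (- m)) x))"

definition eigval :: "nat \<Rightarrow> real" where
  "eigval l = real l * (real l + 1)"

definition gaussian_rv :: "'w measure \<Rightarrow> ('w \<Rightarrow> real) \<Rightarrow> bool" where
  "gaussian_rv M X \<longleftrightarrow> X \<in> borel_measurable M \<and>
     (\<exists>m s. s \<ge> 0 \<and>
        (if s = 0 then (AE \<omega> in M. X \<omega> = m)
         else distributed M lborel X (\<lambda>z. ennreal (normal_density m s z))))"

definition gaussian_field :: "'w measure \<Rightarrow> (real^3 \<Rightarrow> 'w \<Rightarrow> real) \<Rightarrow> bool" where
  "gaussian_field M \<xi> \<longleftrightarrow>
     (\<forall>(xs :: (real^3) list) (cs :: real list). set xs \<subseteq> S2 \<longrightarrow> length cs = length xs \<longrightarrow>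
        gaussian_rv M (\<lambda>\<omega>. \<Sum>i<length xs. cs ! i * \<xi> (xs ! i) \<omega>))"

definition centred_field :: "'w measure \<Rightarrow> (real^3 \<Rightarrow> 'w \<Rightarrow> real) \<Rightarrow> bool" where
  "centred_field M \<xi> \<longleftrightarrow> (\<forall>x\<in>S2. integrable M (\<xi> x) \<and> (\<integral>\<omega>. \<xi> x \<omega> \<partial>M) = 0)"

definition rotation3 :: "real^3^3 \<Rightarrow> bool" where
  "rotation3 R \<longleftrightarrow> orthogonal_matrix R \<and> det R = 1"

definition weakly_isotropic2 :: "'w measure \<Rightarrow> (real^3 \<Rightarrow> 'w \<Rightarrow> real) \<Rightarrow> bool" where
  "weakly_isotropic2 M \<xi> \<longleftrightarrow>
     (\<forall>x\<in>S2. \<xi> x \<in> borel_measurable M \<and> integrable M (\<lambda>\<omega>. (\<xi> x \<omega>)\<^sup>2)) \<and>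
     (\<forall>R x y. rotation3 R \<longrightarrow> x \<in> S2 \<longrightarrow> y \<in> S2 \<longrightarrow>
        (\<integral>\<omega>. \<xi> (R *v x) \<omega> \<partial>M) = (\<integral>\<omega>. \<xi> x \<omega> \<partial>M) \<and>
        (\<integral>\<omega>. \<xi> (R *v x) \<omega> * \<xi> (R *v y) \<omega> \<partial>M) = (\<integral>\<omega>. \<xi> x \<omega> * \<xi> y \<omega> \<partial>M))"

definition fourier_coeff :: "(real^3 \<Rightarrow> 'w \<Rightarrow> real) \<Rightarrow> nat \<Rightarrow> int \<Rightarrow> 'w \<Rightarrow> complex" where
  "fourier_coeff \<xi> l m \<omega> =
     (\<integral>x. complex_of_real (\<xi> x \<omega>) * cnj (sph_harm l m x) \<partial>S2_measure)"

definition std_brownian_motion :: "'w measure \<Rightarrow> (real \<Rightarrow> 'w \<Rightarrow> real) \<Rightarrow> bool" where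
  "std_brownian_motion M b \<longleftrightarrow>
     (\<forall>t\<ge>0. b t \<in> borel_measurable M) \<and>
     (AE \<omega> in M. b 0 \<omega> = 0) \<and>
     (\<forall>s t. 0 \<le> s \<and> s < t \<longrightarrow>
        distributed M lborel (\<lambda>\<omega>. b t \<omega> - b s \<omega>) (\<lambda>z. ennreal (normal_density 0 (sqrt (t - s)) z))) \<and>
     (\<forall>ts :: real list. sorted ts \<and> (\<forall>t\<in>set ts. 0 \<le> t) \<longrightarrow>
        prob_space.indep_vars M (\<lambda>_. borel) (\<lambda>i \<omega>. b (ts ! Suc i) \<omega> - b (ts ! i) \<omega>) {..<length ts - 1}) \<and>
     (AE \<omega> in M. continuous_on {0..} (\<lambda>t. b t \<omega>))"

definition indep_elems :: "'w measure \<Rightarrow> 'a measure \<Rightarrow> ('w \<Rightarrow> 'a) \<Rightarrow> 'b measure \<Rightarrow> ('w \<Rightarrow> 'b) \<Rightarrow> bool" where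
  "indep_elems M S X T Y \<longleftrightarrow>
     X \<in> measurable M S \<and> Y \<in> measurable M T \<and>
     prob_space.indep_set M
       (sigma_sets (space M) {X -` A \<inter> space M | A. A \<in> sets S})
       (sigma_sets (space M) {Y -` A \<inter> space M | A. A \<in> sets T})"

text \<open>Index set of the driving Brownian motions: Inl (l,m) for beta^(1)_{l,m} (0 \<le> m \<le> l),
  Inr (l,m) for beta^(2)_{l,m} (1 \<le> m \<le> l).\<close>
definition bm_index :: "((nat \<times> nat) + (nat \<times> nat)) set" where
  "bm_index = Inl ` {(l, m). m \<le> l} \<union> Inr ` {(l, m). 1 \<le> m \<and> m \<le> l}"

definition bm_family ::
  "(nat \<Rightarrow> nat \<Rightarrow> real \<Rightarrow> 'w \<Rightarrow> real) \<Rightarrow> (nat \<Rightarrow> nat \<Rightarrow> real \<Rightarrow> 'w \<Rightarrow> real)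
     \<Rightarrow> (nat \<times> nat) + (nat \<times> nat) \<Rightarrow> real \<Rightarrow> 'w \<Rightarrow> real" where
  "bm_family \<beta>1 \<beta>2 i = (case i of Inl (l, m) \<Rightarrow> \<beta>1 l m | Inr (l, m) \<Rightarrow> \<beta>2 l m)"

definition W_coeff ::
  "(nat \<Rightarrow> real) \<Rightarrow> (nat \<Rightarrow> nat \<Rightarrow> real \<Rightarrow> 'w \<Rightarrow> real) \<Rightarrow> (nat \<Rightarrow> nat \<Rightarrow> real \<Rightarrow> 'w \<Rightarrow> real)
     \<Rightarrow> nat \<Rightarrow> int \<Rightarrow> real \<Rightarrow> 'w \<Rightarrow> complex" where
  "W_coeff A \<beta>1 \<beta>2 l m t \<omega> =
     (if m = 0 then complex_of_real (sqrt (A l) * \<beta>1 l 0 t \<omega>)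
      else if m > 0 then complex_of_real (sqrt (A l / 2)) *
             Complex (\<beta>1 l (nat m) t \<omega>) (- \<beta>2 l (nat m) t \<omega>)
      else (-1) ^ nat (- m) * complex_of_real (sqrt (A l / 2)) *
             Complex (\<beta>1 l (nat (- m)) t \<omega>) (\<beta>2 l (nat (- m)) t \<omega>))"

text \<open>Ito integral over [0,T] of a deterministic continuous integrand f against a (complex)
  process W: the L2(M)-limit of the left-point Riemann-Ito sums on uniform partitions.\<close>
definition ito_riemann_sum ::
  "(real \<Rightarrow> real) \<Rightarrow> (real \<Rightarrow> 'w \<Rightarrow> complex) \<Rightarrow> real \<Rightarrow> nat \<Rightarrow> 'w \<Rightarrow> complex" where
  "ito_riemann_sum f W T n \<omega> =
     (\<Sum>k<Suc n. complex_of_real (f (real k * T / real (Suc n))) *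
        (W (real (Suc k) * T / real (Suc n)) \<omega> - W (real k * T / real (Suc n)) \<omega>))"

definition L2_limit :: "'w measure \<Rightarrow> (nat \<Rightarrow> 'w \<Rightarrow> complex) \<Rightarrow> 'w \<Rightarrow> complex" where
  "L2_limit M S = (SOME X. X \<in> borel_measurable M \<and>
      ((\<lambda>n. \<integral>\<^sup>+ \<omega>. ennreal ((cmod (S n \<omega> - X \<omega>))\<^sup>2) \<partial>M) \<longlonglongrightarrow> 0))"

definition ito_integral ::
  "'w measure \<Rightarrow> (real \<Rightarrow> real) \<Rightarrow> (real \<Rightarrow> 'w \<Rightarrow> complex) \<Rightarrow> real \<Rightarrow> 'w \<Rightarrow> complex" where
  "ito_integral M f W T = L2_limit M (ito_riemann_sum f W T)"

definition U_coeff ::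
  "'w measure \<Rightarrow> real \<Rightarrow> real \<Rightarrow> (real^3 \<Rightarrow> 'w \<Rightarrow> real) \<Rightarrow> (nat \<Rightarrow> real)
     \<Rightarrow> (nat \<Rightarrow> nat \<Rightarrow> real \<Rightarrow> 'w \<Rightarrow> real) \<Rightarrow> (nat \<Rightarrow> nat \<Rightarrow> real \<Rightarrow> 'w \<Rightarrow> real)
     \<Rightarrow> nat \<Rightarrow> int \<Rightarrow> real \<Rightarrow> 'w \<Rightarrow> complex" where
  "U_coeff M \<alpha> \<tau> \<xi> A \<beta>1 \<beta>2 l m t \<omega> =
     complex_of_real (mittag_leffler \<alpha> (- eigval l * t powr \<alpha>)) * fourier_coeff \<xi> l m \<omega>
     + (if t \<le> \<tau> then 0
        else ito_integral M (\<lambda>s. mittag_leffler \<alpha> (- eigval l * (t - \<tau> - s) powr \<alpha>))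
               (W_coeff A \<beta>1 \<beta>2 l m) (t - \<tau>) \<omega>)"

definition U_partial ::
  "'w measure \<Rightarrow> real \<Rightarrow> real \<Rightarrow> (real^3 \<Rightarrow> 'w \<Rightarrow> real) \<Rightarrow> (nat \<Rightarrow> real)
     \<Rightarrow> (nat \<Rightarrow> nat \<Rightarrow> real \<Rightarrow> 'w \<Rightarrow> real) \<Rightarrow> (nat \<Rightarrow> nat \<Rightarrow> real \<Rightarrow> 'w \<Rightarrow> real)
     \<Rightarrow> real^3 \<Rightarrow> real \<Rightarrow> nat \<Rightarrow> 'w \<Rightarrow> complex" where
  "U_partial M \<alpha> \<tau> \<xi> A \<beta>1 \<beta>2 x t L \<omega> =
     (\<Sum>l<L. \<Sum>m\<in>{- int l..int l}. U_coeff M \<alpha> \<tau> \<xi> A \<beta>1 \<beta>2 l m t \<omega> * sph_harm l m x)"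

definition U_field ::
  "'w measure \<Rightarrow> real \<Rightarrow> real \<Rightarrow> (real^3 \<Rightarrow> 'w \<Rightarrow> real) \<Rightarrow> (nat \<Rightarrow> real)
     \<Rightarrow> (nat \<Rightarrow> nat \<Rightarrow> real \<Rightarrow> 'w \<Rightarrow> real) \<Rightarrow> (nat \<Rightarrow> nat \<Rightarrow> real \<Rightarrow> 'w \<Rightarrow> real)
     \<Rightarrow> real^3 \<Rightarrow> real \<Rightarrow> 'w \<Rightarrow> complex" where
  "U_field M \<alpha> \<tau> \<xi> A \<beta>1 \<beta>2 x t = L2_limit M (U_partial M \<alpha> \<tau> \<xi> A \<beta>1 \<beta>2 x t)"

end

theory Submission
  imports Defs "HOL-Computational_Algebra.Polynomial" "HOL-Real_Asymp.Real_Asymp"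
begin

text \<open>
  The coefficients of \<open>U\<close> are, up to bounded factors, orthogonal in mean square with second moment
  \<open>O(C\<^sub>l + A\<^sub>l)\<close>: the function \<open>E\<^sub>\<alpha>\<close> takes values in \<open>[0, 1]\<close> on the negative axis, as a limit of a
  discretised fractional relaxation equation for which this is a maximum principle. Hence the variance
  of an increment is at most a constant times
  \<open>\<Sum>\<^sub>l (C\<^sub>l + A\<^sub>l) \<Sum>\<^sub>m |Y\<^sub>l\<^sub>m(x) - Y\<^sub>l\<^sub>m(y)|\<^sup>2\<close>. The inner sum is \<open>O(l)\<close>, because \<open>\<Sum>\<^sub>m |Y\<^sub>l\<^sub>m|\<^sup>2 = 2 l + 1\<close>, and
  \<open>O(l\<^sup>3 d\<^sup>2)\<close> for the geodesic distance \<open>d\<close>, because along a rotation the derivative of the vector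
  \<open>(Y\<^sub>l\<^sub>m)\<^sub>m\<close> is given by the ladder operators, of norm \<open>O(l)\<close>. Interpolation yields
  \<open>O(l\<^sup>1\<^sup>+\<^sup>2\<^sup>\<beta> d\<^sup>2\<^sup>\<beta>)\<close>, which is summable against \<open>l\<^sup>-\<^sup>\<kappa>\<close> exactly when \<open>\<kappa> > 2 (1 + \<beta>)\<close>.
\<close>

section \<open>Bounds for the Mittag-Leffler function\<close>

text \<open>\<open>shifted_binomial s n\<close> is the binomial coefficient (s + n choose n), the
  grid analogue of x^s / Gamma(s + 1). Putting it in place of each power of time in the series of
  E_alpha gives the exact solution of an implicit difference scheme; the price is a majorant of that
  series which is uniform in the mesh.

  The Ito integrals and the values of U are picked by \<open>SOME\<close> as mean-square limits, so
  nothing can be said about them until such limits are shown to exist. This is why completeness of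
  L2 is proved for \<open>nn_sq\<close>, and why every estimate is made for Riemann sums or partial
  sums and only then carried to the limit. Sums of two random terms are handled by |a + b|^2 <= 2
  |a|^2 + 2 |b|^2, the source of the powers of 2 in the constants; only the orders in l and d
  matter.\<close>

definition shifted_binomial :: "real \<Rightarrow> nat \<Rightarrow> real" where
  "shifted_binomial s n = pochhammer (s + 1) n / fact n"

lemma pochhammer_nonneg_real: "0 \<le> (x::real) \<Longrightarrow> 0 \<le> pochhammer x n"
  by (induction n) (auto simp: pochhammer_Suc)

lemma shifted_binomial_0 [simp]: "shifted_binomial s 0 = 1"
  by (simp add: shifted_binomial_def)

lemma shifted_binomial_zero_left [simp]: "shifted_binomial 0 n = 1"
  by (simp add: shifted_binomial_def pochhammer_fact[symmetric])

lemma shifted_binomial_Suc: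
  "shifted_binomial s (Suc n) = shifted_binomial s n * (1 + s / real (Suc n))"
  by (simp add: shifted_binomial_def pochhammer_Suc field_simps)

lemma shifted_binomial_nonneg: "-1 \<le> s \<Longrightarrow> 0 \<le> shifted_binomial s n"
  unfolding shifted_binomial_def by (intro divide_nonneg_nonneg) (simp_all add: pochhammer_nonneg_real)

lemma shifted_binomial_mono_right:
  assumes "0 \<le> s" "m \<le> n"
  shows "shifted_binomial s m \<le> shifted_binomial s n"
proof (rule lift_Suc_mono_le[OF _ assms(2)])
  fix k
  show "shifted_binomial s k \<le> shifted_binomial s (Suc k)"
    using assms(1) shifted_binomial_nonneg[of s k] by (simp add: shifted_binomial_Suc mult_le_cancel_left1)
qed

text \<open>Holds factor by factor, since 1 + (p + r) / k <= (1 + p / k) (1 + r / k). It serves to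
  split an exponent into its integer and fractional parts.\<close>

lemma shifted_binomial_add_le:
  assumes "0 \<le> p" "0 \<le> r"
  shows "shifted_binomial (p + r) n \<le> shifted_binomial p n * shifted_binomial r n"
proof (induction n)
  case (Suc n)
  have "(1 + (p + r) / real (Suc n)) \<le> (1 + p / real (Suc n)) * (1 + r / real (Suc n))"
    using assms by (simp add: algebra_simps add_divide_distrib)
  then have "shifted_binomial (p + r) n * (1 + (p + r) / real (Suc n))
     \<le> (shifted_binomial p n * shifted_binomial r n) * ((1 + p / real (Suc n)) * (1 + r / real (Suc n)))"
    using Suc assms shifted_binomial_nonneg[of p n] shifted_binomial_nonneg[of r n]
    by (intro mult_mono) auto
  then show ?case by (simp add: shifted_binomial_Suc mult_ac)
qed simp

text \<open>Each factor 1 + r / (k + 1) is at most ((k + 1) / k)^r, and these powers telescope; the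
  constant 2 bounds the initial factor 1 + r.\<close>

lemma shifted_binomial_frac_le:
  assumes "0 \<le> r" "r \<le> 1"
  shows "shifted_binomial r (Suc n) \<le> 2 * real (Suc n) powr r"
proof (induction n)
  case 0
  then show ?case using assms by (simp add: shifted_binomial_Suc)
next
  case (Suc n)
  let ?m = "real (Suc n)"
  \<comment> \<open>The inequality ln q <= q - 1 is used at q = m / (m + 1), which bounds the
    logarithm of the inverse quotient from below.\<close>
  have "1 - ?m / (?m + 1) \<le> ln ((?m + 1) / ?m)"
    using ln_le_minus_one[of "?m / (?m + 1)"] by (simp add: ln_div)
  then have "r * (1 - ?m / (?m + 1)) \<le> r * ln ((?m + 1) / ?m)"
    using assms by (intro mult_left_mono)
  moreover have "r * (1 - ?m / (?m + 1)) = r / (?m + 1)" by (simp add: field_simps)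
  ultimately have "r / (?m + 1) \<le> r * ln ((?m + 1) / ?m)" by simp
  then have "1 + r / (?m + 1) \<le> ((?m + 1) / ?m) powr r"
  proof -
    have "1 + r / (?m + 1) \<le> 1 + r * ln ((?m + 1) / ?m)"
      using \<open>r / (?m + 1) \<le> r * ln ((?m + 1) / ?m)\<close> by (rule add_left_mono)
    also have "\<dots> \<le> exp (r * ln ((?m + 1) / ?m))" by (rule exp_ge_add_one_self)
    finally show ?thesis by (simp add: powr_def)
  qed
  then have "shifted_binomial r (Suc n) * (1 + r / (?m + 1))
      \<le> (2 * ?m powr r) * ((?m + 1) / ?m) powr r"
    using Suc assms by (intro mult_mono) auto
  also have "\<dots> = 2 * (?m + 1) powr r"
    by (simp add: powr_divide)
  finally show ?case by (subst shifted_binomial_Suc) (simp add: add.commute)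
qed

lemma shifted_binomial_Suc_left:
  "shifted_binomial (real (Suc p)) n = shifted_binomial (real p) n * ((real p + 1 + real n) / (real p + 1))"
proof -
  have "(real p + 1) * pochhammer (real p + 1 + 1) n = pochhammer (real p + 1) n * (real p + 1 + real n)"
    using pochhammer_rec[of "real p + 1" n] pochhammer_Suc[of "real p + 1" n] by simp
  moreover have "real (Suc p) + 1 = real p + 1 + 1" by simp
  ultimately have "pochhammer (real (Suc p) + 1) n = pochhammer (real p + 1) n * (real p + 1 + real n) / (real p + 1)"
    by (simp only: eq_divide_eq mult.commute[of _ "real p + 1"]) simp
  then show ?thesis
    by (simp add: shifted_binomial_def)
qed

text \<open>Raising p by one multiplies the left side by 1 / n + 1 / (p + 1). This is at most 2
  always and at most 2 / N once p and n have reached N, so \<open>real N ^ min p N\<close> repairs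
  the first N steps. The free parameter N makes the ratio 2 / N as small as desired.\<close>

lemma shifted_binomial_nat_le:
  assumes "1 \<le> N" "N \<le> n"
  shows "shifted_binomial (real p) n / real n ^ p \<le> (2 / real N) ^ p * real N ^ min p N"
proof (induction p)
  case (Suc p)
  have f: "(real p + 1 + real n) / (real p + 1) / real n \<le> 2 / real N * (if p < N then real N else 1)"
  proof -
    have e: "(real p + 1 + real n) / (real p + 1) / real n = 1 / real n + 1 / (real p + 1)"
      using assms by (simp add: field_simps)
    have n: "1 / real n \<le> 1 / real N" using assms by (intro divide_left_mono) auto
    show ?thesis
    proof (cases "p < N")
      case True
      have "1 / real n \<le> 1" "1 / (real p + 1) \<le> 1" using assms by auto
      then have "1 / real n + 1 / (real p + 1) \<le> 2" by linarith
      then show ?thesis using True assms unfolding e by simp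
    next
      case False
      then have "1 / (real p + 1) \<le> 1 / real N" using assms by (intro divide_left_mono) auto
      then show ?thesis using n False unfolding e by simp
    qed
  qed
  have "shifted_binomial (real (Suc p)) n / real n ^ Suc p
      = shifted_binomial (real p) n / real n ^ p * ((real p + 1 + real n) / (real p + 1) / real n)"
    unfolding shifted_binomial_Suc_left by simp
  also have "\<dots> \<le> ((2 / real N) ^ p * real N ^ min p N) * (2 / real N * (if p < N then real N else 1))"
    by (rule mult_mono[OF Suc f]) auto
  also have "\<dots> = (2 / real N) ^ Suc p * real N ^ min (Suc p) N"
    by (cases "p < N") (simp_all add: min_def not_less_eq_eq[symmetric])
  finally show ?case .
qed simp

text \<open>A majorant uniform in n and geometric in s, with ratio 2 / N. With s = a k it dominates
  the terms of the scheme, however large the argument x is.\<close>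

lemma shifted_binomial_le:
  assumes "0 \<le> s" "2 \<le> N" "N \<le> n"
  shows "shifted_binomial s n / real n powr s \<le> real N ^ Suc N * (2 / real N) powr s"
proof -
  define p where "p = nat \<lfloor>s\<rfloor>"
  define r where "r = s - real p"
  have r: "0 \<le> r" "r \<le> 1" "s = real p + r" 
    using assms unfolding p_def r_def by linarith+
  have n: "real n > 0" "n = Suc (n - 1)" using assms by auto
  have "shifted_binomial s n \<le> shifted_binomial (real p) n * (2 * real n powr r)"
    using shifted_binomial_add_le[of "real p" r n] shifted_binomial_frac_le[of r "n - 1"] r n
    by (smt (verit) mult_left_mono of_nat_0_le_iff shifted_binomial_nonneg)
  then have "shifted_binomial s n / real n powr s \<le> 2 * (shifted_binomial (real p) n / real n ^ p)"
    using n by (simp add: r(3) powr_add powr_realpow field_simps)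
  also have "\<dots> \<le> 2 * ((2 / real N) ^ p * real N ^ min p N)"
    using assms by (intro mult_left_mono shifted_binomial_nat_le) auto
  also have "\<dots> \<le> 2 * ((2 / real N) ^ p * real N ^ N)"
    using assms by (intro mult_left_mono power_increasing) auto
  also have "(2 / real N) ^ p = (2 / real N) powr (real p)"
    using assms by (simp add: powr_realpow)
  \<comment> \<open>The factor 2 is N times 2 / N. The latter raises the exponent to p + 1, which is
    at least s, and 2 / N <= 1 then allows s in its place.\<close>
  also have "2 * ((2 / real N) powr (real p) * real N ^ N) = real N ^ Suc N * (2 / real N) powr (real p + 1)"
    using assms by (simp add: powr_add field_simps)
  also have "\<dots> \<le> real N ^ Suc N * (2 / real N) powr s"
    using assms r by (intro mult_left_mono powr_mono') auto
  finally show ?thesis .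
qed

text \<open>Gauss's product for 1 / Gamma(s + 1). \<open>rGamma_series\<close> carries one more
  Pochhammer factor and one more power of n, which the quotient n / (n + s + 1) removes.\<close>

lemma shifted_binomial_LIMSEQ:
  assumes "0 \<le> s"
  shows "(\<lambda>n. shifted_binomial s n / real n powr s) \<longlonglongrightarrow> 1 / Gamma (s + 1)"
proof -
  have "(\<lambda>n. rGamma_series (s + 1) n * (real n / (real n + (s + 1)))) \<longlonglongrightarrow> rGamma (s + 1) * 1"
  proof (intro tendsto_mult rGamma_series_LIMSEQ)
    show "(\<lambda>n. real n / (real n + (s + 1))) \<longlonglongrightarrow> 1" by real_asymp
  qed
  moreover have "eventually (\<lambda>n. rGamma_series (s + 1) n * (real n / (real n + (s + 1)))
      = shifted_binomial s n / real n powr s) sequentially"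
    using eventually_gt_at_top[of 0]
  proof eventually_elim
    case (elim n)
    have nz: "real n + (s + 1) \<noteq> 0" using assms by linarith
    have e: "exp ((s + 1) * of_real (ln (real n))) = real n powr s * real n"
      using elim by (simp add: powr_def exp_add distrib_right)
    have p: "pochhammer (s + 1) (n + 1) = pochhammer (s + 1) n * (real n + (s + 1))"
      by (simp add: pochhammer_Suc add_ac)
    show ?case
      unfolding rGamma_series_def shifted_binomial_def p e
      using elim nz by simp
  qed
  ultimately show ?thesis
    by (simp add: rGamma_inverse_Gamma inverse_eq_divide filterlim_cong)
qed

section \<open>Gruenwald--Letnikov differences and their maximum principle\<close>

lemma shifted_binomial_gbinomial: "shifted_binomial s n = (-1) ^ n * ((- s - 1) gchoose n)"
  by (simp add: shifted_binomial_def gbinomial_pochhammer field_simps flip: power_add)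

text \<open>The Gruenwald--Letnikov difference of order \<open>a\<close> in the variable \<open>n\<close> lowers \<open>s\<close> by \<open>a\<close>, as the
  fractional derivative does with the power \<open>x\<^sup>s / \<Gamma>(s + 1)\<close>.\<close>

lemma shifted_binomial_Vandermonde:
  "(\<Sum>j\<le>n. (-1) ^ j * (a gchoose j) * shifted_binomial s (n - j)) = shifted_binomial (s - a) n"
proof -
  have "(\<Sum>j\<le>n. (-1) ^ j * (a gchoose j) * shifted_binomial s (n - j))
      = (\<Sum>j\<le>n. (-1) ^ n * ((a gchoose j) * ((- s - 1) gchoose (n - j))))"
    by (intro sum.cong refl) (auto simp: shifted_binomial_gbinomial simp flip: power_add)
  also have "\<dots> = (-1) ^ n * ((a + (- s - 1)) gchoose n)"
    using gbinomial_Vandermonde[of a "- s - 1" n] by (simp add: atLeast0AtMost flip: sum_distrib_left)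
  finally show ?thesis by (simp add: shifted_binomial_gbinomial algebra_simps)
qed

text \<open>In the Pochhammer symbol of -a only the first factor -a is negative; the others are i -
  a with i >= 1, nonnegative because a <= 1.\<close>

lemma signed_gbinomial_nonpos:
  assumes "0 < a" "a \<le> 1" "0 < j"
  shows "(-1) ^ j * (a gchoose j) \<le> (0::real)"
proof -
  obtain i where j: "j = Suc i" using assms by (cases j) auto
  have "(-1) ^ j * (a gchoose j) = pochhammer (- a) j / fact j"
    by (simp add: gbinomial_pochhammer flip: power_add)
  also have "\<dots> = - (a * pochhammer (1 - a) i / fact j)"
    by (simp add: j pochhammer_rec)
  also have "\<dots> \<le> 0"
    using assms by (simp add: pochhammer_nonneg_real)
  finally show ?thesis .
qed

text \<open>The implicit Gruenwald--Letnikov scheme for the fractional relaxation equation: since the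
  coefficients \<open>(-1)^j (a choose j)\<close> are nonpositive for \<open>j > 0\<close>, each value is a subconvex combination
  of the preceding ones and of the initial value 1.\<close>

lemma fractional_relaxation_bounds:
  fixes h a :: real
  assumes a: "0 < a" "a \<le> 1" and h: "0 < h"
    and summ: "\<And>j. j \<le> n \<Longrightarrow> summable (\<lambda>k. (- h) ^ k * shifted_binomial (a * real k) j)"
  shows "(\<Sum>k. (- h) ^ k * shifted_binomial (a * real k) n) \<in> {0..1}"
  using summ
proof (induction n rule: less_induct)
  case (less n)
  define u where "u j = (\<Sum>k. (- h) ^ k * shifted_binomial (a * real k) j)" for j
  define g where "g j = (-1) ^ j * (a gchoose j)" for j
  have g0: "g 0 = 1" by (simp add: g_def)
  have g: "g j \<le> 0" if "j > 0" for j
    using signed_gbinomial_nonpos[OF a that] by (simp add: g_def)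
  have IH: "u j \<in> {0..1}" if "j < n" for j
    unfolding u_def using that less.prems by (intro less.IH) auto
  have split: "sum f {..n} = f 0 + sum f {1..n}" for f :: "nat \<Rightarrow> real"
    by (simp add: sum.atLeast1_atMost_eq sum.atMost_shift)
  \<comment> \<open>The case s = 0 of the Vandermonde identity: partial sums of the weights are
    again shifted binomials.\<close>
  have b: "(\<Sum>j\<le>n. g j) = shifted_binomial (- a) n"
    using shifted_binomial_Vandermonde[of a 0 n] by (simp add: g_def)
  have "(\<Sum>j\<le>n. g j * u (n - j)) = (\<Sum>j\<le>n. \<Sum>k. g j * ((- h) ^ k * shifted_binomial (a * real k) (n - j)))"
    unfolding u_def using less.prems by (intro sum.cong refl suminf_mult[symmetric]) auto
  also have "\<dots> = (\<Sum>k. \<Sum>j\<le>n. g j * ((- h) ^ k * shifted_binomial (a * real k) (n - j)))"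
    using less.prems by (intro suminf_sum[symmetric] summable_mult) auto
  also have "\<dots> = (\<Sum>k. (- h) ^ k * shifted_binomial (a * real k - a) n)"
    unfolding shifted_binomial_Vandermonde[symmetric] g_def
    by (intro suminf_cong) (simp add: sum_distrib_left mult_ac)
  \<comment> \<open>Lowering the exponent a k by a turns the k-th term into -h times the term of
    index k - 1 of \<open>u n\<close>; only k = 0 has no predecessor and leaves
    \<open>shifted_binomial (- a) n\<close>.\<close>
  also have "\<dots> = shifted_binomial (- a) n - h * u n"
  proof -
    have s: "summable (\<lambda>k. (-h) * ((- h) ^ k * shifted_binomial (a * real k) n))"
      using less.prems by (intro summable_mult) auto
    then have "(\<lambda>k. (- h) ^ Suc k * shifted_binomial (a * real (Suc k) - a) n) sums (- h * u n)"
      unfolding u_def using less.prems[of n]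
      by (subst suminf_mult[symmetric]) (auto dest!: summable_sums simp: algebra_simps)
    then have "(\<lambda>k. (- h) ^ k * shifted_binomial (a * real k - a) n) sums (- h * u n + shifted_binomial (- a) n)"
      by (subst (asm) sums_Suc_iff) simp
    then show ?thesis by (simp add: sums_iff)
  qed
  finally have eq: "(1 + h) * u n = shifted_binomial (- a) n + (\<Sum>j=1..n. - g j * u (n - j))"
    unfolding split by (simp add: g0 sum_negf algebra_simps)
  have lo: "0 \<le> (\<Sum>j=1..n. - g j * u (n - j))"
    using IH g by (intro sum_nonneg mult_nonneg_nonneg) (auto simp: atLeastAtMost_iff)
  \<comment> \<open>Once the earlier values are replaced by 1, the weights sum to the complement of
    \<open>shifted_binomial (- a) n\<close>, so that (1 + h) \<open>u n\<close> is at most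
    1.\<close>
  have "(\<Sum>j=1..n. - g j * u (n - j)) \<le> (\<Sum>j=1..n. - g j * 1)"
    using IH g by (intro sum_mono mult_left_mono) (auto simp: atLeastAtMost_iff)
  also have "\<dots> = 1 - shifted_binomial (- a) n"
    using b unfolding split by (simp add: g0 sum_negf)
  finally have "(1 + h) * u n \<le> 1" "0 \<le> (1 + h) * u n"
    using eq lo shifted_binomial_nonneg[of "- a" n] a by simp_all
  then have "0 \<le> u n" "u n \<le> 1"
    using h by (smt (verit) mult_less_cancel_right2 zero_le_mult_iff mult_right_mono)+
  then show ?case by (simp add: u_def)
qed

text \<open>E_alpha(-x) is the value of the fractional relaxation at time x^(1/a), and n implicit
  steps of length x^(1/a) / n correspond to h = x / n^a. For large n the sums over k lie in [0, 1];
  by Tannery's theorem they converge to the series, and its majorant also gives absolute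
  summability.\<close>

lemma
  assumes a: "0 < a" "a \<le> 1" and x: "0 < x"
  shows summable_mittag_leffler: "summable (\<lambda>k. norm ((- x) ^ k / Gamma (a * real k + 1)))"
    and mittag_leffler_neg_bounds: "mittag_leffler a (- x) \<in> {0..1}"
proof -
  \<comment> \<open>N is taken so large that the ratio in \<open>shifted_binomial_le\<close>
    outweighs x, which leaves a multiple of 2^(-k) as majorant.\<close>
  obtain N :: nat where N: "2 \<le> N" "x * (2 / real N) powr a \<le> 1 / 2"
  proof -
    have "(\<lambda>N. x * (2 / real N) powr a) \<longlonglongrightarrow> 0" using a by real_asymp
    then have "eventually (\<lambda>N. x * (2 / real N) powr a < 1 / 2) sequentially"
      by (rule order_tendstoD) simp
    then have "eventually (\<lambda>N. 2 \<le> N \<and> x * (2 / real N) powr a < 1 / 2) sequentially"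
      using eventually_ge_at_top[of 2] by eventually_elim auto
    then show ?thesis using that by (auto simp: eventually_sequentially intro: less_imp_le)
  qed
  define t where "t k n = (- (x / real n powr a)) ^ k * shifted_binomial (a * real k) n" for k n
  define B where "B k = real N ^ Suc N * (1 / 2 :: real) ^ k" for k
  have sB: "summable B" unfolding B_def by (intro summable_mult summable_geometric) simp
  have teq: "t k n = (- x) ^ k * (shifted_binomial (a * real k) n / real n powr (a * real k))" if "n > 0" for k n
    using that unfolding t_def minus_divide_left power_divide
    by (simp add: powr_powr flip: powr_realpow)
  have bound: "norm (t k n) \<le> B k" if "N \<le> n" for k n
  proof -
    have n: "n > 0" using that N by simp
    have "norm (t k n) = x ^ k * (shifted_binomial (a * real k) n / real n powr (a * real k))"
    proof -
      have "0 \<le> shifted_binomial (a * real k) n"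
        using a by (intro shifted_binomial_nonneg order_trans[OF _ mult_nonneg_nonneg]) auto
      then show ?thesis using n x by (simp add: teq abs_mult power_abs)
    qed
    also have "\<dots> \<le> x ^ k * (real N ^ Suc N * (2 / real N) powr (a * real k))"
      using that N x a by (intro mult_left_mono shifted_binomial_le) auto
    also have "\<dots> = real N ^ Suc N * (x * (2 / real N) powr a) ^ k"
      using N by (simp add: power_mult_distrib powr_powr flip: powr_realpow)
    also have "\<dots> \<le> B k"
      unfolding B_def using N x by (intro mult_left_mono power_mono) auto
    finally show ?thesis .
  qed
  have lim: "(\<lambda>n. t k n) \<longlonglongrightarrow> (- x) ^ k / Gamma (a * real k + 1)" for k
  proof -
    have "(\<lambda>n. (- x) ^ k * (shifted_binomial (a * real k) n / real n powr (a * real k)))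
        \<longlonglongrightarrow> (- x) ^ k * (1 / Gamma (a * real k + 1))"
      using a by (intro tendsto_mult shifted_binomial_LIMSEQ tendsto_const) auto
    moreover have "eventually (\<lambda>n. (- x) ^ k * (shifted_binomial (a * real k) n / real n powr (a * real k)) = t k n) sequentially"
      using eventually_gt_at_top[of 0] by eventually_elim (simp add: teq)
    ultimately show ?thesis by (simp add: filterlim_cong)
  qed
  have ev: "eventually (\<lambda>(k, n). norm (t k n) \<le> B k) (at_top \<times>\<^sub>F sequentially)"
    unfolding eventually_prod_filter
    by (rule exI[of _ "\<lambda>_. True"], rule exI[of _ "\<lambda>n. N \<le> n"]) (use bound in auto)
  have tan: "summable (\<lambda>k. norm ((- x) ^ k / Gamma (a * real k + 1)))"
       "(\<lambda>n. \<Sum>k. t k n) \<longlonglongrightarrow> mittag_leffler a (- x)"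
    using tannerys_theorem[OF lim ev sB] unfolding mittag_leffler_def by auto
  show "summable (\<lambda>k. norm ((- x) ^ k / Gamma (a * real k + 1)))" by (rule tan)
  have "(\<Sum>k. t k n) \<in> {0..1}" if "N \<le> n" for n
    unfolding t_def
  proof (rule fractional_relaxation_bounds[OF a])
    show "0 < x / real n powr a" using x that N by simp
    fix j assume j: "j \<le> n"
    \<comment> \<open>The majorant is available from N on, while j may be smaller; monotonicity of
      \<open>shifted_binomial\<close> in its second argument moves j up to n with the same
      h.\<close>
    show "summable (\<lambda>k. (- (x / real n powr a)) ^ k * shifted_binomial (a * real k) j)"
    proof (rule summable_comparison_test[OF _ sB], intro exI allI impI)
      fix k
      have "norm ((- (x / real n powr a)) ^ k * shifted_binomial (a * real k) j) \<le> norm (t k n)"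
      proof -
        have "0 \<le> shifted_binomial (a * real k) j" "shifted_binomial (a * real k) j \<le> shifted_binomial (a * real k) n"
          using a j by (auto intro!: shifted_binomial_nonneg shifted_binomial_mono_right
              order_trans[of "- 1" 0 "a * real k"])
        then show ?thesis unfolding t_def norm_mult by (intro mult_left_mono) auto
      qed
      then show "norm ((- (x / real n powr a)) ^ k * shifted_binomial (a * real k) j) \<le> B k"
        using bound[OF that, of k] by linarith
    qed
  qed
  then have "eventually (\<lambda>n. (\<Sum>k. t k n) \<in> {0..1}) sequentially"
    unfolding eventually_sequentially by blast
  then show "mittag_leffler a (- x) \<in> {0..1}"
    by (rule Lim_in_closed_set[OF closed_atLeastAtMost _ _ tan(2)]) simp
qed


lemma mittag_leffler_bounds:
  assumes "0 < a" "a \<le> 1" "z \<le> 0"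
  shows "mittag_leffler a z \<in> {0..1}"
proof (cases "z = 0")
  case True
  have "mittag_leffler a 0 = (\<Sum>k. (1 / Gamma (a * real k + 1)) * 0 ^ k)"
    unfolding mittag_leffler_def by (intro suminf_cong) simp
  also have "\<dots> = 1" by (subst powser_zero) simp
  finally show ?thesis using True by simp
next
  case False
  then show ?thesis using mittag_leffler_neg_bounds[of a "- z"] assms by simp
qed

lemma isCont_mittag_leffler:
  assumes "0 < a" "a \<le> 1"
  shows "isCont (mittag_leffler a) z"
proof -
  have "summable (\<lambda>k. (1 / Gamma (a * real k + 1)) * y ^ k)" for y
  proof (rule summable_norm_cancel)
    \<comment> \<open>Absolute summability depends on |y| only, so negative arguments suffice; the
      added 1 keeps the argument nonzero when y = 0.\<close>
    have "summable (\<lambda>k. norm ((- (\<bar>y\<bar> + 1)) ^ k / Gamma (a * real k + 1)))"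
      using assms by (intro summable_mittag_leffler) auto
    then show "summable (\<lambda>k. norm ((1 / Gamma (a * real k + 1)) * y ^ k))"
    proof (rule summable_comparison_test'[where N = 0])
      fix k
      have "\<bar>y ^ k\<bar> \<le> (\<bar>y\<bar> + 1) ^ k" unfolding power_abs by (intro power_mono) auto
      then show "norm (norm ((1 / Gamma (a * real k + 1)) * y ^ k))
          \<le> norm ((- (\<bar>y\<bar> + 1)) ^ k / Gamma (a * real k + 1))"
        by (simp add: abs_mult power_abs divide_right_mono add.commute)
    qed
  qed
  then have "isCont (\<lambda>x. \<Sum>k. (1 / Gamma (a * real k + 1)) * x ^ k) z"
    by (rule isCont_powser_converges_everywhere)
  then show ?thesis
    unfolding mittag_leffler_def[abs_def] by simp
qed

text \<open>For the Ito integrand. The delicate point is the endpoint s = T, where the base of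
  \<open>powr\<close> is 0 and a > 0 keeps the power continuous.\<close>

lemma continuous_on_mittag_leffler_powr:
  assumes "0 < a" "a \<le> 1"
  shows "continuous_on {0..T} (\<lambda>s. mittag_leffler a (- c * (T - s) powr a))"
proof (rule continuous_on_compose2[where g = "mittag_leffler a" and t = UNIV])
  show "continuous_on UNIV (mittag_leffler a)"
    using isCont_mittag_leffler[OF assms] by (simp add: continuous_at_imp_continuous_on)
  show "continuous_on {0..T} (\<lambda>s. - c * (T - s) powr a)"
    using assms by (intro continuous_intros continuous_on_powr') auto
qed auto

section \<open>Spherical harmonics\<close>

text \<open>By Rodrigues' formula the order k = l + m belongs to the m-th derivative of P_l. As
  formal polynomials, derivatives of order above 2 l vanish by degree, and the differential
  equations become identities proved by \<open>pderiv\<close>.\<close>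

definition rodrigues_poly :: "nat \<Rightarrow> nat \<Rightarrow> real poly" where
  "rodrigues_poly l k = (pderiv ^^ k) ([:-1, 0, 1:] ^ l)"

lemma pderiv_rodrigues_poly: "pderiv (rodrigues_poly l k) = rodrigues_poly l (Suc k)"
  by (simp add: rodrigues_poly_def)

lemma higher_pderiv_monom_real:
  "(pderiv ^^ m) (monom (c::real) n) = (if m \<le> n then monom (c * fact n / fact (n - m)) (n - m) else 0)"
proof (induction m)
  case (Suc m)
  show ?case
  proof (cases "Suc m \<le> n")
    case True
    then have "fact (n - m) = real (n - m) * fact (n - Suc m)"
      by (simp add: fact_reduce)
    then show ?thesis using Suc True by (simp add: pderiv_monom)
  qed (use Suc in \<open>auto simp: pderiv_monom not_less_eq_eq le_antisym\<close>)
qed simp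

lemma legendreP_rodrigues: "legendreP l z = poly (rodrigues_poly l l) z / (2 ^ l * fact l)"
proof -
  have "[:-1, 0, 1:] = [:-1:] + monom (1::real) 2"
    by (simp add: numeral_2_eq_2 monom_Suc)
  then have "[:-1, 0, 1:] ^ l = (\<Sum>k\<le>l. of_nat (l choose k) * [:-1::real:] ^ k * monom 1 2 ^ (l - k))"
    by (simp only: binomial_ring)
  also have "\<dots> = (\<Sum>k\<le>l. monom (real (l choose k) * (-1) ^ k) (2 * (l - k)))"
    by (intro sum.cong refl) (simp add: monom_power poly_const_pow of_nat_poly smult_monom mult.commute)
  finally have "rodrigues_poly l l = (\<Sum>k\<le>l. if l \<le> 2 * (l - k) then
      monom (real (l choose k) * (-1) ^ k * fact (2 * (l - k)) / fact (2 * (l - k) - l)) (2 * (l - k) - l) else 0)"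
    unfolding rodrigues_poly_def by (simp only: higher_pderiv_sum higher_pderiv_monom_real)
  \<comment> \<open>The monomial of degree 2 (l - k) survives l derivatives exactly when k <= l div
    2, the range of summation in \<open>legendreP\<close>.\<close>
  also have "\<dots> = (\<Sum>k\<le>l div 2. monom (real (l choose k) * (-1) ^ k * fact (2 * (l - k)) / fact (2 * (l - k) - l)) (2 * (l - k) - l))"
    by (intro sum.mono_neutral_cong_right) auto
  finally have "poly (rodrigues_poly l l) z = (\<Sum>k\<le>l div 2.
      real (l choose k) * (-1) ^ k * fact (2 * (l - k)) / fact (2 * (l - k) - l) * z ^ (2 * (l - k) - l))"
    by (simp add: poly_sum poly_monom)
  also have "\<dots> = fact l * (\<Sum>k\<le>l div 2. (-1) ^ k * real (l choose k) * real ((2*l - 2*k) choose l) * z ^ (l - 2*k))"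
    unfolding sum_distrib_left
  proof (intro sum.cong refl)
    fix k assume "k \<in> {..l div 2}"
    then have k: "2 * k \<le> l" by auto
    have "2 * (l - k) - l = l - 2 * k" "2 * (l - k) = 2 * l - 2 * k" "2 * l - 2 * k - l = l - 2 * k" using k by auto
    moreover have "real ((2*l - 2*k) choose l) = fact (2*l - 2*k) / (fact l * fact (2*l - 2*k - l))"
      using k by (intro binomial_fact) auto
    ultimately show "real (l choose k) * (-1) ^ k * fact (2 * (l - k)) / fact (2 * (l - k) - l) * z ^ (2 * (l - k) - l)
       = fact l * ((-1) ^ k * real (l choose k) * real ((2*l - 2*k) choose l) * z ^ (l - 2*k))"
      by (simp add: field_simps)
  qed
  finally show ?thesis by (simp add: legendreP_def)
qed

text \<open>The m-th derivative of P_l: the associated Legendre function without its factor (1 -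
  z^2)^(m/2), which sits in (x1 + i x2)^m. It is therefore smooth at the poles.\<close>

definition legendre_deriv :: "nat \<Rightarrow> nat \<Rightarrow> real \<Rightarrow> real" where
  "legendre_deriv l m z = poly (rodrigues_poly l (l + m)) z / (2 ^ l * fact l)"

lemma DERIV_legendre_deriv:
  "(legendre_deriv l m has_real_derivative legendre_deriv l (Suc m) z) (at z)"
  unfolding legendre_deriv_def[abs_def]
  by (rule derivative_eq_intros poly_DERIV refl | simp add: pderiv_rodrigues_poly)+

lemma funpow_deriv_legendreP: "(deriv ^^ m) (legendreP l) = legendre_deriv l m"
proof (induction m)
  case 0
  show ?case by (rule ext) (simp add: legendre_deriv_def legendreP_rodrigues)
next
  case (Suc m)
  then show ?case by (auto intro!: ext DERIV_imp_deriv DERIV_legendre_deriv)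
qed

text \<open>Repeated differentiation of \<open>(z\<^sup>2 - 1) w' = 2 l z w\<close> for \<open>w = (z\<^sup>2 - 1)^l\<close>.\<close>

lemma rodrigues_poly_ode:
  "(z\<^sup>2 - 1) * poly (rodrigues_poly l (Suc (Suc k))) z =
     (2 * real l - 2 * (real k + 1)) * z * poly (rodrigues_poly l (Suc k)) z
     + (real k + 1) * (2 * real l - real k) * poly (rodrigues_poly l k) z"
proof -
  let ?R = "rodrigues_poly l"
  have base: "[:-1, 0, 1:] * ?R 1 = smult (2 * real l) ([:0, 1:] * ?R 0)"
  proof (cases l)
    case (Suc n)
    have "?R 1 = smult (real l) ([:-1, 0, 1:] ^ n * [:0, 2:])"
      unfolding rodrigues_poly_def Suc One_nat_def funpow.simps o_apply id_apply pderiv_power_Suc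
      by (simp add: pderiv_pCons mult.commute)
    then show ?thesis
      unfolding \<open>?R 1 = _\<close>
      by (simp add: rodrigues_poly_def Suc poly_eq_poly_eq_iff[symmetric] fun_eq_iff algebra_simps)
  qed (simp add: rodrigues_poly_def)
  have "[:-1, 0, 1:] * ?R (Suc (Suc k)) =
     smult (2 * real l - 2 * (real k + 1)) ([:0, 1:] * ?R (Suc k))
     + smult ((real k + 1) * (2 * real l - real k)) (?R k)"
  proof (induction k)
    case 0
    have "pderiv ([:-1, 0, 1:] * ?R 1) = pderiv (smult (2 * real l) ([:0, 1:] * ?R 0))"
      by (simp only: base)
    then have "poly ([:-1, 0, 1:] * ?R 2 + ?R 1 * [:0, 2:]) z = poly (smult (2 * real l) ([:0, 1:] * ?R 1 + ?R 0 * [:1:])) z" for z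
      by (simp only: pderiv_mult pderiv_smult pderiv_rodrigues_poly One_nat_def numeral_2_eq_2)
        (simp add: pderiv_pCons)
    then show ?case
      by (simp add: poly_eq_poly_eq_iff[symmetric] fun_eq_iff numeral_2_eq_2 algebra_simps)
  next
    case (Suc k)
    have "pderiv ([:-1, 0, 1:] * ?R (Suc (Suc k))) = pderiv (
     smult (2 * real l - 2 * (real k + 1)) ([:0, 1:] * ?R (Suc k))
     + smult ((real k + 1) * (2 * real l - real k)) (?R k))"
      by (simp only: Suc)
    then have "poly ([:-1, 0, 1:] * ?R (Suc (Suc (Suc k))) + ?R (Suc (Suc k)) * [:0, 2:]) z = poly (
     smult (2 * real l - 2 * (real k + 1)) ([:0, 1:] * ?R (Suc (Suc k)) + ?R (Suc k) * [:1:])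
     + smult ((real k + 1) * (2 * real l - real k)) (?R (Suc k))) z" for z
      by (simp only: pderiv_mult pderiv_smult pderiv_add pderiv_rodrigues_poly) (simp add: pderiv_pCons)
    then show ?case
      by (simp add: poly_eq_poly_eq_iff[symmetric] fun_eq_iff algebra_simps)
  qed
  then have "poly ([:-1, 0, 1:] * ?R (Suc (Suc k))) z = poly (
     smult (2 * real l - 2 * (real k + 1)) ([:0, 1:] * ?R (Suc k))
     + smult ((real k + 1) * (2 * real l - real k)) (?R k)) z" by simp
  then show ?thesis by (simp add: power2_eq_square algebra_simps)
qed

text \<open>The order k = l + m of \<open>rodrigues_poly_ode\<close>. The coefficient (l - m) (l + m
  + 1) is also the quotient of consecutive normalising constants, see
  \<open>sph_harm_const_Suc\<close>; this match drives both the telescoping in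
  \<open>unsoeld_legendre\<close> and the ladder estimates.\<close>

lemma legendre_deriv_ode:
  "(1 - z\<^sup>2) * legendre_deriv l (Suc (Suc m)) z =
     2 * (real m + 1) * z * legendre_deriv l (Suc m) z
     - (real l - real m) * (real l + real m + 1) * legendre_deriv l m z"
proof -
  define c :: real where "c = 2 ^ l * fact l"
  have c: "c \<noteq> 0" by (simp add: c_def)
  have "(1 - z\<^sup>2) * poly (rodrigues_poly l (Suc (Suc (l + m)))) z =
     2 * (real m + 1) * z * poly (rodrigues_poly l (Suc (l + m))) z
     - (real l - real m) * (real l + real m + 1) * poly (rodrigues_poly l (l + m)) z"
    using rodrigues_poly_ode[of z l "l + m"] by (simp add: algebra_simps)
  then show ?thesis
    unfolding legendre_deriv_def c_def[symmetric] using c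
    by (simp add: divide_simps)
qed

text \<open>(z^2 - 1)^l has degree 2 l. The case m = l + 1 closes the sums over m at their upper
  end.\<close>

lemma legendre_deriv_eq_0:
  assumes "l < m"
  shows "legendre_deriv l m z = 0"
proof -
  have "degree ([:-1, 0, 1::real:] ^ l) = 2 * l"
    by (subst degree_power_eq) auto
  then have "rodrigues_poly l (l + m) = 0"
    unfolding rodrigues_poly_def using assms
    by (intro poly_eqI) (simp add: coeff_higher_pderiv coeff_eq_0)
  then show ?thesis by (simp add: legendre_deriv_def)
qed

lemma higher_pderiv_pcompose_shift:
  "(pderiv ^^ k) (pcompose p [:c, 1:]) = pcompose ((pderiv ^^ k) p) [:c, 1::real:]"
  by (induction k) (simp_all add: pderiv_pcompose pderiv_pCons)

lemma pcompose_power: "pcompose (p ^ n) q = pcompose p q ^ n"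
  for p q :: "real poly"
  by (induction n) (simp_all add: pcompose_mult one_pCons pcompose_const)

text \<open>Substituting z + 1 turns z^2 - 1 into z (z + 2), so the l-th Taylor coefficient at 1 is
  2^l. This fixes the constant in \<open>unsoeld_legendre\<close>.\<close>

lemma legendre_deriv_0_1 [simp]: "legendre_deriv l 0 1 = 1"
proof -
  have "poly (rodrigues_poly l l) 1 = coeff (pcompose (rodrigues_poly l l) [:1, 1:]) 0"
    by (simp add: poly_pcompose flip: poly_0_coeff_0)
  also have "\<dots> = coeff ((pderiv ^^ l) (pcompose ([:-1, 0, 1:] ^ l) [:1, 1:])) 0"
    by (simp add: rodrigues_poly_def higher_pderiv_pcompose_shift)
  also have "\<dots> = fact l * coeff (pcompose ([:-1, 0, 1:] ^ l) [:1, 1:]) l"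
    by (simp add: coeff_higher_pderiv pochhammer_fact)
  also have "pcompose ([:-1, 0, 1:] ^ l) [:1, 1::real:] = monom 1 l * [:2, 1:] ^ l"
    by (simp add: pcompose_power pcompose_pCons monom_altdef mult.commute flip: power_mult_distrib)
  also have "coeff \<dots> l = poly ([:2, 1:] ^ l) 0"
    by (simp add: coeff_monom_mult poly_0_coeff_0)
  finally show ?thesis by (simp add: legendre_deriv_def)
qed

section \<open>Normalisation and Unsoeld's identity\<close>

definition sph_harm_const :: "nat \<Rightarrow> nat \<Rightarrow> real" where
  "sph_harm_const l m = (2 * real l + 1) * fact (l - m) / fact (l + m)"

lemma sph_harm_const_pos: "sph_harm_const l m > 0"
  by (simp add: sph_harm_const_def)

lemma sph_harm_const_Suc:
  assumes "m < l"
  shows "sph_harm_const l m = (real l - real m) * (real l + real m + 1) * sph_harm_const l (Suc m)"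
proof -
  have "fact (l - m) = real (l - m) * fact (l - Suc m)" using assms by (simp add: fact_reduce)
  moreover have "real (l - m) = real l - real m" using assms by simp
  moreover have "fact (l + Suc m) = (real l + real m + 1) * fact (l + m)" by simp
  ultimately show ?thesis unfolding sph_harm_const_def by (simp del: fact_Suc)
qed

lemma sph_harm_nonneg_alt:
  "sph_harm_nonneg l m x = of_real (sqrt (sph_harm_const l m) * (-1) ^ m * legendre_deriv l m (x$3))
     * Complex (x$1) (x$2) ^ m"
  by (simp add: sph_harm_nonneg_def sph_harm_const_def funpow_deriv_legendreP)

lemma sph_harm_nonneg_eq_0: "l < m \<Longrightarrow> sph_harm_nonneg l m x = 0"
  by (simp add: sph_harm_nonneg_alt legendre_deriv_eq_0)

lemma S2_iff: "x \<in> S2 \<longleftrightarrow> (x$1)\<^sup>2 + (x$2)\<^sup>2 + (x$3)\<^sup>2 = 1"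
proof -
  have "norm x = sqrt ((x$1)\<^sup>2 + (x$2)\<^sup>2 + (x$3)\<^sup>2)"
    unfolding norm_vec_def L2_set_def by (simp add: sum_3)
  then show ?thesis unfolding mem_sphere_0 by (simp only: real_sqrt_eq_1_iff)
qed

lemma cmod_sph_harm_nonneg:
  assumes "x \<in> S2"
  shows "(cmod (sph_harm_nonneg l m x))\<^sup>2
     = sph_harm_const l m * (1 - (x$3)\<^sup>2) ^ m * (legendre_deriv l m (x$3))\<^sup>2"
proof -
  have "(cmod (Complex (x$1) (x$2)))\<^sup>2 = 1 - (x$3)\<^sup>2"
    using assms[unfolded S2_iff] by (simp add: cmod_power2 algebra_simps)
  then have "(cmod (Complex (x$1) (x$2) ^ m))\<^sup>2 = (1 - (x$3)\<^sup>2) ^ m"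
    by (metis norm_power power_commutes power_mult mult.commute)
  then show ?thesis
    using sph_harm_const_pos[of l m]
    by (simp add: sph_harm_nonneg_alt norm_mult norm_power power_mult_distrib)
qed

text \<open>The left side has derivative zero in z: each summand has derivative D (i + 1) - D i, and
  the sum telescopes against the derivative 2 D 0 of the first term. The constant is read off at z =
  1, where every power of 1 - z^2 drops out.\<close>

lemma unsoeld_legendre:
  "sph_harm_const l 0 * (legendre_deriv l 0 z)\<^sup>2
    + 2 * (\<Sum>i<l. sph_harm_const l (Suc i) * (1 - z\<^sup>2) ^ Suc i * (legendre_deriv l (Suc i) z)\<^sup>2) = 2 * real l + 1"
proof -
  let ?N = "sph_harm_const l" and ?Q = "legendre_deriv l"
  define F where "F z = ?N 0 * (?Q 0 z)\<^sup>2 + 2 * (\<Sum>i<l. ?N (Suc i) * (1 - z\<^sup>2) ^ Suc i * (?Q (Suc i) z)\<^sup>2)" for z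
  define D where "D m z = ?N m * (1 - z\<^sup>2) ^ m * ?Q m z * ?Q (Suc m) z" for m z
  note [derivative_intros] = DERIV_chain2[OF DERIV_legendre_deriv]
  have F_term: "((\<lambda>z. ?N (Suc i) * (1 - z\<^sup>2) ^ Suc i * (?Q (Suc i) z)\<^sup>2)
      has_real_derivative D (Suc i) z - D i z) (at z)" if "i < l" for i z
  proof -
    have "((\<lambda>z. ?N (Suc i) * (1 - z\<^sup>2) ^ Suc i * (?Q (Suc i) z)\<^sup>2) has_real_derivative
      ?N (Suc i) * ((1 - z\<^sup>2) ^ Suc i * (2 * ?Q (Suc i) z * ?Q (Suc (Suc i)) z)
       - real (Suc i) * (1 - z\<^sup>2) ^ i * (2 * z) * (?Q (Suc i) z)\<^sup>2)) (at z)"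
    proof -
      have p: "((\<lambda>z. (1 - z\<^sup>2) ^ Suc i) has_real_derivative (1 + real i) * (- (2 * z) * (1 - z\<^sup>2) ^ i)) (at z)"
        by (rule DERIV_power_Suc) (auto intro!: derivative_eq_intros)
      have q: "((\<lambda>z. (?Q (Suc i) z)\<^sup>2) has_real_derivative 2 * ?Q (Suc i) z * ?Q (Suc (Suc i)) z) (at z)"
        by (auto intro!: derivative_eq_intros)
      show ?thesis
        unfolding mult.assoc
        by (rule DERIV_cong[OF DERIV_cmult[OF DERIV_mult[OF p q]]]) (simp add: algebra_simps)
    qed
    also have "?N (Suc i) * ((1 - z\<^sup>2) ^ Suc i * (2 * ?Q (Suc i) z * ?Q (Suc (Suc i)) z)
       - real (Suc i) * (1 - z\<^sup>2) ^ i * (2 * z) * (?Q (Suc i) z)\<^sup>2)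
      = ?N (Suc i) * (1 - z\<^sup>2) ^ i * ?Q (Suc i) z *
         (2 * ((1 - z\<^sup>2) * ?Q (Suc (Suc i)) z) - 2 * (real i + 1) * z * ?Q (Suc i) z)"
      by (simp add: algebra_simps power2_eq_square)
    \<comment> \<open>The Legendre equation cancels one of the two copies of the term in
      \<open>?Q (Suc (Suc i))\<close>, which leaves \<open>D (Suc i)\<close>; its last term becomes
      \<open>D i\<close> through the normalising constants.\<close>
    also have "2 * (real i + 1) * z * ?Q (Suc i) z = (1 - z\<^sup>2) * ?Q (Suc (Suc i)) z
        + (real l - real i) * (real l + real i + 1) * ?Q i z"
      using legendre_deriv_ode[of z l i] by simp
    also have "?N (Suc i) * (1 - z\<^sup>2) ^ i * ?Q (Suc i) z *
         (2 * ((1 - z\<^sup>2) * ?Q (Suc (Suc i)) z) - ((1 - z\<^sup>2) * ?Q (Suc (Suc i)) z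
        + (real l - real i) * (real l + real i + 1) * ?Q i z))
       = D (Suc i) z - ((real l - real i) * (real l + real i + 1) * ?N (Suc i)) * (1 - z\<^sup>2) ^ i * ?Q i z * ?Q (Suc i) z"
      unfolding D_def power_Suc by algebra
    also have "\<dots> = D (Suc i) z - D i z"
      using sph_harm_const_Suc[OF that] by (simp add: D_def)
    finally show ?thesis .
  qed
  have "(F has_real_derivative 0) (at z)" for z
  proof -
    have "(F has_real_derivative ?N 0 * (2 * ?Q 0 z * ?Q (Suc 0) z) + 2 * (\<Sum>i<l. D (Suc i) z - D i z)) (at z)"
      unfolding F_def[abs_def]
      by (intro DERIV_add DERIV_cmult DERIV_sum F_term)
        (auto intro!: derivative_eq_intros simp: power2_eq_square)
    also have "?N 0 * (2 * ?Q 0 z * ?Q (Suc 0) z) + 2 * (\<Sum>i<l. D (Suc i) z - D i z) = 2 * D l z"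
      by (subst sum_lessThan_telescope) (simp add: D_def)
    also have "\<dots> = 0" by (simp add: D_def legendre_deriv_eq_0)
    finally show ?thesis .
  qed
  then have "F z = F 1" by (intro DERIV_isconst_all) auto
  also have "F 1 = 2 * real l + 1" by (simp add: F_def sph_harm_const_def)
  finally show ?thesis by (simp add: F_def)
qed

lemma sum_symmetric_int_interval:
  "(\<Sum>m\<in>{- int l..int l}. f m) = f 0 + (\<Sum>i<l. f (int (Suc i)) + f (- int (Suc i)))"
  for f :: "int \<Rightarrow> 'a::comm_monoid_add"
proof (induction l)
  case (Suc l)
  have "{- int (Suc l)..int (Suc l)} = insert (int (Suc l)) (insert (- int (Suc l)) {- int l..int l})"
    by auto
  then show ?case using Suc by (simp add: add_ac)
qed simp

lemma sph_harm_of_nat [simp]: "sph_harm l (int m) x = sph_harm_nonneg l m x"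
  by (simp add: sph_harm_def)

lemma sph_harm_minus: "sph_harm l (- int (Suc m)) x = (-1) ^ Suc m * cnj (sph_harm_nonneg l (Suc m) x)"
  by (simp add: sph_harm_def nat_add_distrib)

theorem unsoeld:
  assumes "x \<in> S2"
  shows "(\<Sum>m\<in>{- int l..int l}. (cmod (sph_harm l m x))\<^sup>2) = 2 * real l + 1"
proof -
  have "(\<Sum>m\<in>{- int l..int l}. (cmod (sph_harm l m x))\<^sup>2)
     = (cmod (sph_harm_nonneg l 0 x))\<^sup>2 + (\<Sum>i<l. 2 * (cmod (sph_harm_nonneg l (Suc i) x))\<^sup>2)"
    unfolding sum_symmetric_int_interval sph_harm_minus sph_harm_of_nat
    using sph_harm_of_nat[of l 0 x] by (simp add: norm_mult norm_power)
  also have "\<dots> = 2 * real l + 1"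
    using unsoeld_legendre[of l "x$3"]
    by (simp add: cmod_sph_harm_nonneg[OF assms] sum_distrib_left)
  finally show ?thesis .
qed


text \<open>The derivative of the harmonics along the infinitesimal rotation about the unit axis \<open>n\<close>.
  Up to normalisation, \<open>\<nu>\<close> and \<open>cnj \<nu>\<close> multiply the lowering and the raising operator.\<close>

lemma sph_harm_nonneg_along_rotation:
  fixes \<gamma> :: "real \<Rightarrow> real^3" and n1 n2 n3 :: real
  assumes d1: "((\<lambda>s. \<gamma> s $ 1) has_real_derivative n2 * (\<gamma> s $ 3) - n3 * (\<gamma> s $ 2)) (at s)"
    and d2: "((\<lambda>s. \<gamma> s $ 2) has_real_derivative n3 * (\<gamma> s $ 1) - n1 * (\<gamma> s $ 3)) (at s)"
    and d3: "((\<lambda>s. \<gamma> s $ 3) has_real_derivative n1 * (\<gamma> s $ 2) - n2 * (\<gamma> s $ 1)) (at s)"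
    and S: "\<gamma> s \<in> S2" and n: "n1\<^sup>2 + n2\<^sup>2 + n3\<^sup>2 = 1" and m: "m \<le> l"
  defines "V \<equiv> \<lambda>m. cmod (sph_harm_nonneg l m (\<gamma> s))"
  shows "\<exists>D. ((\<lambda>s. sph_harm_nonneg l m (\<gamma> s)) has_vector_derivative D) (at s)
    \<and> (cmod D)\<^sup>2 \<le> 3 * (real l * (real l + 1)) * ((V (Suc m))\<^sup>2 + (V m)\<^sup>2 + (if m = 0 then 0 else (V (m - 1))\<^sup>2))"
proof -
  define \<zeta> where "\<zeta> s = Complex (\<gamma> s $ 1) (\<gamma> s $ 2)" for s
  define \<nu> where "\<nu> = Complex n2 (- n1)"
  define z where "z = \<gamma> s $ 3"
  let ?Q = "\<lambda>m. complex_of_real (legendre_deriv l m z)"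
  define c where "c m = complex_of_real (sqrt (sph_harm_const l m) * (-1) ^ m)" for m
  have Y: "sph_harm_nonneg l m (\<gamma> s) = c m * (?Q m * \<zeta> s ^ m)" for m
    by (simp add: sph_harm_nonneg_alt c_def \<zeta>_def z_def)
  have c2: "(cmod (c m))\<^sup>2 = sph_harm_const l m" for m
    using sph_harm_const_pos[of l m] by (simp add: c_def norm_mult norm_power)
  \<comment> \<open>The rotation in the complex coordinate x1 + i x2: the component n3 of the axis
    acts by a phase, while n1 and n2 mix in the height z through \<open>\<nu>\<close>.\<close>
  have d\<zeta>: "(\<zeta> has_vector_derivative \<i> * n3 * \<zeta> s + \<nu> * z) (at s)"
  proof -
    have "((\<lambda>s. complex_of_real (\<gamma> s $ 1) + \<i> * complex_of_real (\<gamma> s $ 2)) has_vector_derivative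
        complex_of_real (n2 * (\<gamma> s $ 3) - n3 * (\<gamma> s $ 2)) + \<i> * complex_of_real (n3 * (\<gamma> s $ 1) - n1 * (\<gamma> s $ 3))) (at s)"
      using d1 d2
      by (intro has_vector_derivative_add has_vector_derivative_mult_right has_vector_derivative_of_real)
        (simp_all add: has_real_derivative_iff_has_vector_derivative)
    moreover have "complex_of_real (n2 * (\<gamma> s $ 3) - n3 * (\<gamma> s $ 2)) + \<i> * complex_of_real (n3 * (\<gamma> s $ 1) - n1 * (\<gamma> s $ 3))
        = \<i> * n3 * \<zeta> s + \<nu> * z"
      by (simp add: complex_eq_iff \<zeta>_def \<nu>_def z_def)
    moreover have "\<zeta> = (\<lambda>s. complex_of_real (\<gamma> s $ 1) + \<i> * complex_of_real (\<gamma> s $ 2))"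
      by (auto simp: complex_eq_iff \<zeta>_def)
    ultimately show ?thesis by simp
  qed
  have dz: "complex_of_real (n1 * (\<gamma> s $ 2) - n2 * (\<gamma> s $ 1)) = - (cnj \<nu> * \<zeta> s + \<nu> * cnj (\<zeta> s)) / 2"
    by (simp add: complex_eq_iff \<zeta>_def \<nu>_def)
  have zz: "\<zeta> s * cnj (\<zeta> s) = 1 - (complex_of_real z)\<^sup>2"
    using S[unfolded S2_iff] by (simp add: complex_eq_iff \<zeta>_def z_def power2_eq_square algebra_simps)
  have dQ: "((\<lambda>s. complex_of_real (legendre_deriv l m (\<gamma> s $ 3))) has_vector_derivative
      ?Q (Suc m) * (- (cnj \<nu> * \<zeta> s + \<nu> * cnj (\<zeta> s)) / 2)) (at s)"
  proof -
    have "((\<lambda>s. legendre_deriv l m (\<gamma> s $ 3)) has_real_derivative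
        legendre_deriv l (Suc m) (\<gamma> s $ 3) * (n1 * (\<gamma> s $ 2) - n2 * (\<gamma> s $ 1))) (at s)"
      by (rule DERIV_chain2[OF DERIV_legendre_deriv d3])
    then show ?thesis
      unfolding dz[symmetric] of_real_mult[symmetric] z_def
      by (intro has_vector_derivative_of_real) (simp add: has_real_derivative_iff_has_vector_derivative)
  qed
  have n2: "(cmod \<nu>)\<^sup>2 \<le> 1" "n3\<^sup>2 \<le> 1"
    using n zero_le_power2[of n1] zero_le_power2[of n2] zero_le_power2[of n3]
    unfolding \<nu>_def cmod_power2 complex.sel power2_minus by linarith+
  \<comment> \<open>The eigenvalue l (l + 1) dominates all squared ladder coefficients (l - k) (l +
    k + 1) = l (l + 1) - k (k + 1), and also m^2 for m <= l.\<close>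
  define \<Lambda> where "\<Lambda> = real l * (real l + 1)"
  have e\<Lambda>: "(real l - real k) * (real l + real k + 1) \<le> \<Lambda>" for k
    by (simp add: \<Lambda>_def algebra_simps)
  \<comment> \<open>Replacing the constant of index m by that of index m + 1 costs exactly the
    squared ladder coefficient; at m = l the derivative of order m + 1 vanishes.\<close>
  have up: "(cmod (c m * (?Q (Suc m) * \<zeta> s ^ Suc m)))\<^sup>2 \<le> \<Lambda> * (V (Suc m))\<^sup>2"
  proof (cases "m < l")
    case True
    have "(cmod (c m * (?Q (Suc m) * \<zeta> s ^ Suc m)))\<^sup>2
       = ((real l - real m) * (real l + real m + 1)) * (V (Suc m))\<^sup>2"
      unfolding V_def Y norm_mult[of "c _"] power_mult_distrib[of "cmod (c _)"] c2 sph_harm_const_Suc[OF True]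
      by simp
    also have "\<dots> \<le> \<Lambda> * (V (Suc m))\<^sup>2" by (intro mult_right_mono e\<Lambda>) auto
    finally show ?thesis .
  next
    case False
    then have "l < Suc m" by simp
    then show ?thesis by (simp add: legendre_deriv_eq_0 \<Lambda>_def)
  qed
  have three: "(cmod (a + b + d))\<^sup>2 \<le> 3 * ((cmod a)\<^sup>2 + (cmod b)\<^sup>2 + (cmod d)\<^sup>2)" for a b d
  proof -
    have "(cmod (a + b + d))\<^sup>2 \<le> (cmod a + cmod b + cmod d)\<^sup>2"
      by (intro power_mono) (auto intro: order_trans[OF norm_triangle_ineq] add_mono)
    also have "\<dots> \<le> 3 * ((cmod a)\<^sup>2 + (cmod b)\<^sup>2 + (cmod d)\<^sup>2)"
      using zero_le_power2[of "cmod a - cmod b"] zero_le_power2[of "cmod b - cmod d"] zero_le_power2[of "cmod a - cmod d"]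
      by (simp add: power2_eq_square algebra_simps)
    finally show ?thesis .
  qed
  show ?thesis
  proof (cases m)
    case 0
    \<comment> \<open>For m = 0 lowering leads to the index -1, whose harmonic is up to sign the
      conjugate of that of index 1. Both terms thus have moduli controlled by the raising term, and
      the third slot of \<open>three\<close> is filled with 0.\<close>
    define D where "D = - (1/2) * cnj \<nu> * (c 0 * (?Q (Suc 0) * \<zeta> s ^ Suc 0)) + - (1/2) * \<nu> * (c 0 * (?Q (Suc 0) * cnj (\<zeta> s))) + 0"
    have "((\<lambda>s. c 0 * complex_of_real (legendre_deriv l 0 (\<gamma> s $ 3))) has_vector_derivative
        c 0 * (?Q (Suc 0) * (- (cnj \<nu> * \<zeta> s + \<nu> * cnj (\<zeta> s)) / 2))) (at s)"
      using dQ unfolding 0 by (rule has_vector_derivative_mult_right)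
    moreover have "c 0 * (?Q (Suc 0) * (- (cnj \<nu> * \<zeta> s + \<nu> * cnj (\<zeta> s)) / 2)) = D"
      by (simp add: D_def field_simps)
    moreover have "(\<lambda>s. c 0 * complex_of_real (legendre_deriv l 0 (\<gamma> s $ 3))) = (\<lambda>s. sph_harm_nonneg l m (\<gamma> s))"
      by (simp add: sph_harm_nonneg_alt c_def 0)
    ultimately have D: "((\<lambda>s. sph_harm_nonneg l m (\<gamma> s)) has_vector_derivative D) (at s)" by simp
    have "(cmod D)\<^sup>2 \<le> 3 * ((cmod (- (1/2) * cnj \<nu> * (c 0 * (?Q (Suc 0) * \<zeta> s ^ Suc 0))))\<^sup>2
       + (cmod (- (1/2) * \<nu> * (c 0 * (?Q (Suc 0) * cnj (\<zeta> s)))))\<^sup>2 + (cmod 0)\<^sup>2)"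
      unfolding D_def by (rule three)
    also have "\<dots> = 3 * ((cmod \<nu>)\<^sup>2 / 2 * (cmod (c 0 * (?Q (Suc 0) * \<zeta> s ^ Suc 0)))\<^sup>2)"
      by (simp add: norm_mult power_mult_distrib power_divide)
    also have "\<dots> \<le> 3 * (1 * (\<Lambda> * (V (Suc m))\<^sup>2))"
      using n2 up unfolding 0 by (intro mult_left_mono mult_mono) auto
    also have "\<dots> \<le> 3 * \<Lambda> * ((V (Suc m))\<^sup>2 + (V m)\<^sup>2 + (if m = 0 then 0 else (V (m - 1))\<^sup>2))"
      by (simp add: \<Lambda>_def 0 algebra_simps)
    finally show ?thesis using D unfolding \<Lambda>_def by blast
  next
    case (Suc k)
    have kl: "k < l" using m Suc by simp
    let ?e = "(real l - real k) * (real l + real k + 1)"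
    have e0: "?e \<ge> 0" using kl by simp
    define D where "D = - (1/2) * cnj \<nu> * (c m * (?Q (Suc m) * \<zeta> s ^ Suc m))
        + \<i> * n3 * of_nat m * (c m * (?Q m * \<zeta> s ^ m)) + (1/2) * \<nu> * (of_real ?e * (c m * (?Q k * \<zeta> s ^ k)))"
    have dp: "((\<lambda>s. \<zeta> s ^ m) has_vector_derivative of_nat m * \<zeta> s ^ k * (\<i> * n3 * \<zeta> s + \<nu> * z)) (at s)"
    proof -
      have "((\<lambda>w. w ^ m) has_field_derivative of_nat m * \<zeta> s ^ k) (at (\<zeta> s))"
        unfolding Suc by (rule DERIV_cong[OF DERIV_power_Suc[OF DERIV_ident]]) simp
      from field_vector_diff_chain_at[OF d\<zeta> this] show ?thesis
        by (simp add: o_def mult_ac)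
    qed
    \<comment> \<open>The product of \<open>\<zeta> s\<close> and its conjugate is 1 - z^2, so the
      Legendre equation removes the conjugate; the resulting term in z \<open>?Q m\<close> cancels
      the one from the derivative of \<open>\<zeta> s ^ m\<close>.\<close>
    have ode: "\<zeta> s * cnj (\<zeta> s) * ?Q (Suc m) = 2 * of_nat m * z * ?Q m - of_real ?e * ?Q k"
    proof -
      have "complex_of_real ((1 - z\<^sup>2) * legendre_deriv l (Suc (Suc k)) z) = complex_of_real (
     2 * (real k + 1) * z * legendre_deriv l (Suc k) z - ?e * legendre_deriv l k z)"
        by (simp only: legendre_deriv_ode)
      then show ?thesis unfolding zz by (simp add: Suc add.commute)
    qed
    have "((\<lambda>s. c m * (complex_of_real (legendre_deriv l m (\<gamma> s $ 3)) * \<zeta> s ^ m)) has_vector_derivative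
        c m * (?Q m * (of_nat m * \<zeta> s ^ k * (\<i> * n3 * \<zeta> s + \<nu> * z)) + ?Q (Suc m) * (- (cnj \<nu> * \<zeta> s + \<nu> * cnj (\<zeta> s)) / 2) * \<zeta> s ^ m)) (at s)"
      using has_vector_derivative_mult[OF dQ dp] unfolding z_def by (rule has_vector_derivative_mult_right)
    moreover have "c m * (?Q m * (of_nat m * \<zeta> s ^ k * (\<i> * n3 * \<zeta> s + \<nu> * z)) + ?Q (Suc m) * (- (cnj \<nu> * \<zeta> s + \<nu> * cnj (\<zeta> s)) / 2) * \<zeta> s ^ m) = D"
    proof -
      have "c m * (?Q m * (of_nat m * \<zeta> s ^ k * (\<i> * n3 * \<zeta> s + \<nu> * z)) + ?Q (Suc m) * (- (cnj \<nu> * \<zeta> s + \<nu> * cnj (\<zeta> s)) / 2) * \<zeta> s ^ m)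
        = - (1/2) * cnj \<nu> * (c m * (?Q (Suc m) * \<zeta> s ^ Suc m)) + \<i> * n3 * of_nat m * (c m * (?Q m * \<zeta> s ^ m))
         + c m * \<nu> * \<zeta> s ^ k * (of_nat m * z * ?Q m - (1/2) * (\<zeta> s * cnj (\<zeta> s) * ?Q (Suc m)))"
        by (simp add: Suc field_simps)
      also have "\<dots> = D"
        unfolding ode D_def by (simp add: field_simps)
      finally show ?thesis .
    qed
    moreover have "(\<lambda>s. c m * (complex_of_real (legendre_deriv l m (\<gamma> s $ 3)) * \<zeta> s ^ m)) = (\<lambda>s. sph_harm_nonneg l m (\<gamma> s))"
      by (simp add: sph_harm_nonneg_alt c_def \<zeta>_def mult.assoc)
    ultimately have D: "((\<lambda>s. sph_harm_nonneg l m (\<gamma> s)) has_vector_derivative D) (at s)" by simp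
    have A: "(cmod (- (1/2) * cnj \<nu> * (c m * (?Q (Suc m) * \<zeta> s ^ Suc m))))\<^sup>2 \<le> \<Lambda> * (V (Suc m))\<^sup>2"
    proof -
      have "(cmod (- (1/2) * cnj \<nu> * (c m * (?Q (Suc m) * \<zeta> s ^ Suc m))))\<^sup>2
        = (cmod \<nu>)\<^sup>2 / 4 * (cmod (c m * (?Q (Suc m) * \<zeta> s ^ Suc m)))\<^sup>2"
        by (simp add: norm_mult power_mult_distrib power_divide)
      also have "\<dots> \<le> 1 * (\<Lambda> * (V (Suc m))\<^sup>2)"
        using n2 up by (intro mult_mono) auto
      finally show ?thesis by simp
    qed
    have B: "(cmod (\<i> * n3 * of_nat m * (c m * (?Q m * \<zeta> s ^ m))))\<^sup>2 \<le> \<Lambda> * (V m)\<^sup>2"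
    proof -
      have "(cmod (\<i> * n3 * of_nat m * (c m * (?Q m * \<zeta> s ^ m))))\<^sup>2 = (n3\<^sup>2 * (real m)\<^sup>2) * (V m)\<^sup>2"
        unfolding V_def Y by (simp add: norm_mult power_mult_distrib)
      also have "\<dots> \<le> (1 * \<Lambda>) * (V m)\<^sup>2"
      proof (intro mult_right_mono mult_mono n2(2))
        have "(real m)\<^sup>2 \<le> (real l)\<^sup>2" using m by (intro power_mono) auto
        then show "(real m)\<^sup>2 \<le> \<Lambda>" by (simp add: \<Lambda>_def power2_eq_square algebra_simps)
      qed auto
      finally show ?thesis by simp
    qed
    \<comment> \<open>The coefficient \<open>?e\<close> enters squared: one factor converts the
      constant of index m into that of index k, the other is bounded by
      \<open>\<Lambda>\<close>.\<close>
    have C: "(cmod ((1/2) * \<nu> * (of_real ?e * (c m * (?Q k * \<zeta> s ^ k)))))\<^sup>2 \<le> \<Lambda> * (V k)\<^sup>2"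
    proof -
      have "(cmod ((1/2) * \<nu> * (of_real ?e * (c m * (?Q k * \<zeta> s ^ k)))))\<^sup>2
         = (cmod \<nu>)\<^sup>2 / 4 * (?e * (?e * (cmod (c (Suc k)))\<^sup>2) * (cmod (?Q k * \<zeta> s ^ k))\<^sup>2)"
        using e0 by (simp add: norm_mult power_mult_distrib power_divide Suc power2_eq_square del: of_real_mult)
      also have "?e * (cmod (c (Suc k)))\<^sup>2 = (cmod (c k))\<^sup>2"
        unfolding c2 sph_harm_const_Suc[OF kl] ..
      also have "?e * (cmod (c k))\<^sup>2 * (cmod (?Q k * \<zeta> s ^ k))\<^sup>2 = ?e * (V k)\<^sup>2"
        unfolding V_def Y norm_mult[of "c _"] power_mult_distrib[of "cmod (c _)"] by simp
      also have "(cmod \<nu>)\<^sup>2 / 4 * (?e * (V k)\<^sup>2) \<le> 1 * (\<Lambda> * (V k)\<^sup>2)"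
        using n2 e\<Lambda> e0 by (intro mult_mono) (auto simp: \<Lambda>_def)
      finally show ?thesis by simp
    qed
    have "(cmod D)\<^sup>2 \<le> 3 * (\<Lambda> * (V (Suc m))\<^sup>2 + \<Lambda> * (V m)\<^sup>2 + \<Lambda> * (V k)\<^sup>2)"
      unfolding D_def by (rule order_trans[OF three]) (intro mult_left_mono add_mono A B C, simp)
    then have "(cmod D)\<^sup>2 \<le> 3 * \<Lambda> * ((V (Suc m))\<^sup>2 + (V m)\<^sup>2 + (if m = 0 then 0 else (V (m - 1))\<^sup>2))"
      by (simp add: Suc algebra_simps)
    then show ?thesis using D unfolding \<Lambda>_def by blast
  qed
qed

section \<open>Great circles and the Lipschitz estimate\<close>

lemma sum_sph_harm_nonneg_le:
  assumes "x \<in> S2"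
  shows "(\<Sum>m\<le>l. (cmod (sph_harm_nonneg l m x))\<^sup>2) \<le> 2 * real l + 1"
proof -
  have "(\<Sum>m\<le>l. (cmod (sph_harm_nonneg l m x))\<^sup>2)
      = (cmod (sph_harm_nonneg l 0 x))\<^sup>2 + (\<Sum>i<l. (cmod (sph_harm_nonneg l (Suc i) x))\<^sup>2)"
    by (simp add: sum.atMost_shift)
  also have "\<dots> \<le> (cmod (sph_harm_nonneg l 0 x))\<^sup>2 + 2 * (\<Sum>i<l. (cmod (sph_harm_nonneg l (Suc i) x))\<^sup>2)"
    by (simp add: sum_nonneg)
  also have "\<dots> = 2 * real l + 1"
    using unsoeld_legendre[of l "x$3"] by (simp add: cmod_sph_harm_nonneg[OF assms])
  finally show ?thesis .
qed

text \<open>Gram-Schmidt applied to y against x; the remainder has norm equal to the sine of the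
  angle. If y is x or -x, the sine is zero and any unit vector orthogonal to x serves as v.\<close>

lemma great_circle:
  fixes x y :: "real^3"
  assumes "x \<in> S2" "y \<in> S2"
  obtains v where "v \<in> S2" "x \<bullet> v = 0"
    "y = cos (geodesic_dist x y) *\<^sub>R x + sin (geodesic_dist x y) *\<^sub>R v"
proof -
  let ?\<theta> = "geodesic_dist x y"
  have nx: "norm x = 1" "norm y = 1" using assms by auto
  then have xx: "x \<bullet> x = 1" "y \<bullet> y = 1" by (simp_all add: dot_square_norm)
  have le: "\<bar>x \<bullet> y\<bar> \<le> 1" using Cauchy_Schwarz_ineq2[of x y] nx by simp
  then have c: "cos ?\<theta> = x \<bullet> y" unfolding geodesic_dist_def by (intro cos_arccos) auto
  have s: "sin ?\<theta> = sqrt (1 - (x \<bullet> y)\<^sup>2)" unfolding geodesic_dist_def using le by (intro sin_arccos_abs) auto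
  define w where "w = y - (x \<bullet> y) *\<^sub>R x"
  have xw: "x \<bullet> w = 0" by (simp add: w_def inner_diff_right xx)
  have "w \<bullet> w = 1 - (x \<bullet> y)\<^sup>2"
    by (simp add: w_def inner_diff_right inner_diff_left xx inner_commute power2_eq_square)
  then have nw: "norm w = sin ?\<theta>" by (simp add: s norm_eq_sqrt_inner)
  show ?thesis
  proof (cases "w = 0")
    case True
    obtain u where u: "u \<noteq> 0" "orthogonal x u"
      using orthogonal_to_vector_exists[of x] by auto
    show ?thesis
    proof (rule that[of "sgn u"])
      show "sgn u \<in> S2" using u by (simp add: norm_sgn)
      show "x \<bullet> sgn u = 0" using u by (simp add: sgn_div_norm orthogonal_def)
      show "y = cos ?\<theta> *\<^sub>R x + sin ?\<theta> *\<^sub>R sgn u"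
        using True nw c by (simp add: w_def)
    qed
  next
    case False
    show ?thesis
    proof (rule that[of "sgn w"])
      show "sgn w \<in> S2" using False by (simp add: norm_sgn)
      show "x \<bullet> sgn w = 0" using xw by (simp add: sgn_div_norm)
      show "y = cos ?\<theta> *\<^sub>R x + sin ?\<theta> *\<^sub>R sgn w"
        using False by (simp add: c sgn_div_norm flip: nw) (simp add: w_def)
    qed
  qed
qed

text \<open>The unit-speed great circle from x to y is an orbit of the rotations about x cross v, so
  the ladder bounds hold at each of its points. Summed over m they are controlled by three
  index-shifted copies of Unsoeld's sum.\<close>

lemma sph_harm_nonneg_lipschitz:
  assumes x: "x \<in> S2" and y: "y \<in> S2"
  shows "(\<Sum>m\<le>l. (cmod (sph_harm_nonneg l m y - sph_harm_nonneg l m x))\<^sup>2)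
    \<le> 9 * (real l * (real l + 1)) * (2 * real l + 1) * (geodesic_dist x y)\<^sup>2"
proof -
  let ?\<theta> = "geodesic_dist x y" and ?V = "sph_harm_nonneg l"
  obtain v where v: "v \<in> S2" "x \<bullet> v = 0" and yv: "y = cos ?\<theta> *\<^sub>R x + sin ?\<theta> *\<^sub>R v"
    using great_circle[OF x y] .
  define \<gamma> where "\<gamma> s = cos s *\<^sub>R x + sin s *\<^sub>R v" for s
  have \<gamma>0: "\<gamma> 0 = x" and \<gamma>\<theta>: "\<gamma> ?\<theta> = y" using yv by (simp_all add: \<gamma>_def)
  have xS: "(x$1)\<^sup>2 + (x$2)\<^sup>2 + (x$3)\<^sup>2 = 1" and vS: "(v$1)\<^sup>2 + (v$2)\<^sup>2 + (v$3)\<^sup>2 = 1"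
    and xv: "x$1 * v$1 + x$2 * v$2 + x$3 * v$3 = 0"
    using x[unfolded S2_iff] v(1)[unfolded S2_iff] v(2) by (simp_all add: inner_vec_def sum_3)
  have \<gamma>S: "\<gamma> s \<in> S2" for s
  proof -
    have "(\<gamma> s $ 1)\<^sup>2 + (\<gamma> s $ 2)\<^sup>2 + (\<gamma> s $ 3)\<^sup>2 = (cos s)\<^sup>2 * ((x$1)\<^sup>2 + (x$2)\<^sup>2 + (x$3)\<^sup>2)
       + (sin s)\<^sup>2 * ((v$1)\<^sup>2 + (v$2)\<^sup>2 + (v$3)\<^sup>2) + 2 * sin s * cos s * (x$1 * v$1 + x$2 * v$2 + x$3 * v$3)"
      unfolding \<gamma>_def by (simp add: power2_eq_square algebra_simps)
    then show ?thesis unfolding S2_iff xS vS xv by simp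
  qed
  \<comment> \<open>The axis n is x cross v. As x and v are orthonormal, n cross x = v and n cross v
    = -x, so the velocity of \<open>\<gamma>\<close> is n cross \<open>\<gamma>\<close>.\<close>
  define n1 where "n1 = x$2 * v$3 - x$3 * v$2"
  define n2 where "n2 = x$3 * v$1 - x$1 * v$3"
  define n3 where "n3 = x$1 * v$2 - x$2 * v$1"
  have n: "n1\<^sup>2 + n2\<^sup>2 + n3\<^sup>2 = 1"
    unfolding n1_def n2_def n3_def using xS vS xv by algebra
  have e: "v$1 = n2 * x$3 - n3 * x$2" "v$2 = n3 * x$1 - n1 * x$3" "v$3 = n1 * x$2 - n2 * x$1"
    "- (x$1) = n2 * v$3 - n3 * v$2" "- (x$2) = n3 * v$1 - n1 * v$3" "- (x$3) = n1 * v$2 - n2 * v$1"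
    unfolding n1_def n2_def n3_def using xS vS xv by algebra+
  have d: "((\<lambda>s. \<gamma> s $ i) has_real_derivative (- sin s * x$i + cos s * v$i)) (at s)" for s i
    unfolding \<gamma>_def by (auto intro!: derivative_eq_intros)
  have d1: "((\<lambda>s. \<gamma> s $ 1) has_real_derivative n2 * (\<gamma> s $ 3) - n3 * (\<gamma> s $ 2)) (at s)" for s
  proof (rule DERIV_cong[OF d])
    have "- sin s * x$1 + cos s * v$1 = sin s * (n2 * v$3 - n3 * v$2) + cos s * (n2 * x$3 - n3 * x$2)"
      unfolding e(1)[symmetric] e(4)[symmetric] by simp
    then show "- sin s * x$1 + cos s * v$1 = n2 * (\<gamma> s $ 3) - n3 * (\<gamma> s $ 2)"
      by (simp add: \<gamma>_def algebra_simps)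
  qed
  have d2: "((\<lambda>s. \<gamma> s $ 2) has_real_derivative n3 * (\<gamma> s $ 1) - n1 * (\<gamma> s $ 3)) (at s)" for s
  proof (rule DERIV_cong[OF d])
    have "- sin s * x$2 + cos s * v$2 = sin s * (n3 * v$1 - n1 * v$3) + cos s * (n3 * x$1 - n1 * x$3)"
      unfolding e(2)[symmetric] e(5)[symmetric] by simp
    then show "- sin s * x$2 + cos s * v$2 = n3 * (\<gamma> s $ 1) - n1 * (\<gamma> s $ 3)"
      by (simp add: \<gamma>_def algebra_simps)
  qed
  have d3: "((\<lambda>s. \<gamma> s $ 3) has_real_derivative n1 * (\<gamma> s $ 2) - n2 * (\<gamma> s $ 1)) (at s)" for s
  proof (rule DERIV_cong[OF d])
    have "- sin s * x$3 + cos s * v$3 = sin s * (n1 * v$2 - n2 * v$1) + cos s * (n1 * x$2 - n2 * x$1)"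
      unfolding e(3)[symmetric] e(6)[symmetric] by simp
    then show "- sin s * x$3 + cos s * v$3 = n1 * (\<gamma> s $ 2) - n2 * (\<gamma> s $ 1)"
      by (simp add: \<gamma>_def algebra_simps)
  qed
  define \<Lambda> where "\<Lambda> = real l * (real l + 1)"
  have "\<exists>D. ((\<lambda>s. ?V m (\<gamma> s)) has_vector_derivative D) (at s)
    \<and> (cmod D)\<^sup>2 \<le> 3 * \<Lambda> * ((cmod (?V (Suc m) (\<gamma> s)))\<^sup>2 + (cmod (?V m (\<gamma> s)))\<^sup>2 + (if m = 0 then 0 else (cmod (?V (m - 1) (\<gamma> s)))\<^sup>2))"
    if "m \<le> l" for m s
    unfolding \<Lambda>_def by (rule sph_harm_nonneg_along_rotation[OF d1 d2 d3 \<gamma>S n that])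
  then obtain D where D: "\<And>m s. m \<le> l \<Longrightarrow> ((\<lambda>s. ?V m (\<gamma> s)) has_vector_derivative D m s) (at s)"
    and Dle: "\<And>m s. m \<le> l \<Longrightarrow> (cmod (D m s))\<^sup>2 \<le> 3 * \<Lambda> * ((cmod (?V (Suc m) (\<gamma> s)))\<^sup>2
       + (cmod (?V m (\<gamma> s)))\<^sup>2 + (if m = 0 then 0 else (cmod (?V (m - 1) (\<gamma> s)))\<^sup>2))"
    by metis
  \<comment> \<open>The constant 9 is 3 times 3: one factor from squaring a sum of three terms, the
    other from the three shifted sums, each at most 2 l + 1.\<close>
  define B where "B = 9 * \<Lambda> * (2 * real l + 1)"
  have sumD: "(\<Sum>m\<le>l. (cmod (D m s))\<^sup>2) \<le> B" for s
  proof -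
    let ?W = "\<lambda>m. (cmod (?V m (\<gamma> s)))\<^sup>2"
    have "(\<Sum>m\<le>l. (cmod (D m s))\<^sup>2) \<le> (\<Sum>m\<le>l. 3 * \<Lambda> * (?W (Suc m) + ?W m + (if m = 0 then 0 else ?W (m - 1))))"
      by (intro sum_mono Dle) auto
    also have "\<dots> = 3 * \<Lambda> * ((\<Sum>m\<le>l. ?W (Suc m)) + (\<Sum>m\<le>l. ?W m) + (\<Sum>m\<le>l. if m = 0 then 0 else ?W (m - 1)))"
      by (simp only: sum_distrib_left[symmetric] sum.distrib)
    also have "\<dots> \<le> 3 * \<Lambda> * ((2 * real l + 1) + (2 * real l + 1) + (2 * real l + 1))"
    proof (intro mult_left_mono add_mono)
      have W: "(\<Sum>m\<le>l. ?W m) \<le> 2 * real l + 1" by (rule sum_sph_harm_nonneg_le[OF \<gamma>S])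
      then show "(\<Sum>m\<le>l. ?W m) \<le> 2 * real l + 1" .
      have "(\<Sum>m\<le>l. ?W (Suc m)) \<le> ?W 0 + (\<Sum>m\<le>l. ?W (Suc m))" by simp
      also have "\<dots> = (\<Sum>m\<le>Suc l. ?W m)" by (simp add: sum.atMost_Suc_shift del: sum.atMost_Suc)
      also have "\<dots> = (\<Sum>m\<le>l. ?W m)" by (simp add: sph_harm_nonneg_eq_0)
      finally show "(\<Sum>m\<le>l. ?W (Suc m)) \<le> 2 * real l + 1" using W by simp
      have "(\<Sum>m\<le>l. if m = 0 then 0 else ?W (m - 1)) = (\<Sum>m<l. ?W m)"
        by (simp add: sum.atMost_shift)
      also have "\<dots> \<le> (\<Sum>m\<le>l. ?W m)" by (intro sum_mono2) auto
      finally show "(\<Sum>m\<le>l. if m = 0 then 0 else ?W (m - 1)) \<le> 2 * real l + 1" using W by simp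
    qed (simp add: \<Lambda>_def)
    also have "\<dots> = B" by (simp add: B_def algebra_simps)
    finally show ?thesis .
  qed
  define \<delta> where "\<delta> m = ?V m y - ?V m x" for m
  define S where "S = (\<Sum>m\<le>l. (cmod (\<delta> m))\<^sup>2)"
  have S0: "0 \<le> S" by (simp add: S_def sum_nonneg)
  have B0: "0 \<le> B" by (simp add: B_def \<Lambda>_def)
  have \<theta>0: "0 \<le> ?\<theta>" unfolding geodesic_dist_def
    using Cauchy_Schwarz_ineq2[of x y] x y by (intro arccos_lbound) auto
  txt \<open>The mean value theorem is scalar, so the curve is projected onto the increment.\<close>
  define \<phi> where "\<phi> s = (\<Sum>m\<le>l. \<delta> m \<bullet> ?V m (\<gamma> s))" for s
  have \<phi>d: "(\<phi> has_real_derivative (\<Sum>m\<le>l. \<delta> m \<bullet> D m s)) (at s)" for s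
    unfolding \<phi>_def[abs_def] has_real_derivative_iff_has_vector_derivative
  proof (intro has_vector_derivative_sum)
    fix m assume "m \<in> {..l}"
    then show "((\<lambda>s. \<delta> m \<bullet> ?V m (\<gamma> s)) has_vector_derivative \<delta> m \<bullet> D m s) (at s)"
      using D by (intro bounded_linear.has_vector_derivative[OF bounded_linear_inner_right]) auto
  qed
  have \<phi>S: "\<phi> ?\<theta> - \<phi> 0 = S"
    unfolding \<phi>_def \<gamma>0 \<gamma>\<theta> S_def sum_subtractf[symmetric]
    by (intro sum.cong refl) (simp add: \<delta>_def dot_square_norm flip: inner_diff_right)
  have \<phi>b: "(\<Sum>m\<le>l. \<delta> m \<bullet> D m s) \<le> sqrt S * sqrt B" for s
  proof -
    have "(\<Sum>m\<le>l. \<delta> m \<bullet> D m s) \<le> (\<Sum>m\<le>l. cmod (\<delta> m) * cmod (D m s))"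
      by (intro sum_mono norm_cauchy_schwarz)
    also have "\<dots> \<le> L2_set (\<lambda>m. cmod (\<delta> m)) {..l} * L2_set (\<lambda>m. cmod (D m s)) {..l}"
      using L2_set_mult_ineq[of "\<lambda>m. cmod (\<delta> m)" "\<lambda>m. cmod (D m s)" "{..l}"] by simp
    also have "\<dots> \<le> sqrt S * sqrt B"
      unfolding L2_set_def S_def using sumD by (intro mult_mono real_sqrt_le_mono) (auto intro: sum_nonneg B0)
    finally show ?thesis .
  qed
  have "S \<le> ?\<theta> * (sqrt S * sqrt B)"
  proof (cases "?\<theta> = 0")
    case True
    then show ?thesis using \<phi>S by simp
  next
    case False
    then obtain s where "\<phi> ?\<theta> - \<phi> 0 = (?\<theta> - 0) * (\<Sum>m\<le>l. \<delta> m \<bullet> D m s)"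
      using MVT2[of 0 ?\<theta> \<phi> "\<lambda>s. \<Sum>m\<le>l. \<delta> m \<bullet> D m s"] \<phi>d \<theta>0 by auto
    then show ?thesis using \<phi>S \<phi>b[of s] \<theta>0 by (simp add: mult_left_mono)
  qed
  then have "sqrt S * sqrt S \<le> (?\<theta> * sqrt B) * sqrt S" using S0 by (simp add: mult_ac)
  \<comment> \<open>One factor \<open>sqrt S\<close> is cancelled; for S = 0 the bound is
    immediate.\<close>
  then have "sqrt S \<le> ?\<theta> * sqrt B"
    using S0 \<theta>0 B0 mult_right_le_imp_le[of "sqrt S" "sqrt S" "?\<theta> * sqrt B"] by (cases "S = 0") auto
  then have "(sqrt S)\<^sup>2 \<le> (?\<theta> * sqrt B)\<^sup>2" using S0 by (intro power_mono) auto
  then show ?thesis using S0 B0 by (simp add: S_def \<delta>_def B_def \<Lambda>_def power_mult_distrib mult_ac)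
qed

text \<open>Harmonics of negative index are conjugates up to sign, so including them at most doubles
  the sum and the constant 9.\<close>

lemma sph_harm_lipschitz:
  assumes x: "x \<in> S2" and y: "y \<in> S2"
  shows "(\<Sum>m\<in>{- int l..int l}. (cmod (sph_harm l m x - sph_harm l m y))\<^sup>2)
    \<le> 18 * (real l * (real l + 1)) * (2 * real l + 1) * (geodesic_dist x y)\<^sup>2"
proof -
  let ?d = "\<lambda>m. (cmod (sph_harm_nonneg l m y - sph_harm_nonneg l m x))\<^sup>2"
  have neg: "cmod (sph_harm l (- int (Suc i)) x - sph_harm l (- int (Suc i)) y)
      = cmod (sph_harm_nonneg l (Suc i) y - sph_harm_nonneg l (Suc i) x)" for i
    unfolding sph_harm_minus right_diff_distrib[symmetric] complex_cnj_diff[symmetric]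
    by (simp add: norm_mult norm_power norm_minus_commute del: complex_cnj_diff)
  have "(\<Sum>m\<in>{- int l..int l}. (cmod (sph_harm l m x - sph_harm l m y))\<^sup>2)
     = ?d 0 + (\<Sum>i<l. 2 * ?d (Suc i))"
    unfolding sum_symmetric_int_interval sph_harm_of_nat neg
    using sph_harm_of_nat[of l 0] by (simp add: norm_minus_commute)
  also have "\<dots> \<le> 2 * (\<Sum>m\<le>l. ?d m)"
    by (simp add: sum.atMost_shift sum_distrib_left)
  also have "\<dots> \<le> 2 * (9 * (real l * (real l + 1)) * (2 * real l + 1) * (geodesic_dist x y)\<^sup>2)"
    by (intro mult_left_mono sph_harm_nonneg_lipschitz x y) simp
  finally show ?thesis by simp
qed

section \<open>Square-integrable random variables\<close>

text \<open>The second moment with values in [0, infinity], so that inequalities and limits can be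
  stated before integrability is known.\<close>

definition nn_sq :: "'w measure \<Rightarrow> ('w \<Rightarrow> complex) \<Rightarrow> ennreal" where
  "nn_sq M X = (\<integral>\<^sup>+ \<omega>. ennreal ((cmod (X \<omega>))\<^sup>2) \<partial>M)"

lemma nn_sq_cmult:
  assumes [measurable]: "X \<in> borel_measurable M"
  shows "nn_sq M (\<lambda>\<omega>. c * X \<omega>) = ennreal ((cmod c)\<^sup>2) * nn_sq M X"
proof -
  have "nn_sq M (\<lambda>\<omega>. c * X \<omega>) = (\<integral>\<^sup>+ \<omega>. ennreal ((cmod c)\<^sup>2) * ennreal ((cmod (X \<omega>))\<^sup>2) \<partial>M)"
    by (simp add: nn_sq_def norm_mult power_mult_distrib ennreal_mult)
  then show ?thesis by (simp add: nn_sq_def nn_integral_cmult)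
qed

lemma nn_sq_uminus: "nn_sq M (\<lambda>\<omega>. X \<omega> - Y \<omega>) = nn_sq M (\<lambda>\<omega>. Y \<omega> - X \<omega>)"
  by (simp add: nn_sq_def norm_minus_commute)

lemma cmod_add_sq_le: "(cmod (a + b))\<^sup>2 \<le> 2 * (cmod a)\<^sup>2 + 2 * (cmod b)\<^sup>2"
proof -
  have "(cmod (a + b))\<^sup>2 \<le> (cmod a + cmod b)\<^sup>2"
    by (intro power_mono norm_triangle_ineq) auto
  also have "\<dots> \<le> 2 * (cmod a)\<^sup>2 + 2 * (cmod b)\<^sup>2"
    using zero_le_power2[of "cmod a - cmod b"] by (simp add: power2_eq_square algebra_simps)
  finally show ?thesis .
qed

lemma nn_sq_add:
  assumes [measurable]: "X \<in> borel_measurable M" "Y \<in> borel_measurable M"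
  shows "nn_sq M (\<lambda>\<omega>. X \<omega> + Y \<omega>) \<le> 2 * nn_sq M X + 2 * nn_sq M Y"
proof -
  have "nn_sq M (\<lambda>\<omega>. X \<omega> + Y \<omega>) \<le> (\<integral>\<^sup>+ \<omega>. 2 * ennreal ((cmod (X \<omega>))\<^sup>2) + 2 * ennreal ((cmod (Y \<omega>))\<^sup>2) \<partial>M)"
    unfolding nn_sq_def
  proof (intro nn_integral_mono)
    fix \<omega>
    have "ennreal ((cmod (X \<omega> + Y \<omega>))\<^sup>2) \<le> ennreal (2 * (cmod (X \<omega>))\<^sup>2 + 2 * (cmod (Y \<omega>))\<^sup>2)"
      by (intro ennreal_leI cmod_add_sq_le)
    also have "\<dots> = 2 * ennreal ((cmod (X \<omega>))\<^sup>2) + 2 * ennreal ((cmod (Y \<omega>))\<^sup>2)"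
      by (simp add: ennreal_mult)
    finally show "ennreal ((cmod (X \<omega> + Y \<omega>))\<^sup>2) \<le> 2 * ennreal ((cmod (X \<omega>))\<^sup>2) + 2 * ennreal ((cmod (Y \<omega>))\<^sup>2)" .
  qed
  also have "\<dots> = 2 * nn_sq M X + 2 * nn_sq M Y"
    unfolding nn_sq_def by (simp add: nn_integral_add nn_integral_cmult)
  finally show ?thesis .
qed

lemma nn_sq_tendsto_0_add:
  assumes [measurable]: "\<And>n. X n \<in> borel_measurable M" "\<And>n. Y n \<in> borel_measurable M"
    and "(\<lambda>n. nn_sq M (X n)) \<longlonglongrightarrow> 0" "(\<lambda>n. nn_sq M (Y n)) \<longlonglongrightarrow> 0"
  shows "(\<lambda>n. nn_sq M (\<lambda>\<omega>. X n \<omega> + Y n \<omega>)) \<longlonglongrightarrow> 0"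
proof (rule tendsto_sandwich[OF _ _ tendsto_const])
  have "(\<lambda>n. 2 * nn_sq M (X n) + 2 * nn_sq M (Y n)) \<longlonglongrightarrow> 2 * 0 + 2 * 0"
    using assms(3,4) by (intro tendsto_add ennreal_tendsto_cmult) auto
  then show "(\<lambda>n. 2 * nn_sq M (X n) + 2 * nn_sq M (Y n)) \<longlonglongrightarrow> 0" by simp
qed (auto intro!: always_eventually nn_sq_add)

lemma nn_sq_tendsto_0_sum:
  assumes "finite J" "\<And>j n. j \<in> J \<Longrightarrow> X j n \<in> borel_measurable M"
    and "\<And>j. j \<in> J \<Longrightarrow> (\<lambda>n. nn_sq M (X j n)) \<longlonglongrightarrow> 0"
  shows "(\<lambda>n. nn_sq M (\<lambda>\<omega>. \<Sum>j\<in>J. w j * X j n \<omega>)) \<longlonglongrightarrow> 0"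
  using assms
proof (induction J rule: finite_induct)
  case empty
  show ?case by (simp add: nn_sq_def)
next
  case (insert j J)
  have [measurable]: "X i n \<in> borel_measurable M" if "i \<in> insert j J" for i n using that insert by auto
  have "(\<lambda>n. nn_sq M (\<lambda>\<omega>. w j * X j n \<omega> + (\<Sum>j\<in>J. w j * X j n \<omega>))) \<longlonglongrightarrow> 0"
  proof (rule nn_sq_tendsto_0_add)
    have "(\<lambda>n. ennreal ((cmod (w j))\<^sup>2) * nn_sq M (X j n)) \<longlonglongrightarrow> ennreal ((cmod (w j))\<^sup>2) * 0"
      using insert by (intro ennreal_tendsto_cmult) auto
    then show "(\<lambda>n. nn_sq M (\<lambda>\<omega>. w j * X j n \<omega>)) \<longlonglongrightarrow> 0"
      by (simp add: nn_sq_cmult)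
  qed (use insert in auto)
  then show ?case using insert by simp
qed

text \<open>Writes X as (X - S n) + S n and lets n tend to infinity. The factor 2 comes from
  \<open>nn_sq_add\<close>.\<close>

lemma nn_sq_le_of_tendsto:
  assumes [measurable]: "X \<in> borel_measurable M" "\<And>n. S n \<in> borel_measurable M"
    and lim: "(\<lambda>n. nn_sq M (\<lambda>\<omega>. S n \<omega> - X \<omega>)) \<longlonglongrightarrow> 0"
    and bound: "\<And>n. nn_sq M (S n) \<le> B"
  shows "nn_sq M X \<le> 2 * B"
proof (rule LIMSEQ_le)
  have "(\<lambda>n. 2 * nn_sq M (\<lambda>\<omega>. S n \<omega> - X \<omega>) + 2 * B) \<longlonglongrightarrow> 2 * 0 + 2 * B"
    by (intro tendsto_add ennreal_tendsto_cmult lim tendsto_const) auto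
  then show "(\<lambda>n. 2 * nn_sq M (\<lambda>\<omega>. S n \<omega> - X \<omega>) + 2 * B) \<longlonglongrightarrow> 2 * B" by simp
  show "\<exists>N. \<forall>n\<ge>N. nn_sq M X \<le> 2 * nn_sq M (\<lambda>\<omega>. S n \<omega> - X \<omega>) + 2 * B"
  proof (intro exI allI impI)
    fix n
    have "nn_sq M X = nn_sq M (\<lambda>\<omega>. (X \<omega> - S n \<omega>) + S n \<omega>)" by simp
    also have "\<dots> \<le> 2 * nn_sq M (\<lambda>\<omega>. X \<omega> - S n \<omega>) + 2 * nn_sq M (S n)"
      by (rule nn_sq_add) auto
    also have "\<dots> \<le> 2 * nn_sq M (\<lambda>\<omega>. S n \<omega> - X \<omega>) + 2 * B"
      by (intro add_mono mult_left_mono bound) (simp_all add: nn_sq_uminus)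
    finally show "nn_sq M X \<le> 2 * nn_sq M (\<lambda>\<omega>. S n \<omega> - X \<omega>) + 2 * B" .
  qed
qed simp

text \<open>A fast subsequence has increments summable in L1, hence converges almost everywhere;
  Fatou's lemma transfers the Cauchy bounds to its limit.\<close>

lemma (in prob_space) riesz_fischer:
  fixes S :: "nat \<Rightarrow> 'a \<Rightarrow> complex"
  assumes [measurable]: "\<And>n. S n \<in> borel_measurable M"
    and cauchy: "\<And>e. 0 < e \<Longrightarrow> \<exists>N. \<forall>m\<ge>N. \<forall>n\<ge>N. nn_sq M (\<lambda>\<omega>. S m \<omega> - S n \<omega>) \<le> ennreal e"
  shows "\<exists>X. X \<in> borel_measurable M \<and> (\<lambda>n. nn_sq M (\<lambda>\<omega>. S n \<omega> - X \<omega>)) \<longlonglongrightarrow> 0"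
proof -
  have "\<forall>k. \<exists>N. \<forall>m\<ge>N. \<forall>n\<ge>N. nn_sq M (\<lambda>\<omega>. S m \<omega> - S n \<omega>) \<le> ennreal ((1/4) ^ k)"
    by (intro allI cauchy) simp
  then obtain N where N: "\<And>k m n. N k \<le> m \<Longrightarrow> N k \<le> n \<Longrightarrow> nn_sq M (\<lambda>\<omega>. S m \<omega> - S n \<omega>) \<le> ennreal ((1/4) ^ k)"
    by metis
  \<comment> \<open>Adding up all \<open>N i\<close> with i <= k makes r monotone and at least
    \<open>N k\<close>; the summand k makes it tend to infinity.\<close>
  define r where "r k = k + (\<Sum>i\<le>k. N i)" for k
  have r: "N k \<le> r k" "k \<le> r k" "r k \<le> r (Suc k)" for k
    unfolding r_def using member_le_sum[of k "{..k}" N] by auto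
  define D where "D k \<omega> = S (r (Suc k)) \<omega> - S (r k) \<omega>" for k \<omega>
  have [measurable]: "D k \<in> borel_measurable M" for k unfolding D_def by measurable
  have D1: "(\<integral>\<^sup>+ \<omega>. ennreal (cmod (D k \<omega>)) \<partial>M) \<le> ennreal (2 * (1/2) ^ k)" for k
  proof -
    \<comment> \<open>Since the total mass is 1, this converts a second moment of size 4^(-k) into a
      first moment of size 2^(-k).\<close>
    have p: "d \<le> (1/2) ^ k + 2 ^ k * d\<^sup>2" if "0 \<le> d" for d :: real
    proof -
      have "0 \<le> 2 ^ k * (d - (1/2) ^ k)\<^sup>2" by simp
      also have "\<dots> = 2 ^ k * d\<^sup>2 - 2 * d * (2 ^ k * (1/2) ^ k) + (2 ^ k * (1/2) ^ k) * (1/2) ^ k"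
        by (simp add: power2_eq_square algebra_simps)
      also have "(2::real) ^ k * (1/2) ^ k = 1" by (simp flip: power_mult_distrib)
      finally show ?thesis using that by simp
    qed
    have "(\<integral>\<^sup>+ \<omega>. ennreal (cmod (D k \<omega>)) \<partial>M)
       \<le> (\<integral>\<^sup>+ \<omega>. ennreal ((1/2) ^ k) + ennreal (2 ^ k) * ennreal ((cmod (D k \<omega>))\<^sup>2) \<partial>M)"
      by (intro nn_integral_mono) (simp add: p flip: ennreal_mult ennreal_plus)
    also have "\<dots> = ennreal ((1/2) ^ k) + ennreal (2 ^ k) * nn_sq M (D k)"
      by (simp add: nn_integral_add nn_integral_cmult nn_sq_def emeasure_space_1)
    also have "\<dots> \<le> ennreal ((1/2) ^ k) + ennreal (2 ^ k) * ennreal ((1/4) ^ k)"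
      unfolding D_def using r[of k] r[of "Suc k"] by (intro add_left_mono mult_left_mono N) auto
    also have "\<dots> = ennreal (2 * (1/2) ^ k)"
      by (simp flip: ennreal_mult ennreal_plus power_mult_distrib)
    finally show ?thesis .
  qed
  have "(\<integral>\<^sup>+ \<omega>. (\<Sum>k. ennreal (cmod (D k \<omega>))) \<partial>M) = (\<Sum>k. \<integral>\<^sup>+ \<omega>. ennreal (cmod (D k \<omega>)) \<partial>M)"
    by (rule nn_integral_suminf) auto
  also have "\<dots> \<le> (\<Sum>k. ennreal (2 * (1/2) ^ k))"
    by (intro suminf_le D1) auto
  also have "\<dots> = ennreal (\<Sum>k. 2 * (1/2) ^ k)"
    by (intro suminf_ennreal2 summable_mult summable_geometric) auto
  finally have fin: "(\<integral>\<^sup>+ \<omega>. (\<Sum>k. ennreal (cmod (D k \<omega>))) \<partial>M) \<noteq> \<infinity>"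
    by (auto simp: top_unique)
  have "AE \<omega> in M. (\<Sum>k. ennreal (cmod (D k \<omega>))) \<noteq> \<infinity>"
    using fin by (intro nn_integral_PInf_AE) auto
  then have conv: "AE \<omega> in M. convergent (\<lambda>k. S (r k) \<omega>)"
  proof eventually_elim
    case (elim \<omega>)
    have "summable (\<lambda>k. cmod (D k \<omega>))"
      using elim by (intro summable_suminf_not_top) auto
    then have "summable (\<lambda>k. D k \<omega>)" by (rule summable_norm_cancel)
    then have "convergent (\<lambda>n. (\<Sum>k<n. D k \<omega>) + S (r 0) \<omega>)"
      by (intro convergent_add convergent_const) (simp add: summable_iff_convergent)
    moreover have "(\<Sum>k<n. D k \<omega>) + S (r 0) \<omega> = S (r n) \<omega>" for n
      unfolding D_def by (simp add: sum_lessThan_telescope[of "\<lambda>k. S (r k) \<omega>"])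
    ultimately show ?case by simp
  qed
  define X where "X \<omega> = lim (\<lambda>k. S (r k) \<omega>)" for \<omega>
  have [measurable]: "X \<in> borel_measurable M" unfolding X_def by measurable
  have bound: "nn_sq M (\<lambda>\<omega>. S n \<omega> - X \<omega>) \<le> ennreal e"
    if e: "\<And>m n. N' \<le> m \<Longrightarrow> N' \<le> n \<Longrightarrow> nn_sq M (\<lambda>\<omega>. S m \<omega> - S n \<omega>) \<le> ennreal e" and n: "N' \<le> n" for e N' n
  proof -
    \<comment> \<open>Here n stays fixed and only the index k of the subsequence grows, so the
      Cauchy bound between n and \<open>r k\<close> survives in the lower limit.\<close>
    have "nn_sq M (\<lambda>\<omega>. S n \<omega> - X \<omega>) = (\<integral>\<^sup>+ \<omega>. liminf (\<lambda>k. ennreal ((cmod (S n \<omega> - S (r k) \<omega>))\<^sup>2)) \<partial>M)"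
      unfolding nn_sq_def
    proof (rule nn_integral_cong_AE, use conv in eventually_elim)
      case (elim \<omega>)
      then have "(\<lambda>k. S (r k) \<omega>) \<longlonglongrightarrow> X \<omega>" by (simp add: X_def convergent_LIMSEQ_iff)
      then have "(\<lambda>k. ennreal ((cmod (S n \<omega> - S (r k) \<omega>))\<^sup>2)) \<longlonglongrightarrow> ennreal ((cmod (S n \<omega> - X \<omega>))\<^sup>2)"
        by (intro tendsto_intros)
      then show ?case by (intro lim_imp_Liminf[symmetric]) auto
    qed
    also have "\<dots> \<le> liminf (\<lambda>k. nn_sq M (\<lambda>\<omega>. S n \<omega> - S (r k) \<omega>))"
      unfolding nn_sq_def by (intro nn_integral_liminf) auto
    also have "\<dots> \<le> liminf (\<lambda>k. ennreal e)"
    proof (rule Liminf_mono)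
      show "\<forall>\<^sub>F k in sequentially. nn_sq M (\<lambda>\<omega>. S n \<omega> - S (r k) \<omega>) \<le> ennreal e"
        using eventually_ge_at_top[of N']
        by eventually_elim (use r n in \<open>auto intro!: e intro: order_trans\<close>)
    qed
    finally show ?thesis by (simp add: Liminf_const)
  qed
  have "(\<lambda>n. nn_sq M (\<lambda>\<omega>. S n \<omega> - X \<omega>)) \<longlonglongrightarrow> 0"
  proof (rule order_tendstoI)
    fix a :: ennreal assume a: "0 < a"
    obtain e where e: "0 < e" "ennreal e < a"
    proof -
      obtain b where "0 < b" "b < a" using dense[OF a] by blast
moreover have "b < top" using \<open>b < a\<close> by (rule less_le_trans) simp
      ultimately show ?thesis using that[of "enn2real b"] by (auto simp: enn2real_positive_iff)
    qed
    obtain N' where "\<forall>m\<ge>N'. \<forall>n\<ge>N'. nn_sq M (\<lambda>\<omega>. S m \<omega> - S n \<omega>) \<le> ennreal e"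
      using cauchy[OF e(1)] by blast
    then have "nn_sq M (\<lambda>\<omega>. S n \<omega> - X \<omega>) < a" if "N' \<le> n" for n
      using bound[of N' e n] that e(2) by (intro le_less_trans[OF _ e(2)]) auto
    then show "\<forall>\<^sub>F n in sequentially. nn_sq M (\<lambda>\<omega>. S n \<omega> - X \<omega>) < a"
      unfolding eventually_sequentially by blast
  qed auto
  then show ?thesis using \<open>X \<in> borel_measurable M\<close> by blast
qed

text \<open>Existence turns the choice in \<open>L2_limit\<close> into a genuine limit, determined
  up to null sets.\<close>

lemma (in prob_space) L2_limit:
  assumes "\<And>n. S n \<in> borel_measurable M"
    and "\<And>e. 0 < e \<Longrightarrow> \<exists>N. \<forall>m\<ge>N. \<forall>n\<ge>N. nn_sq M (\<lambda>\<omega>. S m \<omega> - S n \<omega>) \<le> ennreal e"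
  shows "L2_limit M S \<in> borel_measurable M"
    and "(\<lambda>n. nn_sq M (\<lambda>\<omega>. S n \<omega> - L2_limit M S \<omega>)) \<longlonglongrightarrow> 0"
  using someI_ex[OF riesz_fischer[OF assms]] unfolding L2_limit_def nn_sq_def by auto

section \<open>Orthogonal families and the variance of a real part\<close>

lemma integrable_sq_of_nn_sq:
  assumes "X \<in> borel_measurable M" "nn_sq M X < \<infinity>"
  shows "integrable M (\<lambda>\<omega>. (cmod (X \<omega>))\<^sup>2)"
  using assms by (intro integrableI_bounded) (auto simp: nn_sq_def)

lemma integrable_mult_cnj:
  assumes [measurable]: "X \<in> borel_measurable M" "Y \<in> borel_measurable M"
    and "nn_sq M X < \<infinity>" "nn_sq M Y < \<infinity>"
  shows "integrable M (\<lambda>\<omega>. X \<omega> * cnj (Y \<omega>))"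
proof (rule Bochner_Integration.integrable_bound)
  show "integrable M (\<lambda>\<omega>. (cmod (X \<omega>))\<^sup>2 + (cmod (Y \<omega>))\<^sup>2)"
    using assms by (intro Bochner_Integration.integrable_add integrable_sq_of_nn_sq)
  have "(\<lambda>\<omega>. cnj (Y \<omega>)) \<in> borel_measurable M"
    by (rule borel_measurable_continuous_on[OF _ assms(2)]) (intro continuous_intros)
  then show "(\<lambda>\<omega>. X \<omega> * cnj (Y \<omega>)) \<in> borel_measurable M" by measurable
  have "a * b \<le> a\<^sup>2 + b\<^sup>2" if "0 \<le> a" "0 \<le> b" for a b :: real
    using zero_le_power2[of "a - b"] zero_le_power2[of "a"] zero_le_power2[of "b"] mult_nonneg_nonneg[OF that] 
    unfolding power2_diff by linarith
  then show "AE \<omega> in M. norm (X \<omega> * cnj (Y \<omega>)) \<le> norm ((cmod (X \<omega>))\<^sup>2 + (cmod (Y \<omega>))\<^sup>2)"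
    by (intro AE_I2) (simp add: norm_mult)
qed

text \<open>Pythagoras' theorem. Finite second moments are asked for separately: a product that is
  not integrable has integral 0 by convention and could satisfy \<open>orth\<close> for the wrong
  reason.\<close>

lemma nn_sq_orthogonal:
  assumes J: "finite J" and m: "\<And>j. j \<in> J \<Longrightarrow> X j \<in> borel_measurable M"
    and fin: "\<And>j. j \<in> J \<Longrightarrow> nn_sq M (X j) < \<infinity>"
    and orth: "\<And>j k. j \<in> J \<Longrightarrow> k \<in> J \<Longrightarrow>
       (\<integral>\<omega>. X j \<omega> * cnj (X k \<omega>) \<partial>M) = (if j = k then complex_of_real (\<sigma> j) else 0)"
  shows "nn_sq M (\<lambda>\<omega>. \<Sum>j\<in>J. w j * X j \<omega>) = ennreal (\<Sum>j\<in>J. (cmod (w j))\<^sup>2 * \<sigma> j)"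
proof -
  let ?F = "\<lambda>\<omega>. \<Sum>j\<in>J. w j * X j \<omega>"
  have eq: "complex_of_real ((cmod (?F \<omega>))\<^sup>2) = (\<Sum>j\<in>J. \<Sum>k\<in>J. (w j * cnj (w k)) * (X j \<omega> * cnj (X k \<omega>)))" for \<omega>
    unfolding complex_norm_square cnj_sum sum_product by (intro sum.cong refl) (simp add: mult_ac)
  have int: "integrable M (\<lambda>\<omega>. (w j * cnj (w k)) * (X j \<omega> * cnj (X k \<omega>)))" if "j \<in> J" "k \<in> J" for j k
    using that by (intro integrable_mult_right integrable_mult_cnj m fin)
  have hb: "has_bochner_integral M (\<lambda>\<omega>. complex_of_real ((cmod (?F \<omega>))\<^sup>2))
     (\<Sum>j\<in>J. \<Sum>k\<in>J. (w j * cnj (w k)) * (if j = k then complex_of_real (\<sigma> j) else 0))"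
    unfolding eq
    by (intro has_bochner_integral_sum, subst orth[symmetric])
      (auto simp: has_bochner_integral_iff int)
  have "(\<Sum>j\<in>J. \<Sum>k\<in>J. (w j * cnj (w k)) * (if j = k then complex_of_real (\<sigma> j) else 0))
      = (\<Sum>j\<in>J. (w j * cnj (w j)) * complex_of_real (\<sigma> j))"
    using J by (intro sum.cong refl) (simp add: if_distrib sum.delta cong: if_cong)
  also have "\<dots> = complex_of_real (\<Sum>j\<in>J. (cmod (w j))\<^sup>2 * \<sigma> j)"
    unfolding complex_norm_square[symmetric] by simp
  finally have "has_bochner_integral M (\<lambda>\<omega>. complex_of_real ((cmod (?F \<omega>))\<^sup>2)) (complex_of_real (\<Sum>j\<in>J. (cmod (w j))\<^sup>2 * \<sigma> j))"
    using hb by simp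
  from has_bochner_integral_Re[OF this]
  have "has_bochner_integral M (\<lambda>\<omega>. (cmod (?F \<omega>))\<^sup>2) (\<Sum>j\<in>J. (cmod (w j))\<^sup>2 * \<sigma> j)" by simp
  then show ?thesis
    unfolding nn_sq_def by (subst nn_integral_eq_integral) (auto simp: has_bochner_integral_iff)
qed

lemma (in prob_space) variance_Re_le:
  assumes [measurable]: "X \<in> borel_measurable M" and B: "nn_sq M X \<le> ennreal B" "0 \<le> B"
  shows "variance (\<lambda>\<omega>. Re (X \<omega>)) \<le> B"
proof -
  have int: "integrable M (\<lambda>\<omega>. (cmod (X \<omega>))\<^sup>2)"
    using B by (intro integrable_sq_of_nn_sq) (auto intro: le_less_trans)
  have le: "(Re z)\<^sup>2 \<le> (cmod z)\<^sup>2" for z by (simp add: cmod_power2)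
  have int2: "integrable M (\<lambda>\<omega>. (Re (X \<omega>))\<^sup>2)"
    by (rule Bochner_Integration.integrable_bound[OF int]) (auto simp: le)
  have int1: "integrable M (\<lambda>\<omega>. Re (X \<omega>))"
    by (rule square_integrable_imp_integrable[OF _ int2]) simp
  have "variance (\<lambda>\<omega>. Re (X \<omega>)) = expectation (\<lambda>\<omega>. (Re (X \<omega>))\<^sup>2) - (expectation (\<lambda>\<omega>. Re (X \<omega>)))\<^sup>2"
    by (rule variance_eq[OF int1 int2])
  also have "\<dots> \<le> expectation (\<lambda>\<omega>. (Re (X \<omega>))\<^sup>2)" by simp
  also have "\<dots> \<le> expectation (\<lambda>\<omega>. (cmod (X \<omega>))\<^sup>2)"
    by (intro integral_mono int int2 le)
  also have "ennreal \<dots> = nn_sq M X"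
    unfolding nn_sq_def by (rule nn_integral_eq_integral[symmetric, OF int]) simp
  then have "expectation (\<lambda>\<omega>. (cmod (X \<omega>))\<^sup>2) \<le> B" using B by (simp flip: ennreal_le_iff)
  finally show ?thesis by simp
qed

section \<open>Fourier coefficients of the initial field\<close>

lemma space_S2_measure [simp]: "space S2_measure = S2"
  by (simp add: S2_measure_def space_restrict_space)

lemma sets_S2_measure [measurable_cong]: "sets S2_measure = sets (restrict_space borel S2)"
  by (simp add: S2_measure_def)

text \<open>Since \<open>sgn 0 = 0\<close> lies outside \<open>S2\<close>, the map \<open>sgn\<close> is not measurable into \<open>restrict_space borel S2\<close>
  and \<open>distr\<close> has to be rewritten with a version of \<open>sgn\<close> that differs on a null set.\<close>

lemma prob_space_S2_measure: "prob_space S2_measure"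
proof -
  let ?U = "uniform_measure lborel (ball (0::real^3) 1)" and ?N = "restrict_space borel S2"
  \<comment> \<open>The value at 0 is an arbitrary point of the sphere.\<close>
  define g :: "real^3 \<Rightarrow> real^3" where "g x = (if x = 0 then axis 1 1 else sgn x)" for x
  have sgn: "(sgn :: real^3 \<Rightarrow> real^3) \<in> borel_measurable borel"
    unfolding sgn_div_norm[abs_def] by measurable
  have gb: "g \<in> borel_measurable borel"
    unfolding g_def[abs_def] using sgn by measurable
  have "g x \<in> S2" for x by (auto simp: g_def norm_sgn norm_axis_1)
  then have gm: "g \<in> measurable ?U ?N"
    using gb by (intro measurable_restrict_space2) auto
  have U: "prob_space ?U"
  proof (rule prob_space_uniform_measure)
    show "emeasure lborel (ball (0::real^3) 1) \<noteq> 0"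
      using content_ball_pos[of 1 "0::real^3"] by (auto simp: measure_def)
    show "emeasure lborel (ball (0::real^3) 1) \<noteq> \<infinity>"
      using emeasure_lborel_ball_finite[of "0::real^3" 1] by (simp add: less_top)
  qed
  have ae: "AE x in ?U. x \<noteq> (0::real^3)"
    by (intro AE_uniform_measureI) (auto intro: AE_mp[OF AE_lborel_singleton[of 0]])
  have "S2_measure = distr ?U ?N g"
    unfolding S2_measure_def distr_def
  \<comment> \<open>\<open>distr\<close> is built from the masses of preimages whether or not the
    map is measurable, so equality of these masses on every set of the target is enough.\<close>
  proof (rule measure_of_eq[OF sets.space_closed])
    fix A assume "A \<in> sigma_sets (space ?N) (sets ?N)"
    then have "A \<in> sets ?N" unfolding sets.sigma_sets_eq .
    then have A: "A \<in> sets borel" by (auto simp: sets_restrict_space)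
    show "emeasure ?U (sgn -` A \<inter> space ?U) = emeasure ?U (g -` A \<inter> space ?U)"
    proof (rule emeasure_eq_AE)
      show "AE x in ?U. (x \<in> sgn -` A \<inter> space ?U) = (x \<in> g -` A \<inter> space ?U)"
        using ae by eventually_elim (simp add: g_def)
      show "sgn -` A \<inter> space ?U \<in> sets ?U"
        using measurable_sets[OF sgn A] by simp
      show "g -` A \<inter> space ?U \<in> sets ?U"
        using measurable_sets[OF gb A] by simp
    qed
  qed
  then show ?thesis using prob_space.prob_space_distr[OF U gm] by simp
qed

lemma borel_measurable_sph_harm [measurable]: "sph_harm l m \<in> borel_measurable S2_measure"
proof -
  have c: "continuous_on UNIV (sph_harm_nonneg l k)" for k
  proof -
    have "continuous_on UNIV (legendre_deriv l k)"
      using DERIV_legendre_deriv by (intro continuous_at_imp_continuous_on ballI DERIV_isCont)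
    then have q: "continuous_on UNIV (\<lambda>x::real^3. legendre_deriv l k (x$3))"
      by (rule continuous_on_compose2) (auto intro!: continuous_intros)
    show ?thesis
      unfolding sph_harm_nonneg_alt[abs_def] Complex_eq by (intro continuous_intros q)
  qed
  have "sph_harm l m \<in> borel_measurable borel"
    unfolding sph_harm_def[abs_def]
    by (cases "0 \<le> m") (auto intro!: borel_measurable_continuous_onI continuous_intros c)
  then show ?thesis
    by (simp add: measurable_cong_sets[OF sets_S2_measure refl] measurable_restrict_space1)
qed

lemma cmod_sph_harm_le:
  assumes "x \<in> S2" "\<bar>m\<bar> \<le> int l"
  shows "(cmod (sph_harm l m x))\<^sup>2 \<le> 2 * real l + 1"
proof -
  have "(cmod (sph_harm l m x))\<^sup>2 \<le> (\<Sum>m\<in>{- int l..int l}. (cmod (sph_harm l m x))\<^sup>2)"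
    using assms(2) by (intro member_le_sum) auto
  then show ?thesis using unsoeld[OF assms(1)] by simp
qed

text \<open>Rotations act transitively on the sphere, and the invariance of the covariance is used
  with both of its points equal.\<close>

lemma isotropic_second_moment:
  assumes iso: "weakly_isotropic2 M \<xi>" and "x \<in> S2" "y \<in> S2"
  shows "(\<integral>\<omega>. (\<xi> x \<omega>)\<^sup>2 \<partial>M) = (\<integral>\<omega>. (\<xi> y \<omega>)\<^sup>2 \<partial>M)"
proof -
  obtain f where f: "orthogonal_transformation f" "det (matrix f) = 1" "f y = x"
    using assms by (auto intro: rotation_exists[of y x])
  have "rotation3 (matrix f)"
    using f by (simp add: rotation3_def orthogonal_transformation_matrix)
  moreover have "matrix f *v y = x"
    using f by (simp add: matrix_works orthogonal_transformation_linear)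
  moreover have "\<And>R. rotation3 R \<Longrightarrow> (\<integral>\<omega>. \<xi> (R *v y) \<omega> * \<xi> (R *v y) \<omega> \<partial>M) = (\<integral>\<omega>. \<xi> y \<omega> * \<xi> y \<omega> \<partial>M)"
    using iso assms(3) unfolding weakly_isotropic2_def by blast
  ultimately show ?thesis
    unfolding power2_eq_square by metis
qed

text \<open>Cauchy-Schwarz on the sphere bounds the squared coefficient by 2 l + 1 times the
  integral of the squared field; Fubini and the constant second moment make its expectation finite.
  This supplies the integrability that \<open>nn_sq_orthogonal\<close> asks for.\<close>

lemma
  assumes M: "prob_space M"
    and \<xi>: "(\<lambda>(x, \<omega>). \<xi> x \<omega>) \<in> borel_measurable (S2_measure \<Otimes>\<^sub>M M)"
    and iso: "weakly_isotropic2 M \<xi>" and m: "\<bar>m\<bar> \<le> int l"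
  shows borel_measurable_fourier_coeff: "fourier_coeff \<xi> l m \<in> borel_measurable M"
    and nn_sq_fourier_coeff_finite: "nn_sq M (fourier_coeff \<xi> l m) < \<infinity>"
proof -
  interpret M: prob_space M by fact
  interpret S: prob_space S2_measure by (rule prob_space_S2_measure)
  interpret P: pair_sigma_finite S2_measure M ..
  have e1: "emeasure S2_measure S2 = 1" using S.emeasure_space_1 by simp
  have \<xi>'[measurable]: "(\<lambda>(\<omega>, x). \<xi> x \<omega>) \<in> borel_measurable (M \<Otimes>\<^sub>M S2_measure)"
    using measurable_compose[OF measurable_pair_swap' \<xi>] by (simp add: case_prod_unfold)
  have cY[measurable]: "(\<lambda>x. cnj (sph_harm l m x)) \<in> borel_measurable S2_measure"
    by (rule borel_measurable_continuous_on[OF _ borel_measurable_sph_harm]) (intro continuous_intros)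
  have "(\<lambda>(\<omega>, x). complex_of_real (\<xi> x \<omega>) * cnj (sph_harm l m x)) \<in> borel_measurable (M \<Otimes>\<^sub>M S2_measure)"
    by measurable
  from S.borel_measurable_lebesgue_integral[OF this]
  show meas: "fourier_coeff \<xi> l m \<in> borel_measurable M"
    unfolding fourier_coeff_def[abs_def] by simp
  obtain e :: "real^3" where e: "e \<in> S2" using norm_axis_1[of "1::3"] by (metis mem_sphere_0)
  define c where "c = (\<integral>\<omega>. (\<xi> e \<omega>)\<^sup>2 \<partial>M)"
  have sec: "(\<integral>\<^sup>+\<omega>. ennreal ((\<xi> x \<omega>)\<^sup>2) \<partial>M) = ennreal c" if "x \<in> S2" for x
    using iso that e isotropic_second_moment[OF iso that e] unfolding c_def
    by (subst nn_integral_eq_integral) (auto simp: weakly_isotropic2_def)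
  have le: "ennreal ((cmod (fourier_coeff \<xi> l m \<omega>))\<^sup>2)
      \<le> (\<integral>\<^sup>+x. ennreal ((\<xi> x \<omega>)\<^sup>2) \<partial>S2_measure) * ennreal (2 * real l + 1)" if \<omega>: "\<omega> \<in> space M" for \<omega>
  proof -
    have [measurable]: "(\<lambda>x. \<xi> x \<omega>) \<in> borel_measurable S2_measure"
      using measurable_compose[OF measurable_Pair2'[OF \<omega>] \<xi>] by simp
    have "ennreal (cmod (fourier_coeff \<xi> l m \<omega>))
       \<le> (\<integral>\<^sup>+x. ennreal (cmod (complex_of_real (\<xi> x \<omega>) * cnj (sph_harm l m x))) \<partial>S2_measure)"
    \<comment> \<open>Where the integral over the sphere does not exist, the coefficient is 0 by
      convention and the bound is trivial.\<close>
    proof (cases "integrable S2_measure (\<lambda>x. complex_of_real (\<xi> x \<omega>) * cnj (sph_harm l m x))")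
      case True
      then show ?thesis unfolding fourier_coeff_def by (rule integral_norm_bound_ennreal)
    qed (simp add: fourier_coeff_def not_integrable_integral_eq)
    also have "\<dots> = (\<integral>\<^sup>+x. ennreal \<bar>\<xi> x \<omega>\<bar> * ennreal (cmod (sph_harm l m x)) \<partial>S2_measure)"
      by (simp add: norm_mult ennreal_mult)
    finally have "(ennreal (cmod (fourier_coeff \<xi> l m \<omega>)))\<^sup>2
       \<le> (\<integral>\<^sup>+x. ennreal \<bar>\<xi> x \<omega>\<bar> * ennreal (cmod (sph_harm l m x)) \<partial>S2_measure)\<^sup>2"
      by (intro power_mono) auto
    also have "\<dots> \<le> (\<integral>\<^sup>+x. (ennreal \<bar>\<xi> x \<omega>\<bar>)\<^sup>2 \<partial>S2_measure) * (\<integral>\<^sup>+x. (ennreal (cmod (sph_harm l m x)))\<^sup>2 \<partial>S2_measure)"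
      by (intro Cauchy_Schwarz_nn_integral) auto
    also have "(\<integral>\<^sup>+x. (ennreal (cmod (sph_harm l m x)))\<^sup>2 \<partial>S2_measure) \<le> (\<integral>\<^sup>+x. ennreal (2 * real l + 1) \<partial>S2_measure)"
      by (intro nn_integral_mono, subst ennreal_power, simp)
        (auto intro!: ennreal_leI cmod_sph_harm_le[OF _ m] simp del: ennreal_plus)
    finally show ?thesis
      by (simp add: ennreal_power e1 mult_left_mono)
  qed
  have "nn_sq M (fourier_coeff \<xi> l m) \<le> (\<integral>\<^sup>+\<omega>. (\<integral>\<^sup>+x. ennreal ((\<xi> x \<omega>)\<^sup>2) \<partial>S2_measure) * ennreal (2 * real l + 1) \<partial>M)"
    unfolding nn_sq_def by (intro nn_integral_mono le)
  also have "\<dots> = (\<integral>\<^sup>+\<omega>. (\<integral>\<^sup>+x. ennreal ((\<xi> x \<omega>)\<^sup>2) \<partial>S2_measure) \<partial>M) * ennreal (2 * real l + 1)"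
    by (rule nn_integral_multc) measurable
  also have "(\<integral>\<^sup>+\<omega>. (\<integral>\<^sup>+x. ennreal ((\<xi> x \<omega>)\<^sup>2) \<partial>S2_measure) \<partial>M)
      = (\<integral>\<^sup>+x. (\<integral>\<^sup>+\<omega>. ennreal ((\<xi> x \<omega>)\<^sup>2) \<partial>M) \<partial>S2_measure)"
  proof -
    have "(\<lambda>(x, \<omega>). ennreal ((\<xi> x \<omega>)\<^sup>2)) \<in> borel_measurable (S2_measure \<Otimes>\<^sub>M M)"
      using \<xi> by measurable
    from P.Fubini'[OF this] show ?thesis by simp
  qed
  also have "\<dots> = (\<integral>\<^sup>+x. ennreal c \<partial>S2_measure)"
    by (intro nn_integral_cong) (simp add: sec del: mem_sphere_0)
  also have "\<dots> = ennreal c" by (simp add: e1)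
  finally show "nn_sq M (fourier_coeff \<xi> l m) < \<infinity>"
    by (rule le_less_trans) (simp add: ennreal_mult_less_top)
qed

section \<open>Riemann sums for the Ito integral\<close>

lemma (in prob_space) indep_vars_expectation_mult:
  fixes X :: "'i \<Rightarrow> 'a \<Rightarrow> real"
  assumes "indep_vars (\<lambda>_. borel) X I" "i \<in> I" "j \<in> I" "i \<noteq> j" "integrable M (X i)" "integrable M (X j)"
  shows "expectation (\<lambda>\<omega>. X i \<omega> * X j \<omega>) = expectation (X i) * expectation (X j)"
proof -
  have "expectation (\<lambda>\<omega>. \<Prod>k\<in>{i, j}. X k \<omega>) = (\<Prod>k\<in>{i, j}. expectation (X k))"
    using assms by (intro indep_vars_lebesgue_integral indep_vars_subset[OF assms(1)]) auto
  then show ?thesis using assms(4) by simp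
qed

lemma (in prob_space) brownian_increment:
  assumes b: "std_brownian_motion M b" and st: "0 \<le> s" "s < t"
  shows "(\<lambda>\<omega>. b t \<omega> - b s \<omega>) \<in> borel_measurable M"
    and "integrable M (\<lambda>\<omega>. b t \<omega> - b s \<omega>)"
    and "expectation (\<lambda>\<omega>. b t \<omega> - b s \<omega>) = 0"
    and "integrable M (\<lambda>\<omega>. (b t \<omega> - b s \<omega>)\<^sup>2)"
    and "expectation (\<lambda>\<omega>. (b t \<omega> - b s \<omega>)\<^sup>2) = t - s"
proof -
  let ?X = "\<lambda>\<omega>. b t \<omega> - b s \<omega>"
  have pos: "0 < sqrt (t - s)" using st by simp
  have D: "distributed M lborel ?X (\<lambda>z. ennreal (normal_density 0 (sqrt (t - s)) z))"
    using b st by (auto simp: std_brownian_motion_def)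
  show "?X \<in> borel_measurable M"
    using distributed_measurable[OF D] by simp
  show "integrable M ?X"
    using distributed_integrable[OF D, of "\<lambda>x. x"] integrable_normal_moment_nz_1[OF pos, of 0] by simp
  show E: "expectation ?X = 0"
    by (rule normal_distributed_expectation[OF pos D])
  show "integrable M (\<lambda>\<omega>. (?X \<omega>)\<^sup>2)"
    using distributed_integrable[OF D, of "\<lambda>x. x\<^sup>2"] integrable_normal_moment[OF pos, of 0 2] by simp
  show "expectation (\<lambda>\<omega>. (?X \<omega>)\<^sup>2) = t - s"
    using normal_distributed_variance[OF pos D] E st by simp
qed

text \<open>The path is an argument, so that independence of whole paths passes to the sums. The
  grid has Suc n intervals, as in \<open>ito_riemann_sum\<close>.\<close>

definition riemann_sum :: "(real \<Rightarrow> real) \<Rightarrow> (real \<Rightarrow> real) \<Rightarrow> real \<Rightarrow> nat \<Rightarrow> real" where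
  "riemann_sum f \<phi> T n = (\<Sum>k<Suc n. f (real k * T / real (Suc n)) *
     (\<phi> (real (Suc k) * T / real (Suc n)) - \<phi> (real k * T / real (Suc n))))"

text \<open>The discrete Ito isometry: increments over disjoint intervals are independent and
  centred, hence orthogonal, each with variance T / N.\<close>

lemma (in prob_space) brownian_weighted_increments:
  fixes c :: "nat \<Rightarrow> real"
  assumes b: "std_brownian_motion M b" and T: "0 < T" and N: "0 < N"
  defines "\<Delta> \<equiv> \<lambda>k \<omega>. b (real (Suc k) * T / real N) \<omega> - b (real k * T / real N) \<omega>"
  shows "(\<lambda>\<omega>. \<Sum>k<N. c k * \<Delta> k \<omega>) \<in> borel_measurable M"
    and "expectation (\<lambda>\<omega>. \<Sum>k<N. c k * \<Delta> k \<omega>) = 0"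
    and "nn_sq M (\<lambda>\<omega>. complex_of_real (\<Sum>k<N. c k * \<Delta> k \<omega>)) = ennreal (\<Sum>k<N. (c k)\<^sup>2 * (T / real N))"
proof -
  have st: "0 \<le> real k * T / real N" "real k * T / real N < real (Suc k) * T / real N" for k
    using T N by (auto simp: divide_strict_right_mono)
  have diff: "real (Suc k) * T / real N - real k * T / real N = T / real N" for k
    by (simp add: distrib_right add_divide_distrib)
  note inc = brownian_increment[OF b st]
  have m[measurable]: "\<Delta> k \<in> borel_measurable M" for k unfolding \<Delta>_def by (rule inc)
  have i1: "integrable M (\<Delta> k)" for k unfolding \<Delta>_def by (rule inc)
  have E0: "expectation (\<Delta> k) = 0" for k unfolding \<Delta>_def by (rule inc)
  have i2: "integrable M (\<lambda>\<omega>. (\<Delta> k \<omega>)\<^sup>2)" for k unfolding \<Delta>_def by (rule inc)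
  have E2: "expectation (\<lambda>\<omega>. (\<Delta> k \<omega>)\<^sup>2) = T / real N" for k
    unfolding \<Delta>_def inc(5) by (rule diff)
  \<comment> \<open>A list of N + 1 grid points, so that the independence of increments yields
    exactly the N variables \<open>\<Delta>\<close>.\<close>
  define ts where "ts = map (\<lambda>k. real k * T / real N) [0..<Suc N]"
  have ts: "ts ! k = real k * T / real N" if "k \<le> N" for k
    using that unfolding ts_def by (subst nth_map) (simp_all del: upt_Suc)
  have "sorted ts"
    using T N unfolding ts_def
    by (auto simp: sorted_iff_nth_mono simp del: upt_Suc intro!: divide_right_mono)
  moreover have "\<forall>t\<in>set ts. 0 \<le> t" using T unfolding ts_def by auto
  ultimately have "indep_vars (\<lambda>_. borel) (\<lambda>i \<omega>. b (ts ! Suc i) \<omega> - b (ts ! i) \<omega>) {..<length ts - 1}"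
    using b unfolding std_brownian_motion_def by blast
  moreover have "length ts - 1 = N" by (simp add: ts_def)
  ultimately have ind: "indep_vars (\<lambda>_. borel) \<Delta> {..<N}"
    by (subst indep_vars_cong[OF refl, where Y = "\<lambda>i \<omega>. b (ts ! Suc i) \<omega> - b (ts ! i) \<omega>"])
      (auto simp: \<Delta>_def ts)
  show "(\<lambda>\<omega>. \<Sum>k<N. c k * \<Delta> k \<omega>) \<in> borel_measurable M" by measurable
  show "expectation (\<lambda>\<omega>. \<Sum>k<N. c k * \<Delta> k \<omega>) = 0"
    using i1 by (simp add: E0)
  have "nn_sq M (\<lambda>\<omega>. \<Sum>k<N. complex_of_real (c k) * complex_of_real (\<Delta> k \<omega>))
      = ennreal (\<Sum>k<N. (cmod (complex_of_real (c k)))\<^sup>2 * (T / real N))"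
  proof (rule nn_sq_orthogonal)
    fix k
    have "nn_sq M (\<lambda>\<omega>. complex_of_real (\<Delta> k \<omega>)) = ennreal (T / real N)"
      unfolding nn_sq_def E2[of k, symmetric] by (subst nn_integral_eq_integral[symmetric]) (auto simp: i2)
    then show "nn_sq M (\<lambda>\<omega>. complex_of_real (\<Delta> k \<omega>)) < \<infinity>" by simp
  next
    fix j k assume jk: "j \<in> {..<N}" "k \<in> {..<N}"
    have "expectation (\<lambda>\<omega>. \<Delta> j \<omega> * \<Delta> k \<omega>) = (if j = k then T / real N else 0)"
      using indep_vars_expectation_mult[OF ind jk _ i1 i1] E2[of k] by (auto simp: E0 power2_eq_square)
    then show "(\<integral>\<omega>. complex_of_real (\<Delta> j \<omega>) * cnj (complex_of_real (\<Delta> k \<omega>)) \<partial>M)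
       = (if j = k then complex_of_real (T / real N) else 0)"
      by (simp flip: of_real_mult)
  qed auto
  then show "nn_sq M (\<lambda>\<omega>. complex_of_real (\<Sum>k<N. c k * \<Delta> k \<omega>)) = ennreal (\<Sum>k<N. (c k)\<^sup>2 * (T / real N))"
    by simp
qed

text \<open>Within a block of Q fine intervals the weight is constant and the increments telescope.
  This puts sums over two unrelated uniform grids on their common refinement.\<close>

lemma riemann_sum_refine:
  fixes P Q :: nat and f \<phi> :: "real \<Rightarrow> real"
  assumes "0 < P" "0 < Q"
  shows "(\<Sum>j<P. f (real j * T / real P) * (\<phi> (real (Suc j) * T / real P) - \<phi> (real j * T / real P)))
    = (\<Sum>k<P * Q. f (real (k div Q) * T / real P) *
        (\<phi> (real (Suc k) * T / real (P * Q)) - \<phi> (real k * T / real (P * Q))))" (is "_ = sum ?g _")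
proof -
  let ?h = "\<lambda>k. \<phi> (real k * T / real (P * Q))"
  have "(\<Sum>k\<in>{j * Q..<j * Q + Q}. ?g k)
     = f (real j * T / real P) * (\<phi> (real (Suc j) * T / real P) - \<phi> (real j * T / real P))" for j
  proof -
    have "(\<Sum>k\<in>{j * Q..<j * Q + Q}. ?g k) = (\<Sum>k\<in>{j * Q..<j * Q + Q}. f (real j * T / real P) * (?h (Suc k) - ?h k))"
    proof (intro sum.cong refl)
      fix k assume "k \<in> {j * Q..<j * Q + Q}"
      then have "k div Q = j" by (intro div_nat_eqI) (auto simp: mult.commute)
      then show "?g k = f (real j * T / real P) * (?h (Suc k) - ?h k)" by simp
    qed
    also have "\<dots> = f (real j * T / real P) * (?h (j * Q + Q) - ?h (j * Q))"
      unfolding sum_distrib_left[symmetric] by (subst sum_Suc_diff') simp_all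
    also have "real (j * Q + Q) * T / real (P * Q) = real (Suc j) * T / real P"
      using assms by (simp add: field_simps)
    also have "real (j * Q) * T / real (P * Q) = real j * T / real P"
      using assms by (simp add: field_simps)
    finally show ?thesis .
  qed
  then show ?thesis using sum.nat_group[of ?g Q P] by simp
qed

section \<open>Mean-square convergence of the Riemann sums\<close>

definition L2_Cauchy :: "'w measure \<Rightarrow> (nat \<Rightarrow> 'w \<Rightarrow> complex) \<Rightarrow> bool" where
  "L2_Cauchy M S \<longleftrightarrow> (\<forall>n. S n \<in> borel_measurable M) \<and>
     (\<forall>e>0. \<exists>N. \<forall>m\<ge>N. \<forall>n\<ge>N. nn_sq M (\<lambda>\<omega>. S m \<omega> - S n \<omega>) \<le> ennreal e)"

lemma L2_CauchyD [measurable]: "L2_Cauchy M S \<Longrightarrow> S n \<in> borel_measurable M"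
  by (simp add: L2_Cauchy_def)

lemma L2_Cauchy_cmult:
  assumes S: "L2_Cauchy M S"
  shows "L2_Cauchy M (\<lambda>n \<omega>. c * S n \<omega>)"
  unfolding L2_Cauchy_def
proof (intro conjI allI impI)
  note [measurable] = L2_CauchyD[OF S]
  show "(\<lambda>\<omega>. c * S n \<omega>) \<in> borel_measurable M" for n by measurable
  fix e :: real assume e: "0 < e"
  \<comment> \<open>The added 1 covers c = 0.\<close>
  then have "0 < e / ((cmod c)\<^sup>2 + 1)" by (intro divide_pos_pos) (auto intro: add_nonneg_pos)
  then obtain N where N: "\<And>m n. N \<le> m \<Longrightarrow> N \<le> n \<Longrightarrow> nn_sq M (\<lambda>\<omega>. S m \<omega> - S n \<omega>) \<le> ennreal (e / ((cmod c)\<^sup>2 + 1))"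
    using S unfolding L2_Cauchy_def by blast
  have "nn_sq M (\<lambda>\<omega>. c * S m \<omega> - c * S n \<omega>) \<le> ennreal e" if "N \<le> m" "N \<le> n" for m n
  proof -
    have "nn_sq M (\<lambda>\<omega>. c * S m \<omega> - c * S n \<omega>) = ennreal ((cmod c)\<^sup>2) * nn_sq M (\<lambda>\<omega>. S m \<omega> - S n \<omega>)"
      unfolding right_diff_distrib[symmetric] by (rule nn_sq_cmult) measurable
    also have "\<dots> \<le> ennreal ((cmod c)\<^sup>2) * ennreal (e / ((cmod c)\<^sup>2 + 1))"
      by (intro mult_left_mono N that) simp
    also have "\<dots> = ennreal ((cmod c)\<^sup>2 * (e / ((cmod c)\<^sup>2 + 1)))"
      using e by (intro ennreal_mult[symmetric] divide_nonneg_nonneg) auto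
    also have "\<dots> \<le> ennreal e"
    proof (intro ennreal_leI)
      have p: "0 < (cmod c)\<^sup>2 + 1" by (intro add_nonneg_pos) auto
      have "(cmod c)\<^sup>2 * e \<le> e * ((cmod c)\<^sup>2 + 1)" using e by (simp add: algebra_simps)
      then show "(cmod c)\<^sup>2 * (e / ((cmod c)\<^sup>2 + 1)) \<le> e"
        using p by (simp add: pos_divide_le_eq)
    qed
    finally show ?thesis .
  qed
  then show "\<exists>N. \<forall>m\<ge>N. \<forall>n\<ge>N. nn_sq M (\<lambda>\<omega>. c * S m \<omega> - c * S n \<omega>) \<le> ennreal e" by blast
qed

lemma L2_Cauchy_add:
  assumes S: "L2_Cauchy M S" and R: "L2_Cauchy M R"
  shows "L2_Cauchy M (\<lambda>n \<omega>. S n \<omega> + R n \<omega>)"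
  unfolding L2_Cauchy_def
proof (intro conjI allI impI)
  note [measurable] = L2_CauchyD[OF S] L2_CauchyD[OF R]
  show "(\<lambda>\<omega>. S n \<omega> + R n \<omega>) \<in> borel_measurable M" for n by measurable
  fix e :: real assume e: "0 < e"
  \<comment> \<open>Two differences, each doubled by \<open>nn_sq_add\<close>, share e.\<close>
  then have e4: "0 < e / 4" by simp
  obtain N1 where N1: "\<And>m n. N1 \<le> m \<Longrightarrow> N1 \<le> n \<Longrightarrow> nn_sq M (\<lambda>\<omega>. S m \<omega> - S n \<omega>) \<le> ennreal (e / 4)"
    using S e4 unfolding L2_Cauchy_def by blast
  obtain N2 where N2: "\<And>m n. N2 \<le> m \<Longrightarrow> N2 \<le> n \<Longrightarrow> nn_sq M (\<lambda>\<omega>. R m \<omega> - R n \<omega>) \<le> ennreal (e / 4)"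
    using R e4 unfolding L2_Cauchy_def by blast
  have "nn_sq M (\<lambda>\<omega>. S m \<omega> + R m \<omega> - (S n \<omega> + R n \<omega>)) \<le> ennreal e" if "max N1 N2 \<le> m" "max N1 N2 \<le> n" for m n
  proof -
    have "nn_sq M (\<lambda>\<omega>. S m \<omega> + R m \<omega> - (S n \<omega> + R n \<omega>)) = nn_sq M (\<lambda>\<omega>. (S m \<omega> - S n \<omega>) + (R m \<omega> - R n \<omega>))"
      by (simp add: algebra_simps)
    also have "\<dots> \<le> 2 * nn_sq M (\<lambda>\<omega>. S m \<omega> - S n \<omega>) + 2 * nn_sq M (\<lambda>\<omega>. R m \<omega> - R n \<omega>)"
      by (rule nn_sq_add) measurable
    also have "\<dots> \<le> 2 * ennreal (e / 4) + 2 * ennreal (e / 4)"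
      using that by (intro add_mono mult_left_mono N1 N2) auto
    also have "\<dots> = ennreal (2 * (e / 4) + 2 * (e / 4))"
    proof -
      have "2 * ennreal (e / 4) = ennreal (2 * (e / 4))" using e by (subst ennreal_mult) auto
      then show ?thesis using e by (subst ennreal_plus) auto
    qed
    also have "2 * (e / 4) + 2 * (e / 4) = e" by simp
    finally show ?thesis .
  qed
  then show "\<exists>N. \<forall>m\<ge>N. \<forall>n\<ge>N. nn_sq M (\<lambda>\<omega>. S m \<omega> + R m \<omega> - (S n \<omega> + R n \<omega>)) \<le> ennreal e" by blast
qed

lemma (in prob_space) L2_Cauchy_limit:
  assumes "L2_Cauchy M S"
  shows "L2_limit M S \<in> borel_measurable M"
    and "(\<lambda>n. nn_sq M (\<lambda>\<omega>. S n \<omega> - L2_limit M S \<omega>)) \<longlonglongrightarrow> 0"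
  using assms L2_limit[of S] unfolding L2_Cauchy_def by blast+

text \<open>Uniform grids of different sizes need not be nested, so both sums are written over P Q
  intervals. The discrete isometry reduces their distance to that of two step functions, small by
  uniform continuity of f.\<close>

lemma (in prob_space) L2_Cauchy_riemann_sum:
  assumes b: "std_brownian_motion M b" and T: "0 < T" and f: "continuous_on {0..T} f"
  shows "L2_Cauchy M (\<lambda>n \<omega>. complex_of_real (riemann_sum f (\<lambda>t. b t \<omega>) T n))"
  unfolding L2_Cauchy_def
proof (intro conjI allI impI)
  show "(\<lambda>\<omega>. complex_of_real (riemann_sum f (\<lambda>t. b t \<omega>) T n)) \<in> borel_measurable M" for n
    unfolding riemann_sum_def
    by (rule measurable_compose[OF brownian_weighted_increments(1)[OF b T] borel_measurable_of_real]) simp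
  fix e :: real assume e: "0 < e"
  \<comment> \<open>Both step functions stay within \<open>\<eta>\<close> of f, so they differ by at
    most sqrt (e / T); the square, integrated over length T, gives e.\<close>
  define \<eta> where "\<eta> = sqrt (e / T) / 2"
  have \<eta>: "0 < \<eta>" using e T by (simp add: \<eta>_def)
  have "uniformly_continuous_on {0..T} f"
    using f by (intro compact_uniformly_continuous) auto
  then obtain \<delta> where \<delta>: "0 < \<delta>"
    and uc: "\<And>s t. s \<in> {0..T} \<Longrightarrow> t \<in> {0..T} \<Longrightarrow> dist s t < \<delta> \<Longrightarrow> dist (f s) (f t) < \<eta>"
    unfolding uniformly_continuous_on_def using \<eta> by metis
  obtain N0 where N0: "T / \<delta> < real N0" using reals_Archimedean2 by blast
  \<comment> \<open>The coarse point of index k div Q lies at or to the left of the fine point of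
    index k, less than one coarse step T / P away.\<close>
  have mesh: "\<bar>f (real (k div Q) * T / real P) - f (real k * T / real (P * Q))\<bar> < \<eta>"
    if P: "N0 < P" and Q: "0 < Q" and k: "k < P * Q" for P Q k :: nat
  proof -
    have P0: "0 < real P" and Q0: "0 < real Q" using P Q by auto
    have "T / \<delta> < real P" using N0 P by linarith
    then have "T / real P < \<delta>" using \<delta> P0 T by (simp add: field_simps)
    have kq: "real k = real (k div Q) * real Q + real (k mod Q)"
      by (metis of_nat_add of_nat_mult div_mult_mod_eq)
    have d: "real k * T / real (P * Q) - real (k div Q) * T / real P = real (k mod Q) / real Q * (T / real P)"
      unfolding kq using P0 Q0 by (simp add: field_simps)
    have m: "0 \<le> real (k mod Q) / real Q" "real (k mod Q) / real Q < 1"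
      using Q by auto
    have d0: "0 \<le> real k * T / real (P * Q) - real (k div Q) * T / real P"
      unfolding d using m T P0 by simp
    have "real (k mod Q) / real Q * (T / real P) < 1 * (T / real P)"
      using m T P0 by (intro mult_strict_right_mono) auto
    then have d1: "real k * T / real (P * Q) - real (k div Q) * T / real P < \<delta>"
      unfolding d using \<open>T / real P < \<delta>\<close> by simp
    have "real k < real (P * Q)" using k by (simp only: of_nat_less_iff)
    then have "real k * T \<le> real (P * Q) * T" using T by simp
    then have t1: "real k * T / real (P * Q) \<le> T"
      using P0 Q0 by (simp add: divide_le_eq mult_ac)
    have "dist (f (real (k div Q) * T / real P)) (f (real k * T / real (P * Q))) < \<eta>"
    proof (rule uc)
      show "real (k div Q) * T / real P \<in> {0..T}" "real k * T / real (P * Q) \<in> {0..T}"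
        using d0 t1 T by auto
      show "dist (real (k div Q) * T / real P) (real k * T / real (P * Q)) < \<delta>"
        using d0 d1 by (simp add: dist_real_def)
    qed
    then show ?thesis by (simp add: dist_real_def)
  qed
  have "nn_sq M (\<lambda>\<omega>. complex_of_real (riemann_sum f (\<lambda>t. b t \<omega>) T m) - complex_of_real (riemann_sum f (\<lambda>t. b t \<omega>) T n)) \<le> ennreal e"
    if m: "N0 \<le> m" and n: "N0 \<le> n" for m n
  proof -
    define P Q where "P = Suc m" and "Q = Suc n"
    have PQ: "N0 < P" "N0 < Q" "0 < P" "0 < Q" "0 < P * Q" using m n by (auto simp: P_def Q_def)
    define c where "c k = f (real (k div Q) * T / real P) - f (real (k div P) * T / real Q)" for k
    have eq: "riemann_sum f \<phi> T m - riemann_sum f \<phi> T n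
      = (\<Sum>k<P * Q. c k * (\<phi> (real (Suc k) * T / real (P * Q)) - \<phi> (real k * T / real (P * Q))))" for \<phi>
      unfolding riemann_sum_def P_def[symmetric] Q_def[symmetric]
        riemann_sum_refine[OF PQ(3,4)] riemann_sum_refine[OF PQ(4,3)] mult.commute[of Q P]
      unfolding c_def sum_subtractf[symmetric] left_diff_distrib[symmetric] ..
    have "nn_sq M (\<lambda>\<omega>. complex_of_real (riemann_sum f (\<lambda>t. b t \<omega>) T m) - complex_of_real (riemann_sum f (\<lambda>t. b t \<omega>) T n))
      = ennreal (\<Sum>k<P * Q. (c k)\<^sup>2 * (T / real (P * Q)))"
      unfolding of_real_diff[symmetric] eq
      by (rule brownian_weighted_increments(3)[OF b T PQ(5)])
    also have "\<dots> \<le> ennreal (\<Sum>k<P * Q. e / T * (T / real (P * Q)))"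
    proof (intro ennreal_leI sum_mono mult_right_mono)
      fix k assume "k \<in> {..<P * Q}"
      then have k: "k < P * Q" "k < Q * P" by (auto simp: mult.commute)
      have "\<bar>c k\<bar> < \<eta> + \<eta>"
        using mesh[OF PQ(1,4) k(1)] mesh[OF PQ(2,3) k(2)] unfolding c_def mult.commute[of Q P] by linarith
      then have "\<bar>c k\<bar> \<le> sqrt (e / T)" by (simp add: \<eta>_def)
      then have "\<bar>c k\<bar>\<^sup>2 \<le> (sqrt (e / T))\<^sup>2" by (intro power_mono) auto
      then show "(c k)\<^sup>2 \<le> e / T" using e T by simp
    qed (use T in auto)
    also have "(\<Sum>k<P * Q. e / T * (T / real (P * Q))) = e"
      using T PQ by simp
    finally show ?thesis .
  qed
  then show "\<exists>N. \<forall>m\<ge>N. \<forall>n\<ge>N. nn_sq M (\<lambda>\<omega>. complex_of_real (riemann_sum f (\<lambda>t. b t \<omega>) T m)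
      - complex_of_real (riemann_sum f (\<lambda>t. b t \<omega>) T n)) \<le> ennreal e" by blast
qed

text \<open>The sum reads finitely many coordinates of the path at nonnegative times, hence is
  measurable for the product sigma-algebra in which independence of the paths is stated.\<close>

lemma borel_measurable_riemann_sum:
  assumes "0 \<le> T"
  shows "(\<lambda>\<phi>. riemann_sum f \<phi> T n) \<in> borel_measurable (Pi\<^sub>M {0..} (\<lambda>_. borel))"
proof -
  have c[measurable]: "(\<lambda>\<phi>. \<phi> t) \<in> borel_measurable (Pi\<^sub>M {0..} (\<lambda>_. borel))" if "0 \<le> t" for t :: real
    using that by (intro measurable_component_singleton) auto
  show ?thesis
    unfolding riemann_sum_def
    by (intro borel_measurable_sum borel_measurable_times borel_measurable_const borel_measurable_diff c)
      (use assms in auto)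
qed

lemma riemann_sum_restrict:
  "0 \<le> T \<Longrightarrow> riemann_sum f (restrict \<phi> {0..}) T n = riemann_sum f \<phi> T n"
  unfolding riemann_sum_def by (intro sum.cong) (auto simp: restrict_def)

text \<open>The discrete isometry with weights of modulus at most 1. The exact value v is recorded
  because orthogonality requires an equation for the second moments.\<close>

lemma (in prob_space) nn_sq_riemann_sum:
  assumes "std_brownian_motion M b" "0 < T" and f: "\<And>s. s \<in> {0..T} \<Longrightarrow> \<bar>f s\<bar> \<le> 1"
  shows "\<exists>v. 0 \<le> v \<and> v \<le> T \<and> nn_sq M (\<lambda>\<omega>. complex_of_real (riemann_sum f (\<lambda>t. b t \<omega>) T n)) = ennreal v"
proof (intro exI conjI)
  let ?v = "\<Sum>k<Suc n. (f (real k * T / real (Suc n)))\<^sup>2 * (T / real (Suc n))"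
  show "nn_sq M (\<lambda>\<omega>. complex_of_real (riemann_sum f (\<lambda>t. b t \<omega>) T n)) = ennreal ?v"
    unfolding riemann_sum_def by (rule brownian_weighted_increments(3)[OF assms(1,2)]) simp
  show "0 \<le> ?v" using assms(2) by (intro sum_nonneg) auto
  have "?v \<le> (\<Sum>k<Suc n. 1 * (T / real (Suc n)))"
  proof (intro sum_mono mult_right_mono)
    fix k assume k: "k \<in> {..<Suc n}"
    then have "real k * T / real (Suc n) \<in> {0..T}"
      using assms(2) by (auto simp: divide_le_eq mult.commute[of T])
    then have "\<bar>f (real k * T / real (Suc n))\<bar> \<le> 1" by (rule f)
    then show "(f (real k * T / real (Suc n)))\<^sup>2 \<le> 1" by (simp add: abs_square_le_1)
  qed (use assms(2) in auto)
  also have "\<dots> = T" by simp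
  finally show "?v \<le> T" .
qed

text \<open>Functionals of independent paths are independent; being centred, they are orthogonal.
  Injectivity of \<open>\<iota>\<close> ensures that different summands use different Brownian
  motions.\<close>

lemma (in prob_space) nn_sq_independent_riemann_sums:
  fixes B :: "'i \<Rightarrow> real \<Rightarrow> 'a \<Rightarrow> real" and c :: "'j \<Rightarrow> complex"
  assumes bm: "\<And>i. i \<in> I \<Longrightarrow> std_brownian_motion M (B i)"
    and ind: "indep_vars (\<lambda>_. Pi\<^sub>M {0..} (\<lambda>_. borel)) (\<lambda>i \<omega>. restrict (\<lambda>t. B i t \<omega>) {0..}) I"
    and T: "0 < T" and f: "\<And>i s. s \<in> {0..T} \<Longrightarrow> \<bar>f i s\<bar> \<le> 1"
    and J: "finite J" "inj_on \<iota> J" "\<iota> ` J \<subseteq> I"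
  shows "nn_sq M (\<lambda>\<omega>. \<Sum>j\<in>J. c j * complex_of_real (riemann_sum (f (\<iota> j)) (\<lambda>t. B (\<iota> j) t \<omega>) T n))
    \<le> ennreal (\<Sum>j\<in>J. (cmod (c j))\<^sup>2 * T)"
proof -
  define R where "R i \<omega> = riemann_sum (f i) (\<lambda>t. B i t \<omega>) T n" for i \<omega>
  have "\<exists>v. 0 \<le> v \<and> v \<le> T \<and> nn_sq M (\<lambda>\<omega>. complex_of_real (R i \<omega>)) = ennreal v" if "i \<in> I" for i
    unfolding R_def using that by (intro nn_sq_riemann_sum bm T f)
  then obtain v where v: "\<And>i. i \<in> I \<Longrightarrow> 0 \<le> v i" "\<And>i. i \<in> I \<Longrightarrow> v i \<le> T"
    "\<And>i. i \<in> I \<Longrightarrow> nn_sq M (\<lambda>\<omega>. complex_of_real (R i \<omega>)) = ennreal (v i)"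
    by metis
  have m: "R i \<in> borel_measurable M" if "i \<in> I" for i
    unfolding R_def riemann_sum_def using that by (intro brownian_weighted_increments(1) bm T) auto
  have E0: "expectation (R i) = 0" if "i \<in> I" for i
    unfolding R_def riemann_sum_def using that by (intro brownian_weighted_increments(2) bm T) auto
  have i2: "integrable M (\<lambda>\<omega>. (R i \<omega>)\<^sup>2)" if "i \<in> I" for i
    using integrable_sq_of_nn_sq[of "\<lambda>\<omega>. complex_of_real (R i \<omega>)" M] v(3)[OF that] m[OF that] by simp
  have i1: "integrable M (R i)" if "i \<in> I" for i
    by (rule square_integrable_imp_integrable[OF m i2]) (use that in auto)
  have E2: "expectation (\<lambda>\<omega>. (R i \<omega>)\<^sup>2) = v i" if "i \<in> I" for i
  proof -
    have "ennreal (expectation (\<lambda>\<omega>. (R i \<omega>)\<^sup>2)) = ennreal (v i)"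
      unfolding v(3)[OF that, symmetric] nn_sq_def
      by (subst nn_integral_eq_integral[symmetric]) (auto simp: i2 that)
    then show ?thesis using v(1)[OF that] by simp
  qed
  have "indep_vars (\<lambda>_. borel) (\<lambda>i \<omega>. riemann_sum (f i) (restrict (\<lambda>t. B i t \<omega>) {0..}) T n) I"
    using T by (intro indep_vars_compose2[OF ind] borel_measurable_riemann_sum) auto
  then have indR: "indep_vars (\<lambda>_. borel) R I"
    using T by (simp add: riemann_sum_restrict R_def[abs_def])
  have "nn_sq M (\<lambda>\<omega>. \<Sum>j\<in>J. c j * complex_of_real (R (\<iota> j) \<omega>)) = ennreal (\<Sum>j\<in>J. (cmod (c j))\<^sup>2 * v (\<iota> j))"
  proof (rule nn_sq_orthogonal[OF J(1)])
    fix j assume "j \<in> J"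
    then have j: "\<iota> j \<in> I" using J by auto
    show "(\<lambda>\<omega>. complex_of_real (R (\<iota> j) \<omega>)) \<in> borel_measurable M" using m[OF j] by measurable
    show "nn_sq M (\<lambda>\<omega>. complex_of_real (R (\<iota> j) \<omega>)) < \<infinity>" using v(3)[OF j] by simp
  next
    fix j k assume jk: "j \<in> J" "k \<in> J"
    then have I: "\<iota> j \<in> I" "\<iota> k \<in> I" using J by auto
    have "expectation (\<lambda>\<omega>. R (\<iota> j) \<omega> * R (\<iota> k) \<omega>) = (if j = k then v (\<iota> j) else 0)"
    proof (cases "j = k")
      case True
      then show ?thesis using E2[OF I(1)] by (simp add: power2_eq_square)
    next
      case False
      then have "\<iota> j \<noteq> \<iota> k" using J jk by (auto dest: inj_onD)
      from indep_vars_expectation_mult[OF indR I this i1[OF I(1)] i1[OF I(2)]] show ?thesis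
        using False E0[OF I(1)] by simp
    qed
    then show "(\<integral>\<omega>. complex_of_real (R (\<iota> j) \<omega>) * cnj (complex_of_real (R (\<iota> k) \<omega>)) \<partial>M)
       = (if j = k then complex_of_real (v (\<iota> j)) else 0)"
      by (simp flip: of_real_mult)
  qed
  also have "\<dots> \<le> ennreal (\<Sum>j\<in>J. (cmod (c j))\<^sup>2 * T)"
    using J v(2) by (intro ennreal_leI sum_mono mult_left_mono) auto
  finally show ?thesis unfolding R_def .
qed

text \<open>With \<open>W_factor2\<close>, the coefficients of the two real Brownian motions in W
  for every sign of m. At m = 0 the second one is 0, matching the absence of
  \<open>Inr (l, 0)\<close> from \<open>bm_index\<close>.\<close>

definition W_factor1 :: "(nat \<Rightarrow> real) \<Rightarrow> nat \<Rightarrow> int \<Rightarrow> complex" where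
  "W_factor1 A l m = (if m = 0 then of_real (sqrt (A l)) else if m > 0 then of_real (sqrt (A l / 2))
     else (-1) ^ nat (- m) * of_real (sqrt (A l / 2)))"

definition W_factor2 :: "(nat \<Rightarrow> real) \<Rightarrow> nat \<Rightarrow> int \<Rightarrow> complex" where
  "W_factor2 A l m = (if m = 0 then 0 else if m > 0 then - \<i> * of_real (sqrt (A l / 2))
     else (-1) ^ nat (- m) * \<i> * of_real (sqrt (A l / 2)))"

lemma W_coeff_eq:
  "W_coeff A \<beta>1 \<beta>2 l m t \<omega> = W_factor1 A l m * of_real (bm_family \<beta>1 \<beta>2 (Inl (l, nat \<bar>m\<bar>)) t \<omega>)
     + W_factor2 A l m * of_real (bm_family \<beta>1 \<beta>2 (Inr (l, nat \<bar>m\<bar>)) t \<omega>)"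
  by (simp add: W_coeff_def W_factor1_def W_factor2_def bm_family_def Complex_eq algebra_simps)

lemma ito_riemann_sum_W_coeff:
  "ito_riemann_sum f (W_coeff A \<beta>1 \<beta>2 l m) T n \<omega> =
     W_factor1 A l m * of_real (riemann_sum f (\<lambda>t. bm_family \<beta>1 \<beta>2 (Inl (l, nat \<bar>m\<bar>)) t \<omega>) T n)
   + W_factor2 A l m * of_real (riemann_sum f (\<lambda>t. bm_family \<beta>1 \<beta>2 (Inr (l, nat \<bar>m\<bar>)) t \<omega>) T n)"
  unfolding ito_riemann_sum_def riemann_sum_def W_coeff_eq of_real_sum sum_distrib_left sum.distrib[symmetric]
  by (intro sum.cong refl) (simp only: of_real_mult of_real_diff, simp only: algebra_simps)

lemma W_factor_le:
  assumes "0 \<le> A l"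
  shows "(cmod (W_factor1 A l m))\<^sup>2 \<le> A l" "(cmod (W_factor2 A l m))\<^sup>2 \<le> A l"
  using assms by (auto simp: W_factor1_def W_factor2_def norm_mult norm_power)

lemma Inl_bm_index: "\<bar>m\<bar> \<le> int l \<Longrightarrow> Inl (l, nat \<bar>m\<bar>) \<in> bm_index"
  by (auto simp: bm_index_def)

lemma Inr_bm_index: "\<bar>m\<bar> \<le> int l \<Longrightarrow> m \<noteq> 0 \<Longrightarrow> Inr (l, nat \<bar>m\<bar>) \<in> bm_index"
  by (auto simp: bm_index_def)

text \<open>Keeps exactly what the forced part has to know about the Mittag-Leffler kernel:
  continuity and the bound 1 on [0, T].\<close>

locale driving_noise = prob_space M for M :: "'w measure" +
  fixes \<beta>1 \<beta>2 :: "nat \<Rightarrow> nat \<Rightarrow> real \<Rightarrow> 'w \<Rightarrow> real" and A :: "nat \<Rightarrow> real"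
    and f :: "nat \<Rightarrow> real \<Rightarrow> real" and T :: real
  assumes bm: "\<And>i. i \<in> bm_index \<Longrightarrow> std_brownian_motion M (bm_family \<beta>1 \<beta>2 i)"
    and ind: "indep_vars (\<lambda>_. Pi\<^sub>M {0..} (\<lambda>_. borel))
           (\<lambda>i \<omega>. restrict (\<lambda>t. bm_family \<beta>1 \<beta>2 i t \<omega>) {0..}) bm_index"
    and A: "\<And>l. 0 \<le> A l" and T: "0 < T"
    and f: "\<And>l. continuous_on {0..T} (f l)" "\<And>l s. s \<in> {0..T} \<Longrightarrow> \<bar>f l s\<bar> \<le> 1"
begin

abbreviation RW :: "nat \<Rightarrow> int \<Rightarrow> nat \<Rightarrow> 'w \<Rightarrow> complex" where
  "RW l m n \<equiv> ito_riemann_sum (f l) (W_coeff A \<beta>1 \<beta>2 l m) T n"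

text \<open>The case m = 0 is separate because \<open>Inr (l, 0)\<close> lies outside
  \<open>bm_index\<close>, where nothing is known about the path.\<close>

lemma L2_Cauchy_RW:
  assumes m: "\<bar>m\<bar> \<le> int l"
  shows "L2_Cauchy M (RW l m)"
proof (cases "m = 0")
  case True
  have "L2_Cauchy M (\<lambda>n \<omega>. W_factor1 A l m * of_real (riemann_sum (f l) (\<lambda>t. bm_family \<beta>1 \<beta>2 (Inl (l, nat \<bar>m\<bar>)) t \<omega>) T n))"
    by (intro L2_Cauchy_cmult L2_Cauchy_riemann_sum bm Inl_bm_index m T f)
  then show ?thesis
    unfolding ito_riemann_sum_W_coeff[abs_def] using True by (simp add: W_factor2_def)
next
  case False
  then show ?thesis
    unfolding ito_riemann_sum_W_coeff[abs_def]
    by (intro L2_Cauchy_add L2_Cauchy_cmult L2_Cauchy_riemann_sum bm Inl_bm_index Inr_bm_index m T f)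
qed

text \<open>The coefficients of index \<open>m\<close> and \<open>-m\<close> share their Brownian motions, so the sum is split
  according to the sign of \<open>m\<close> and to the two families in order to obtain orthogonal sums.\<close>

lemma nn_sq_sum_RW:
  assumes J: "finite J" "\<And>l m. (l, m) \<in> J \<Longrightarrow> \<bar>m\<bar> \<le> int l"
  shows "nn_sq M (\<lambda>\<omega>. \<Sum>(l, m)\<in>J. w l m * RW l m n \<omega>) \<le> ennreal (16 * (\<Sum>(l, m)\<in>J. (cmod (w l m))\<^sup>2 * (T * A l)))"
proof -
  define S where "S = (\<Sum>(l, m)\<in>J. (cmod (w l m))\<^sup>2 * (T * A l))"
  have S0: "0 \<le> S" unfolding S_def using T A by (intro sum_nonneg) auto
  define lev :: "(nat \<times> nat) + (nat \<times> nat) \<Rightarrow> nat" where "lev i = (case i of Inl p \<Rightarrow> fst p | Inr p \<Rightarrow> fst p)" for i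
  define R where "R i \<omega> = complex_of_real (riemann_sum (f (lev i)) (\<lambda>t. bm_family \<beta>1 \<beta>2 i t \<omega>) T n)" for i \<omega>
  define i1 :: "nat \<times> int \<Rightarrow> (nat \<times> nat) + (nat \<times> nat)" where "i1 j = Inl (fst j, nat \<bar>snd j\<bar>)" for j
  define i2 :: "nat \<times> int \<Rightarrow> (nat \<times> nat) + (nat \<times> nat)" where "i2 j = Inr (fst j, nat \<bar>snd j\<bar>)" for j
  define c1 where "c1 j = w (fst j) (snd j) * W_factor1 A (fst j) (snd j)" for j
  define c2 where "c2 j = w (fst j) (snd j) * W_factor2 A (fst j) (snd j)" for j
  have m: "R i \<in> borel_measurable M" if "i \<in> bm_index" for i
    unfolding R_def[abs_def] using L2_CauchyD[OF L2_Cauchy_riemann_sum[OF bm[OF that] T f(1)]] by simp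
  have part: "nn_sq M (\<lambda>\<omega>. \<Sum>j\<in>K. c j * R (\<iota> j) \<omega>) \<le> ennreal S"
    if K: "K \<subseteq> J" and \<iota>: "inj_on \<iota> K" "\<iota> ` K \<subseteq> bm_index"
      and c: "\<And>j. (cmod (c j))\<^sup>2 \<le> (cmod (w (fst j) (snd j)))\<^sup>2 * A (fst j)" for K \<iota> c
  proof -
    have "nn_sq M (\<lambda>\<omega>. \<Sum>j\<in>K. c j * R (\<iota> j) \<omega>) \<le> ennreal (\<Sum>j\<in>K. (cmod (c j))\<^sup>2 * T)"
      unfolding R_def using finite_subset[OF K J(1)]
      by (intro nn_sq_independent_riemann_sums[where f = "\<lambda>i. f (lev i)", OF bm ind T f(2) _ \<iota>]) auto
    also have "\<dots> \<le> ennreal (\<Sum>j\<in>K. (cmod (w (fst j) (snd j)))\<^sup>2 * (T * A (fst j)))"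
      using mult_right_mono[OF c less_imp_le[OF T]] by (intro ennreal_leI sum_mono) (simp add: mult_ac)
    also have "\<dots> \<le> ennreal S"
      unfolding S_def case_prod_beta using J K T A by (intro ennreal_leI sum_mono2) auto
    finally show ?thesis .
  qed
  \<comment> \<open>On each of these sets |m| determines m, so different pairs use different
    motions. The index m = 0 is put into \<open>J0\<close> but not \<open>J2\<close>, since its
    second factor vanishes.\<close>
  define J0 J1 J2 where "J0 = {j \<in> J. 0 \<le> snd j}" and "J1 = {j \<in> J. snd j < 0}" and "J2 = {j \<in> J. 0 < snd j}"
  have fin: "finite J0" "finite J1" "finite J2" using J(1) by (auto simp: J0_def J1_def J2_def)
  have inj: "inj_on i1 J0" "inj_on i1 J1" "inj_on i2 J2" "inj_on i2 J1"
    by (auto simp: inj_on_def i1_def i2_def J0_def J1_def J2_def)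
  have im: "i1 ` J0 \<subseteq> bm_index" "i1 ` J1 \<subseteq> bm_index" "i2 ` J2 \<subseteq> bm_index" "i2 ` J1 \<subseteq> bm_index"
  proof -
    have "i1 j \<in> bm_index" if "j \<in> J" for j
      unfolding i1_def using that J(2)[of "fst j" "snd j"] by (intro Inl_bm_index) simp
    moreover have "i2 j \<in> bm_index" if "j \<in> J" "snd j \<noteq> 0" for j
      unfolding i2_def using that J(2)[of "fst j" "snd j"] by (intro Inr_bm_index) simp_all
    ultimately show "i1 ` J0 \<subseteq> bm_index" "i1 ` J1 \<subseteq> bm_index" "i2 ` J2 \<subseteq> bm_index" "i2 ` J1 \<subseteq> bm_index"
      by (auto simp: J0_def J1_def J2_def)
  qed
  have c: "(cmod (c1 j))\<^sup>2 \<le> (cmod (w (fst j) (snd j)))\<^sup>2 * A (fst j)"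
    "(cmod (c2 j))\<^sup>2 \<le> (cmod (w (fst j) (snd j)))\<^sup>2 * A (fst j)" for j
    unfolding c1_def c2_def norm_mult power_mult_distrib by (intro mult_left_mono W_factor_le A; simp)+
  let ?X = "\<lambda>K c i \<omega>. \<Sum>j\<in>K. c j * R (i j) \<omega>"
  have meas: "?X J0 c1 i1 \<in> borel_measurable M" "?X J1 c1 i1 \<in> borel_measurable M"
    "?X J2 c2 i2 \<in> borel_measurable M" "?X J1 c2 i2 \<in> borel_measurable M"
    using im by (auto intro!: borel_measurable_sum borel_measurable_times m)
  have eq: "(\<Sum>(l, m)\<in>J. w l m * RW l m n \<omega>) = (?X J0 c1 i1 \<omega> + ?X J1 c1 i1 \<omega>) + (?X J2 c2 i2 \<omega> + ?X J1 c2 i2 \<omega>)" for \<omega>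
  proof -
    have "(\<Sum>(l, m)\<in>J. w l m * RW l m n \<omega>) = (\<Sum>j\<in>J. c1 j * R (i1 j) \<omega>) + (\<Sum>j\<in>J. c2 j * R (i2 j) \<omega>)"
      unfolding ito_riemann_sum_W_coeff sum.distrib[symmetric] case_prod_beta
      by (intro sum.cong refl) (simp add: c1_def c2_def R_def i1_def i2_def lev_def algebra_simps)
    also have "(\<Sum>j\<in>J. c1 j * R (i1 j) \<omega>) = ?X J0 c1 i1 \<omega> + ?X J1 c1 i1 \<omega>"
      using J(1) by (subst sum.union_disjoint[symmetric]) (auto simp: J0_def J1_def intro!: sum.cong)
    also have "(\<Sum>j\<in>J. c2 j * R (i2 j) \<omega>) = (\<Sum>j\<in>J2 \<union> J1. c2 j * R (i2 j) \<omega>)"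
      using J(1) by (intro sum.mono_neutral_right) (auto simp: J2_def J1_def c2_def W_factor2_def)
    also have "\<dots> = ?X J2 c2 i2 \<omega> + ?X J1 c2 i2 \<omega>"
      using fin by (intro sum.union_disjoint) (auto simp: J1_def J2_def)
    finally show ?thesis .
  qed
  have "nn_sq M (\<lambda>\<omega>. \<Sum>(l, m)\<in>J. w l m * RW l m n \<omega>)
      \<le> 2 * nn_sq M (\<lambda>\<omega>. ?X J0 c1 i1 \<omega> + ?X J1 c1 i1 \<omega>) + 2 * nn_sq M (\<lambda>\<omega>. ?X J2 c2 i2 \<omega> + ?X J1 c2 i2 \<omega>)"
    unfolding eq by (intro nn_sq_add borel_measurable_add meas)
  also have "\<dots> \<le> 2 * (2 * nn_sq M (?X J0 c1 i1) + 2 * nn_sq M (?X J1 c1 i1)) + 2 * (2 * nn_sq M (?X J2 c2 i2) + 2 * nn_sq M (?X J1 c2 i2))"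
    by (intro add_mono mult_left_mono nn_sq_add meas) auto
  \<comment> \<open>Four sums, each doubled twice and bounded by S, give the constant 16.\<close>
  also have "\<dots> \<le> 2 * (2 * ennreal S + 2 * ennreal S) + 2 * (2 * ennreal S + 2 * ennreal S)"
    by (intro add_mono mult_left_mono part inj im c) (auto simp: J0_def J1_def J2_def)
  also have "\<dots> = ennreal (16 * S)"
  proof -
    have "2 * (2 * ennreal S + 2 * ennreal S) + 2 * (2 * ennreal S + 2 * ennreal S) = 16 * ennreal S"
      by (simp add: algebra_simps flip: mult_2)
    then show ?thesis using S0 by (simp add: ennreal_mult)
  qed
  finally show ?thesis by (simp add: S_def)
qed

abbreviation IW :: "nat \<Rightarrow> int \<Rightarrow> 'w \<Rightarrow> complex" where
  "IW l m \<equiv> ito_integral M (f l) (W_coeff A \<beta>1 \<beta>2 l m) T"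

lemma borel_measurable_IW: "\<bar>m\<bar> \<le> int l \<Longrightarrow> IW l m \<in> borel_measurable M"
  unfolding ito_integral_def by (intro L2_Cauchy_limit L2_Cauchy_RW)

text \<open>Passing from the Riemann sums to their mean-square limit doubles the constant
  16.\<close>

lemma nn_sq_sum_IW:
  assumes J: "finite J" "\<And>l m. (l, m) \<in> J \<Longrightarrow> \<bar>m\<bar> \<le> int l"
  shows "nn_sq M (\<lambda>\<omega>. \<Sum>(l, m)\<in>J. w l m * IW l m \<omega>) \<le> ennreal (32 * (\<Sum>(l, m)\<in>J. (cmod (w l m))\<^sup>2 * (T * A l)))"
proof -
  have RWm: "RW l m n \<in> borel_measurable M" if "(l, m) \<in> J" for l m n
    using J(2)[OF that] by (intro L2_CauchyD L2_Cauchy_RW)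
  have IWm: "IW l m \<in> borel_measurable M" if "(l, m) \<in> J" for l m
    using J(2)[OF that] by (intro borel_measurable_IW)
  have "nn_sq M (\<lambda>\<omega>. \<Sum>(l, m)\<in>J. w l m * IW l m \<omega>) \<le> 2 * ennreal (16 * (\<Sum>(l, m)\<in>J. (cmod (w l m))\<^sup>2 * (T * A l)))"
  proof (rule nn_sq_le_of_tendsto)
    show "nn_sq M (\<lambda>\<omega>. \<Sum>(l, m)\<in>J. w l m * RW l m n \<omega>) \<le> ennreal (16 * (\<Sum>(l, m)\<in>J. (cmod (w l m))\<^sup>2 * (T * A l)))" for n
      by (rule nn_sq_sum_RW[OF J])
    have "(\<lambda>n. nn_sq M (\<lambda>\<omega>. \<Sum>j\<in>J. (case j of (l, m) \<Rightarrow> w l m) * (case j of (l, m) \<Rightarrow> RW l m n \<omega> - IW l m \<omega>))) \<longlonglongrightarrow> 0"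
    proof (rule nn_sq_tendsto_0_sum[OF J(1)])
      fix j assume j: "j \<in> J"
      obtain l m where lm: "j = (l, m)" by force
      show "(\<lambda>\<omega>. case j of (l, m) \<Rightarrow> RW l m n \<omega> - IW l m \<omega>) \<in> borel_measurable M" for n
        using j RWm IWm by (simp add: lm)
      show "(\<lambda>n. nn_sq M (\<lambda>\<omega>. case j of (l, m) \<Rightarrow> RW l m n \<omega> - IW l m \<omega>)) \<longlonglongrightarrow> 0"
        using L2_Cauchy_limit(2)[OF L2_Cauchy_RW[OF J(2)]] j by (simp add: lm ito_integral_def)
    qed
    then show "(\<lambda>n. nn_sq M (\<lambda>\<omega>. (\<Sum>(l, m)\<in>J. w l m * RW l m n \<omega>) - (\<Sum>(l, m)\<in>J. w l m * IW l m \<omega>))) \<longlonglongrightarrow> 0"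
      unfolding sum_subtractf[symmetric] by (simp add: case_prod_beta right_diff_distrib)
  qed (auto intro!: borel_measurable_sum borel_measurable_times RWm IWm simp: case_prod_beta)
  also have "\<dots> = ennreal (32 * (\<Sum>(l, m)\<in>J. (cmod (w l m))\<^sup>2 * (T * A l)))"
  proof -
    have "0 \<le> (\<Sum>(l, m)\<in>J. (cmod (w l m))\<^sup>2 * (T * A l))" using T A by (intro sum_nonneg) auto
    then show ?thesis by (simp add: ennreal_mult flip: mult.assoc)
  qed
  finally show ?thesis .
qed

end

section \<open>Variance of the increments\<close>

lemma (in prob_space) nn_sq_sum_fourier_coeff:
  assumes \<xi>: "(\<lambda>(x, \<omega>). \<xi> x \<omega>) \<in> borel_measurable (S2_measure \<Otimes>\<^sub>M M)"
    and iso: "weakly_isotropic2 M \<xi>"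
    and cov: "\<And>l m l' m'. \<bar>m\<bar> \<le> int l \<Longrightarrow> \<bar>m'\<bar> \<le> int l' \<Longrightarrow>
           (\<integral>\<omega>. fourier_coeff \<xi> l m \<omega> * cnj (fourier_coeff \<xi> l' m' \<omega>) \<partial>M)
             = (if l = l' \<and> m = m' then complex_of_real (Cl l) else 0)"
    and J: "finite J" "\<And>l m. (l, m) \<in> J \<Longrightarrow> \<bar>m\<bar> \<le> int l"
  shows "nn_sq M (\<lambda>\<omega>. \<Sum>(l, m)\<in>J. w l m * fourier_coeff \<xi> l m \<omega>) = ennreal (\<Sum>(l, m)\<in>J. (cmod (w l m))\<^sup>2 * Cl l)"
proof -
  have "nn_sq M (\<lambda>\<omega>. \<Sum>j\<in>J. (case j of (l, m) \<Rightarrow> w l m) * (case j of (l, m) \<Rightarrow> fourier_coeff \<xi> l m) \<omega>)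
      = ennreal (\<Sum>j\<in>J. (cmod (case j of (l, m) \<Rightarrow> w l m))\<^sup>2 * (Cl (fst j)))"
  proof (rule nn_sq_orthogonal[OF J(1)])
    fix j assume "j \<in> J"
    then show "(case j of (l, m) \<Rightarrow> fourier_coeff \<xi> l m) \<in> borel_measurable M"
      "nn_sq M (case j of (l, m) \<Rightarrow> fourier_coeff \<xi> l m) < \<infinity>"
      using borel_measurable_fourier_coeff[OF prob_space_axioms \<xi> iso J(2)]
        nn_sq_fourier_coeff_finite[OF prob_space_axioms \<xi> iso J(2)] by (cases j; auto)+
  next
    fix j k assume jk: "j \<in> J" "k \<in> J"
    obtain l m l' m' where lm: "j = (l, m)" "k = (l', m')" by (cases j; cases k)
    show "(\<integral>\<omega>. (case j of (l, m) \<Rightarrow> fourier_coeff \<xi> l m) \<omega> * cnj ((case k of (l, m) \<Rightarrow> fourier_coeff \<xi> l m) \<omega>) \<partial>M)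
      = (if j = k then complex_of_real (Cl (fst j)) else 0)"
      using jk cov[OF J(2) J(2), of l m l' m'] by (simp add: lm)
  qed
  then show ?thesis by (simp add: case_prod_beta)
qed

text \<open>The integrand is |X|^2. This extracts the sign of the angular power spectrum
  \<open>Cl\<close> from the covariance formula.\<close>

lemma variance_coeff_nonneg:
  assumes "(\<integral>\<omega>. X \<omega> * cnj (X \<omega>) \<partial>M) = complex_of_real c"
  shows "0 \<le> c"
proof -
  have "(\<integral>\<omega>. X \<omega> * cnj (X \<omega>) \<partial>M) = complex_of_real (\<integral>\<omega>. (cmod (X \<omega>))\<^sup>2 \<partial>M)"
    unfolding complex_norm_square[symmetric] by (simp only: integral_complex_of_real)
  then have "c = (\<integral>\<omega>. (cmod (X \<omega>))\<^sup>2 \<partial>M)" using assms by simp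
  then show ?thesis by simp
qed

section \<open>Second moments of the solution field and of its increments\<close>

locale forced_fractional_diffusion = prob_space M for M :: "'w measure" +
  fixes \<alpha> \<tau> t :: real and \<xi> :: "real^3 \<Rightarrow> 'w \<Rightarrow> real" and Cl Al :: "nat \<Rightarrow> real"
    and \<beta>1 \<beta>2 :: "nat \<Rightarrow> nat \<Rightarrow> real \<Rightarrow> 'w \<Rightarrow> real"
  assumes \<alpha>: "0 < \<alpha>" "\<alpha> \<le> 1" and t: "0 < t"
    and \<xi>: "(\<lambda>(x, \<omega>). \<xi> x \<omega>) \<in> borel_measurable (S2_measure \<Otimes>\<^sub>M M)"
    and iso: "weakly_isotropic2 M \<xi>"
    and cov: "\<And>l m l' m'. \<bar>m\<bar> \<le> int l \<Longrightarrow> \<bar>m'\<bar> \<le> int l' \<Longrightarrow>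
           (\<integral>\<omega>. fourier_coeff \<xi> l m \<omega> * cnj (fourier_coeff \<xi> l' m' \<omega>) \<partial>M)
             = (if l = l' \<and> m = m' then complex_of_real (Cl l) else 0)"
    and Al: "\<And>l. 0 \<le> Al l"
    and bm: "\<And>i. i \<in> bm_index \<Longrightarrow> std_brownian_motion M (bm_family \<beta>1 \<beta>2 i)"
    and ind: "indep_vars (\<lambda>_. Pi\<^sub>M {0..} (\<lambda>_. borel))
           (\<lambda>i \<omega>. restrict (\<lambda>t. bm_family \<beta>1 \<beta>2 i t \<omega>) {0..}) bm_index"
begin

abbreviation u :: "nat \<Rightarrow> int \<Rightarrow> 'w \<Rightarrow> complex" where
  "u l m \<equiv> U_coeff M \<alpha> \<tau> \<xi> Al \<beta>1 \<beta>2 l m t"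

abbreviation S :: "real^3 \<Rightarrow> nat \<Rightarrow> 'w \<Rightarrow> complex" where
  "S x \<equiv> U_partial M \<alpha> \<tau> \<xi> Al \<beta>1 \<beta>2 x t"

abbreviation U :: "real^3 \<Rightarrow> 'w \<Rightarrow> complex" where
  "U x \<equiv> U_field M \<alpha> \<tau> \<xi> Al \<beta>1 \<beta>2 x t"

text \<open>Contribution of degree l: the factor 2 comes from splitting into homogeneous and forced
  parts, and 64 is twice the 32 of \<open>nn_sq_sum_IW\<close>. The maximum switches the forced
  share off up to time \<open>\<tau>\<close>.\<close>

definition var_bound :: "nat \<Rightarrow> real" where
  "var_bound l = 2 * Cl l + 64 * (max (t - \<tau>) 0 * Al l)"

lemma Cl_nonneg: "0 \<le> Cl l"
  using cov[of 0 l 0 l] by (intro variance_coeff_nonneg[of M "fourier_coeff \<xi> l 0"]) simp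

lemma var_bound_nonneg: "0 \<le> var_bound l"
  using Cl_nonneg[of l] Al[of l] by (simp add: var_bound_def)

lemma driving_noise:
  assumes "\<tau> < t"
  shows "driving_noise M \<beta>1 \<beta>2 Al (\<lambda>l s. mittag_leffler \<alpha> (- eigval l * (t - \<tau> - s) powr \<alpha>)) (t - \<tau>)"
proof unfold_locales
  show "continuous_on {0..t - \<tau>} (\<lambda>s. mittag_leffler \<alpha> (- eigval l * (t - \<tau> - s) powr \<alpha>))" for l
    by (rule continuous_on_mittag_leffler_powr[OF \<alpha>])
  show "\<bar>mittag_leffler \<alpha> (- eigval l * (t - \<tau> - s) powr \<alpha>)\<bar> \<le> 1" for l s
    using mittag_leffler_bounds[OF \<alpha>, of "- eigval l * (t - \<tau> - s) powr \<alpha>"] by (simp add: eigval_def)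
qed (use assms bm ind Al in auto)

lemma borel_measurable_u:
  assumes m: "\<bar>m\<bar> \<le> int l"
  shows "u l m \<in> borel_measurable M"
proof (cases "t \<le> \<tau>")
  case True
  then show ?thesis
    unfolding U_coeff_def[abs_def] using borel_measurable_fourier_coeff[OF prob_space_axioms \<xi> iso m] by simp
next
  case False
  then interpret driving_noise M \<beta>1 \<beta>2 Al "\<lambda>l s. mittag_leffler \<alpha> (- eigval l * (t - \<tau> - s) powr \<alpha>)" "t - \<tau>"
    by (intro driving_noise) simp
  show ?thesis
    unfolding U_coeff_def[abs_def]
    using borel_measurable_fourier_coeff[OF prob_space_axioms \<xi> iso m] borel_measurable_IW[OF m] False by simp
qed

lemma nn_sq_sum_u:
  assumes J: "finite J" "\<And>l m. (l, m) \<in> J \<Longrightarrow> \<bar>m\<bar> \<le> int l"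
  shows "nn_sq M (\<lambda>\<omega>. \<Sum>(l, m)\<in>J. w l m * u l m \<omega>) \<le> ennreal (\<Sum>(l, m)\<in>J. (cmod (w l m))\<^sup>2 * var_bound l)"
proof -
  define e where "e l = mittag_leffler \<alpha> (- eigval l * t powr \<alpha>)" for l
  have e: "(e l)\<^sup>2 \<le> 1" for l
    using mittag_leffler_bounds[OF \<alpha>, of "- eigval l * t powr \<alpha>"] by (simp add: e_def eigval_def abs_square_le_1)
  define H where "H l m \<omega> = complex_of_real (e l) * fourier_coeff \<xi> l m \<omega>" for l m \<omega>
  \<comment> \<open>Defined as the remainder, the forced part needs no case distinction until its
    second moment is estimated: it is 0 for t <= \<open>\<tau>\<close> and the Ito integral
    afterwards.\<close>
  define I where "I l m \<omega> = u l m \<omega> - H l m \<omega>" for l m \<omega>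
  let ?T = "max (t - \<tau>) 0"
  have Hm: "H l m \<in> borel_measurable M" if "(l, m) \<in> J" for l m
    unfolding H_def[abs_def] using borel_measurable_fourier_coeff[OF prob_space_axioms \<xi> iso J(2)[OF that]] by simp
  have Im: "I l m \<in> borel_measurable M" if "(l, m) \<in> J" for l m
    unfolding I_def[abs_def] using Hm[OF that] borel_measurable_u[OF J(2)[OF that]] by simp
  have "nn_sq M (\<lambda>\<omega>. \<Sum>(l, m)\<in>J. w l m * H l m \<omega>) = ennreal (\<Sum>(l, m)\<in>J. (cmod (w l m * complex_of_real (e l)))\<^sup>2 * Cl l)"
    unfolding H_def mult.assoc[symmetric] by (rule nn_sq_sum_fourier_coeff[OF \<xi> iso cov J])
  also have "\<dots> \<le> ennreal (\<Sum>(l, m)\<in>J. (cmod (w l m))\<^sup>2 * Cl l)"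
  proof (intro ennreal_leI sum_mono, clarify)
    fix l m
    have "(cmod (w l m))\<^sup>2 * (e l)\<^sup>2 * Cl l \<le> (cmod (w l m))\<^sup>2 * 1 * Cl l"
      by (intro mult_right_mono mult_left_mono e Cl_nonneg) simp
    then show "(cmod (w l m * complex_of_real (e l)))\<^sup>2 * Cl l \<le> (cmod (w l m))\<^sup>2 * Cl l"
      by (simp add: norm_mult power_mult_distrib)
  qed
  finally have H: "nn_sq M (\<lambda>\<omega>. \<Sum>(l, m)\<in>J. w l m * H l m \<omega>) \<le> ennreal (\<Sum>(l, m)\<in>J. (cmod (w l m))\<^sup>2 * Cl l)" .
  have I: "nn_sq M (\<lambda>\<omega>. \<Sum>(l, m)\<in>J. w l m * I l m \<omega>) \<le> ennreal (32 * (\<Sum>(l, m)\<in>J. (cmod (w l m))\<^sup>2 * (?T * Al l)))"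
  proof (cases "t \<le> \<tau>")
    case True
    then have "I l m \<omega> = 0" for l m \<omega> by (simp add: I_def H_def e_def U_coeff_def)
    then show ?thesis by (simp add: nn_sq_def)
  next
    case False
    then interpret driving_noise M \<beta>1 \<beta>2 Al "\<lambda>l s. mittag_leffler \<alpha> (- eigval l * (t - \<tau> - s) powr \<alpha>)" "t - \<tau>"
      by (intro driving_noise) simp
    have "I l m = IW l m" for l m using False by (simp add: I_def[abs_def] H_def e_def U_coeff_def)
    then show ?thesis using nn_sq_sum_IW[OF J, of w] False by simp
  qed
  have "nn_sq M (\<lambda>\<omega>. \<Sum>(l, m)\<in>J. w l m * u l m \<omega>)
      = nn_sq M (\<lambda>\<omega>. (\<Sum>(l, m)\<in>J. w l m * H l m \<omega>) + (\<Sum>(l, m)\<in>J. w l m * I l m \<omega>))"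
    unfolding sum.distrib[symmetric] by (simp add: I_def case_prod_beta algebra_simps)
  also have "\<dots> \<le> 2 * nn_sq M (\<lambda>\<omega>. \<Sum>(l, m)\<in>J. w l m * H l m \<omega>) + 2 * nn_sq M (\<lambda>\<omega>. \<Sum>(l, m)\<in>J. w l m * I l m \<omega>)"
    by (intro nn_sq_add) (auto intro!: borel_measurable_sum borel_measurable_times Hm Im simp: case_prod_beta)
  also have "\<dots> \<le> 2 * ennreal (\<Sum>(l, m)\<in>J. (cmod (w l m))\<^sup>2 * Cl l) + 2 * ennreal (32 * (\<Sum>(l, m)\<in>J. (cmod (w l m))\<^sup>2 * (?T * Al l)))"
    by (intro add_mono mult_left_mono H I) auto
  also have "\<dots> = ennreal (2 * (\<Sum>(l, m)\<in>J. (cmod (w l m))\<^sup>2 * Cl l) + 2 * (32 * (\<Sum>(l, m)\<in>J. (cmod (w l m))\<^sup>2 * (?T * Al l))))"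
  proof -
    have "0 \<le> (\<Sum>(l, m)\<in>J. (cmod (w l m))\<^sup>2 * Cl l)" "0 \<le> (\<Sum>(l, m)\<in>J. (cmod (w l m))\<^sup>2 * (?T * Al l))"
      using Cl_nonneg Al by (auto intro!: sum_nonneg)
    then show ?thesis by (simp add: ennreal_mult)
  qed
  also have "2 * (\<Sum>(l, m)\<in>J. (cmod (w l m))\<^sup>2 * Cl l) + 2 * (32 * (\<Sum>(l, m)\<in>J. (cmod (w l m))\<^sup>2 * (?T * Al l)))
      = (\<Sum>(l, m)\<in>J. (cmod (w l m))\<^sup>2 * var_bound l)"
    unfolding var_bound_def sum_distrib_left sum.distrib[symmetric] by (simp add: case_prod_beta algebra_simps)
  finally show ?thesis .
qed

lemma nn_sq_sum_u_levels:
  assumes "finite L"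
  shows "nn_sq M (\<lambda>\<omega>. \<Sum>l\<in>L. \<Sum>m\<in>{- int l..int l}. w l m * u l m \<omega>)
    \<le> ennreal (\<Sum>l\<in>L. var_bound l * (\<Sum>m\<in>{- int l..int l}. (cmod (w l m))\<^sup>2))"
proof -
  have "nn_sq M (\<lambda>\<omega>. \<Sum>(l, m)\<in>Sigma L (\<lambda>l. {- int l..int l}). w l m * u l m \<omega>)
     \<le> ennreal (\<Sum>(l, m)\<in>Sigma L (\<lambda>l. {- int l..int l}). (cmod (w l m))\<^sup>2 * var_bound l)"
    using assms by (intro nn_sq_sum_u) auto
  then show ?thesis
    using assms by (simp add: sum.Sigma sum_distrib_left mult.commute)
qed

lemma borel_measurable_S: "S x n \<in> borel_measurable M"
  unfolding U_partial_def[abs_def]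
  by (intro borel_measurable_sum borel_measurable_times borel_measurable_u borel_measurable_const) auto

text \<open>Unsoeld's identity turns the weights of degree l into 2 l + 1, so the second moments of
  the tails are bounded by tails of the series in \<open>summ\<close>.\<close>

lemma L2_Cauchy_S:
  assumes x: "x \<in> S2" and summ: "summable (\<lambda>l. var_bound l * (2 * real l + 1))"
  shows "L2_Cauchy M (S x)"
  unfolding L2_Cauchy_def
proof (intro conjI allI impI borel_measurable_S)
  fix e :: real assume e: "0 < e"
  then obtain N where N: "\<And>m n. N \<le> m \<Longrightarrow> norm (\<Sum>l\<in>{m..<n}. var_bound l * (2 * real l + 1)) < e"
    using summ unfolding summable_Cauchy by blast
  have le: "nn_sq M (\<lambda>\<omega>. S x n \<omega> - S x m \<omega>) \<le> ennreal e" if "N \<le> m" "m \<le> n" for m n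
  proof -
    have "S x n \<omega> - S x m \<omega> = (\<Sum>l\<in>{m..<n}. \<Sum>k\<in>{- int l..int l}. sph_harm l k x * u l k \<omega>)" for \<omega>
      unfolding U_partial_def lessThan_atLeast0 using that by (subst sum_diff_nat_ivl) (auto simp: mult.commute)
    then have "nn_sq M (\<lambda>\<omega>. S x n \<omega> - S x m \<omega>) = nn_sq M (\<lambda>\<omega>. \<Sum>l\<in>{m..<n}. \<Sum>k\<in>{- int l..int l}. sph_harm l k x * u l k \<omega>)"
      by simp
    also have "\<dots> \<le> ennreal (\<Sum>l\<in>{m..<n}. var_bound l * (\<Sum>k\<in>{- int l..int l}. (cmod (sph_harm l k x))\<^sup>2))"
      by (rule nn_sq_sum_u_levels) simp
    also have "\<dots> \<le> ennreal e"
      using N[OF that(1), of n] unfolding unsoeld[OF x] by (intro ennreal_leI) simp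
    finally show ?thesis .
  qed
  show "\<exists>N. \<forall>m\<ge>N. \<forall>n\<ge>N. nn_sq M (\<lambda>\<omega>. S x m \<omega> - S x n \<omega>) \<le> ennreal e"
  proof (intro exI allI impI)
    fix m n assume "N \<le> m" "N \<le> n"
    then show "nn_sq M (\<lambda>\<omega>. S x m \<omega> - S x n \<omega>) \<le> ennreal e"
      using le[of m n] le[of n m] nn_sq_uminus[of M "S x m" "S x n"] by (cases "m \<le> n") auto
  qed
qed

text \<open>The difference is taken between partial sums, where the harmonics at x and y can be
  subtracted degree by degree; a bound uniform in n then passes to the limit with a factor
  2.\<close>

lemma variance_U_diff_le:
  assumes x: "x \<in> S2" and y: "y \<in> S2" and summ: "summable (\<lambda>l. var_bound l * (2 * real l + 1))"
    and B: "\<And>n. (\<Sum>l<n. var_bound l * (\<Sum>m\<in>{- int l..int l}. (cmod (sph_harm l m x - sph_harm l m y))\<^sup>2)) \<le> B"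
  shows "variance (\<lambda>\<omega>. Re (U x \<omega> - U y \<omega>)) \<le> 2 * B"
proof -
  note U = L2_Cauchy_limit[OF L2_Cauchy_S[OF _ summ], folded U_field_def]
  note [measurable] = U(1)[OF x] U(1)[OF y] borel_measurable_S
  have B0: "0 \<le> B" using B[of 0] by simp
  have "nn_sq M (\<lambda>\<omega>. U x \<omega> - U y \<omega>) \<le> 2 * ennreal B"
  proof (rule nn_sq_le_of_tendsto)
    have "(\<lambda>n. nn_sq M (\<lambda>\<omega>. (S x n \<omega> - U x \<omega>) + (U y \<omega> - S y n \<omega>))) \<longlonglongrightarrow> 0"
    proof (rule nn_sq_tendsto_0_add)
      show "(\<lambda>n. nn_sq M (\<lambda>\<omega>. U y \<omega> - S y n \<omega>)) \<longlonglongrightarrow> 0"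
        using U(2)[OF y] by (subst nn_sq_uminus)
    qed (use U(2)[OF x] in measurable)
    then show "(\<lambda>n. nn_sq M (\<lambda>\<omega>. (S x n \<omega> - S y n \<omega>) - (U x \<omega> - U y \<omega>))) \<longlonglongrightarrow> 0"
      by (simp add: algebra_simps)
    fix n
    have "S x n \<omega> - S y n \<omega> = (\<Sum>l<n. \<Sum>m\<in>{- int l..int l}. (sph_harm l m x - sph_harm l m y) * u l m \<omega>)" for \<omega>
      unfolding U_partial_def sum_subtractf[symmetric] by (simp add: algebra_simps)
    then have "nn_sq M (\<lambda>\<omega>. S x n \<omega> - S y n \<omega>) = nn_sq M (\<lambda>\<omega>. \<Sum>l<n. \<Sum>m\<in>{- int l..int l}. (sph_harm l m x - sph_harm l m y) * u l m \<omega>)"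
      by simp
    also have "\<dots> \<le> ennreal (\<Sum>l<n. var_bound l * (\<Sum>m\<in>{- int l..int l}. (cmod (sph_harm l m x - sph_harm l m y))\<^sup>2))"
      by (rule nn_sq_sum_u_levels) simp
    also have "\<dots> \<le> ennreal B" by (intro ennreal_leI B)
    finally show "nn_sq M (\<lambda>\<omega>. S x n \<omega> - S y n \<omega>) \<le> ennreal B" .
  qed measurable
  also have "2 * ennreal B = ennreal (2 * B)" using B0 by (simp add: ennreal_mult)
  finally show ?thesis
    using B0 by (intro variance_Re_le) auto
qed

end

text \<open>With r = l d the two available bounds are of order l r^2 and l. For r <= 1 the first,
  and for r > 1 the second, is at most of order l r^(2 beta).\<close>

lemma sph_harm_hoelder:
  assumes x: "x \<in> S2" and y: "y \<in> S2" and \<beta>: "0 < \<beta>" "\<beta> \<le> 1"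
  shows "(\<Sum>m\<in>{- int l..int l}. (cmod (sph_harm l m x - sph_harm l m y))\<^sup>2)
    \<le> 108 * real l powr (1 + 2 * \<beta>) * geodesic_dist x y powr (2 * \<beta>)" (is "?G \<le> _")
proof (cases "l = 0")
  case True
  then show ?thesis using sph_harm_lipschitz[OF x y, of l] by simp
next
  case False
  let ?\<theta> = "geodesic_dist x y"
  have l: "1 \<le> real l" using False by simp
  have \<theta>: "0 \<le> ?\<theta>" unfolding geodesic_dist_def
    using Cauchy_Schwarz_ineq2[of x y] x y by (intro arccos_lbound) auto
  define r where "r = real l * ?\<theta>"
  have r0: "0 \<le> r" using \<theta> by (simp add: r_def)
  have "?G \<le> 108 * real l * r powr (2 * \<beta>)"
  proof (cases "r \<le> 1")
    case True
    have "?G \<le> 18 * (real l * (real l + 1)) * (2 * real l + 1) * ?\<theta>\<^sup>2"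
      by (rule sph_harm_lipschitz[OF x y])
    \<comment> \<open>For l >= 1 one has l + 1 <= 2 l and 2 l + 1 <= 3 l; hence 108 = 18 times 2
      times 3.\<close>
    also have "\<dots> \<le> 18 * (real l * (2 * real l)) * (3 * real l) * ?\<theta>\<^sup>2"
      using l by (intro mult_right_mono mult_mono mult_left_mono) auto
    also have "\<dots> = 108 * real l * r\<^sup>2" by (simp add: r_def power2_eq_square)
    also have "\<dots> \<le> 108 * real l * r powr (2 * \<beta>)"
    proof (intro mult_left_mono)
      show "r\<^sup>2 \<le> r powr (2 * \<beta>)"
      proof (cases "r = 0")
        case False
        then have "r powr 2 \<le> r powr (2 * \<beta>)" using r0 True \<beta> by (intro powr_mono') auto
        then show ?thesis using False r0 by (simp add: powr_numeral)
      qed simp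
    qed simp
    finally show ?thesis .
  next
    case False
    have sq: "(cmod (a - b))\<^sup>2 \<le> 2 * (cmod a)\<^sup>2 + 2 * (cmod b)\<^sup>2" for a b
      using cmod_add_sq_le[of a "- b"] by simp
    have "?G \<le> (\<Sum>m\<in>{- int l..int l}. 2 * (cmod (sph_harm l m x))\<^sup>2 + 2 * (cmod (sph_harm l m y))\<^sup>2)"
      by (intro sum_mono sq)
    also have "\<dots> = 4 * (2 * real l + 1)"
      by (simp only: sum.distrib sum_distrib_left[symmetric] unsoeld[OF x] unsoeld[OF y])
    also have "\<dots> \<le> 108 * real l * 1" using l by simp
    also have "\<dots> \<le> 108 * real l * r powr (2 * \<beta>)"
      using False \<beta> by (intro mult_left_mono ge_one_powr_ge_zero) auto
    finally show ?thesis .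
  qed
  also have "\<dots> = 108 * real l powr (1 + 2 * \<beta>) * ?\<theta> powr (2 * \<beta>)"
    using l \<theta> by (simp add: r_def powr_mult powr_add)
  finally show ?thesis .
qed

theorem theorem4:
  fixes M :: "'w measure"
    and \<alpha> \<tau> \<beta>s D C K A\<^sub>0 \<kappa>1 \<kappa>2 :: real
    and \<xi> :: "real^3 \<Rightarrow> 'w \<Rightarrow> real"
    and Cl Al :: "nat \<Rightarrow> real"
    and \<beta>1 \<beta>2 :: "nat \<Rightarrow> nat \<Rightarrow> real \<Rightarrow> 'w \<Rightarrow> real"
  assumes "prob_space M"
    and "0 < \<alpha>" "\<alpha> \<le> 1" "0 < \<tau>"
    \<comment> \<open>the random field xi\<close>
    and "(\<lambda>(x, \<omega>). \<xi> x \<omega>) \<in> borel_measurable (S2_measure \<Otimes>\<^sub>M M)"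
    and "centred_field M \<xi>" "gaussian_field M \<xi>" "weakly_isotropic2 M \<xi>"
    and "\<And>l m l' m'. \<bar>m\<bar> \<le> int l \<Longrightarrow> \<bar>m'\<bar> \<le> int l' \<Longrightarrow>
           (\<integral>\<omega>. fourier_coeff \<xi> l m \<omega> * cnj (fourier_coeff \<xi> l' m' \<omega>) \<partial>M)
             = (if l = l' \<and> m = m' then complex_of_real (Cl l) else 0)"
    \<comment> \<open>the driving Brownian motions, independent of each other and of xi\<close>
    and "\<And>l. 0 \<le> Al l"
    and "\<And>i. i \<in> bm_index \<Longrightarrow> std_brownian_motion M (bm_family \<beta>1 \<beta>2 i)"
    and "prob_space.indep_vars M (\<lambda>_. Pi\<^sub>M {0..} (\<lambda>_. borel))
           (\<lambda>i \<omega>. restrict (\<lambda>t. bm_family \<beta>1 \<beta>2 i t \<omega>) {0..}) bm_index"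
    and "indep_elems M (Pi\<^sub>M S2 (\<lambda>_. borel)) (\<lambda>\<omega>. restrict (\<lambda>x. \<xi> x \<omega>) S2)
           (Pi\<^sub>M bm_index (\<lambda>_. Pi\<^sub>M {0..} (\<lambda>_. borel)))
           (\<lambda>\<omega>. restrict (\<lambda>i. restrict (\<lambda>t. bm_family \<beta>1 \<beta>2 i t \<omega>) {0..}) bm_index)"
    \<comment> \<open>decay hypotheses\<close>
    and "0 < \<beta>s" "\<beta>s \<le> 1"
    and "0 < D" "0 < C" "0 < K" "0 < A\<^sub>0"
    and "\<kappa>1 > 2 * (1 + \<beta>s)" "\<kappa>2 > 2 * (1 + \<beta>s)"
    and "Cl 0 \<le> D" "\<And>l. l \<ge> 1 \<Longrightarrow> Cl l \<le> C * real l powr (- \<kappa>1)"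
    and "Al 0 \<le> K" "\<And>l. l \<ge> 1 \<Longrightarrow> Al l \<le> A\<^sub>0 * real l powr (- \<kappa>2)"
  shows "\<forall>t>0. \<exists>K\<^sub>\<beta>>0. \<forall>x\<in>S2. \<forall>y\<in>S2.
           prob_space.variance M
             (\<lambda>\<omega>. Re (U_field M \<alpha> \<tau> \<xi> Al \<beta>1 \<beta>2 x t \<omega> - U_field M \<alpha> \<tau> \<xi> Al \<beta>1 \<beta>2 y t \<omega>))
           \<le> K\<^sub>\<beta> * (geodesic_dist x y) powr (2 * \<beta>s)"
proof (intro allI impI)
  fix t :: real assume t: "0 < t"
  interpret forced_fractional_diffusion M \<alpha> \<tau> t \<xi> Cl Al \<beta>1 \<beta>2
    using assms t by (intro forced_fractional_diffusion.intro forced_fractional_diffusion_axioms.intro) auto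
  \<comment> \<open>For l >= 1 the smaller exponent serves both spectra.\<close>
  define \<kappa> where "\<kappa> = min \<kappa>1 \<kappa>2"
  have \<kappa>: "2 * (1 + \<beta>s) < \<kappa>" using assms by (simp add: \<kappa>_def)
  define B where "B = 2 * C + 64 * (max (t - \<tau>) 0 * A\<^sub>0)"
  have B: "0 < B" using assms unfolding B_def by (intro add_pos_nonneg) auto
  have vb: "var_bound l \<le> B * real l powr (- \<kappa>)" if l: "1 \<le> l" for l
  proof -
    have p: "real l powr (- \<kappa>1) \<le> real l powr (- \<kappa>)" "real l powr (- \<kappa>2) \<le> real l powr (- \<kappa>)"
      using l by (auto intro!: powr_mono simp: \<kappa>_def)
    have "Cl l \<le> C * real l powr (- \<kappa>)"
      using assms(17) by (intro order_trans[OF assms(23)[OF l]] mult_left_mono p) simp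
    moreover have "Al l \<le> A\<^sub>0 * real l powr (- \<kappa>)"
      using assms(19) by (intro order_trans[OF assms(25)[OF l]] mult_left_mono p) simp
    ultimately have "var_bound l \<le> 2 * (C * real l powr (- \<kappa>)) + 64 * (max (t - \<tau>) 0 * (A\<^sub>0 * real l powr (- \<kappa>)))"
      unfolding var_bound_def by (intro add_mono mult_left_mono) auto
    then show ?thesis by (simp add: B_def algebra_simps)
  qed
  \<comment> \<open>The factor 108 is that of \<open>sph_harm_hoelder\<close>. The exponent lies
    below -1 precisely because \<open>\<kappa>\<close> exceeds 2 (1 +
    \<open>\<beta>s\<close>).\<close>
  define b where "b l = 108 * B * real l powr (1 + 2 * \<beta>s - \<kappa>)" for l :: nat
  have b0: "0 \<le> b l" for l using B by (simp add: b_def)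
  have sb: "summable b"
    unfolding b_def[abs_def] using \<kappa> by (intro summable_mult) (simp add: summable_real_powr_iff)
  have summ: "summable (\<lambda>l. var_bound l * (2 * real l + 1))"
  \<comment> \<open>The power bounds are available from l = 1 on, which suffices for
    convergence.\<close>
  proof (rule summable_comparison_test'[OF sb, of 1])
    fix l :: nat assume l: "1 \<le> l"
    have "var_bound l * (2 * real l + 1) \<le> (B * real l powr (- \<kappa>)) * (3 * real l powr 1)"
      using l vb[OF l] var_bound_nonneg B by (intro mult_mono) auto
    also have "\<dots> = 3 * B * real l powr (1 - \<kappa>)"
      using powr_add[of "real l" 1 "- \<kappa>"] l by (simp add: mult_ac)
    also have "\<dots> \<le> 108 * B * real l powr (1 + 2 * \<beta>s - \<kappa>)"
      using l B assms by (intro mult_mono powr_mono) auto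
    finally show "norm (var_bound l * (2 * real l + 1)) \<le> b l"
      using var_bound_nonneg by (simp add: b_def)
  qed
  \<comment> \<open>The added 1 makes the constant positive as soon as the sum of b is
    nonnegative.\<close>
  have "variance (\<lambda>\<omega>. Re (U x \<omega> - U y \<omega>)) \<le> (2 * suminf b + 1) * geodesic_dist x y powr (2 * \<beta>s)"
    if x: "x \<in> S2" and y: "y \<in> S2" for x y
  proof -
    let ?d = "geodesic_dist x y powr (2 * \<beta>s)"
    have "variance (\<lambda>\<omega>. Re (U x \<omega> - U y \<omega>)) \<le> 2 * (suminf b * ?d)"
    proof (rule variance_U_diff_le[OF x y summ])
      fix n
      have "(\<Sum>l<n. var_bound l * (\<Sum>m\<in>{- int l..int l}. (cmod (sph_harm l m x - sph_harm l m y))\<^sup>2)) \<le> (\<Sum>l<n. b l * ?d)"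
      proof (intro sum_mono)
        fix l
        have "var_bound l * (\<Sum>m\<in>{- int l..int l}. (cmod (sph_harm l m x - sph_harm l m y))\<^sup>2)
          \<le> var_bound l * (108 * real l powr (1 + 2 * \<beta>s) * ?d)"
          using assms by (intro mult_left_mono sph_harm_hoelder x y var_bound_nonneg) auto
        also have "\<dots> \<le> b l * ?d"
        \<comment> \<open>At l = 0 both sides are 0, since \<open>powr\<close> with base 0 is 0; the
          harmonic of degree 0 is constant and contributes nothing to increments.\<close>
        proof (cases "l = 0")
          case False
          then have "var_bound l * (108 * real l powr (1 + 2 * \<beta>s) * ?d)
              \<le> (B * real l powr (- \<kappa>)) * (108 * real l powr (1 + 2 * \<beta>s) * ?d)"
            by (intro mult_right_mono vb) auto
          also have "\<dots> = 108 * B * (real l powr (1 + 2 * \<beta>s) * real l powr (- \<kappa>)) * ?d"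
            by (simp only: mult_ac)
          also have "\<dots> = b l * ?d"
            by (simp add: b_def flip: powr_add)
          finally show ?thesis .
        qed (simp add: b_def)
        finally show "var_bound l * (\<Sum>m\<in>{- int l..int l}. (cmod (sph_harm l m x - sph_harm l m y))\<^sup>2) \<le> b l * ?d" .
      qed
      also have "\<dots> = (\<Sum>l<n. b l) * ?d" by (simp add: sum_distrib_right)
      also have "\<dots> \<le> suminf b * ?d"
        by (intro mult_right_mono sum_le_suminf sb b0) auto
      finally show "(\<Sum>l<n. var_bound l * (\<Sum>m\<in>{- int l..int l}. (cmod (sph_harm l m x - sph_harm l m y))\<^sup>2)) \<le> suminf b * ?d" .
    qed
    also have "\<dots> \<le> (2 * suminf b + 1) * ?d" by (simp add: algebra_simps)
    finally show ?thesis .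
  qed
  moreover have "0 < 2 * suminf b + 1"
    using suminf_nonneg[OF sb b0] by simp
  ultimately show "\<exists>K\<^sub>\<beta>>0. \<forall>x\<in>S2. \<forall>y\<in>S2. variance (\<lambda>\<omega>. Re (U x \<omega> - U y \<omega>)) \<le> K\<^sub>\<beta> * geodesic_dist x y powr (2 * \<beta>s)"
    by blast
qed

end
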